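(* Let $(R,\mathfrak{m})$ be a commutative Noetherian local ring of prime characteristic $p>0$ and dimension $d$. Suppose there is an $e_0\in\mathbb{N}$, depending only on $R$, such that for every $e\ge e_0$ and every filter regular system of parameters $x_1,\dots,x_d$ of $R$, writing $\mathfrak{q}=(x_1,\dots,x_d)$, $\mathfrak{q}_i=(x_1,\dots,x_i)$ for $1\le i\le d$ and $\mathfrak{q}_0=0$, we have $$\alpha_e^{-1}\left(0^{f_R}_{H^j_{\mathfrak{m}}\left(R/\mathfrak{q}_i^{[p^e]}\right)}\right)=0^{f_R}_{H^j_{\mathfrak{m}}\left(R/\mathfrak{q}_{i-1}^{[p^e]}\right)}$$ for all integers $i\ge 1$ and $j\ge 0$ with $i+j\le d$, where $\alpha_e: H^j_{\mathfrak{m}}\left(R/\mathfrak{q}_{i-1}^{[p^e]}\right)\to H^j_{\mathfrak{m}}\left(R/\mathfrak{q}_i^{[p^e]}\right)$ is the map induced by the natural projection $R/\mathfrak{q}_{i-1}^{[p^e]}\to R/\mathfrak{q}_i^{[p^e]}$. Then $$\operatorname{Fte}(R)\le e_0+\sum_{k=0}^{d}\binom{d}{k}\operatorname{HSL}\left(H^k_{\mathfrak{m}}(R)\right).$$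
   Context: $\mathbb{N}$ contains $0$. For an ideal $I\subset R$ and $e\in\mathbb{N}$, $I^{[p^e]}$ is the ideal generated by $\{x^{p^e}: x\in I\}$. The Frobenius closure of $I$ is $I^F=\{x\in R: x^{p^e}\in I^{[p^e]}\text{ for all } e\gg 0\}$. A parameter ideal is an ideal generated by a full system of $d$ parameters of $R$. The Frobenius test exponent of $R$ is $$\operatorname{Fte}(R)=\inf\{e\in\mathbb{N}: (\mathfrak{q}^F)^{[p^e]}=\mathfrak{q}^{[p^e]}\text{ for all parameter ideals }\mathfrak{q}\subset R\}\in\mathbb{N}\cup\{\infty\}.$$ A sequence $x_1,\dots,x_t$ of elements of $\mathfrak{m}$ is filter regular if for each $1\le i\le t$, $x_i\notin\mathfrak{p}$ for every $\mathfrak{p}\in\operatorname{Ass}_R(R/(x_1,\dots,x_{i-1}))$ with $\mathfrak{p}\ne\mathfrak{m}$. A filter regular system of parameters is a full system of $d$ parameters that is a filter regular sequence. A Frobenius action on an $R$-module $M$ is an additive map $f:M\to M$ with $f(xm)=x^pf(m)$ for $x\in R$, $m\in M$. Put $0^f_M=\{m\in M: f^e(m)=0\text{ for some }e\in\mathbb{N}\}$ and $\operatorname{HSL}(M)=\inf\{e\in\mathbb{N}: f^e(0^f_M)=0\}\in\mathbb{N}\cup\{\infty\}$ (the Hartshorne-Speiser-Lyubeznik number). Each $H^k_{\mathfrak{m}}(R)$ carries the standard Frobenius action induced by the Frobenius endomorphism of $R$ (applied termwise to the localizations in a Čech complex), and $\operatorname{HSL}(H^k_{\mathfrak{m}}(R))$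 is taken with respect to it. For an ideal $J\subset R$ and $e\in\mathbb{N}$, the relative Frobenius map $f_R^e: R/J\to R/J^{[p^e]}$, $x+J\mapsto x^{p^e}+J^{[p^e]}$, induces (via Čech complexes) $p^e$-linear maps $f_R^e: H^j_{\mathfrak{m}}(R/J)\to H^j_{\mathfrak{m}}(R/J^{[p^e]})$. The relative Frobenius closure of zero is the submodule $$0^{f_R}_{H^j_{\mathfrak{m}}(R/J)}=\{\xi\in H^j_{\mathfrak{m}}(R/J): f_R^e(\xi)=0\in H^j_{\mathfrak{m}}(R/J^{[p^e]})\text{ for some }e\in\mathbb{N}\}.$$ *)

theory Defs
  imports "HOL-Computational_Algebra.Primes" "HOL-Algebra.Ring_Divisibility" "HOL-Algebra.Module" "HOL-Library.Extended_Nat"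
begin

section \<open>Noetherian local rings, parameters, Frobenius closure\<close>

locale noetherian_local_ring = noetherian_ring R + cring R for R (structure) +
  fixes \<mm>
  assumes maximal: "maximalideal \<mm> R"
    and unique_maximal: "maximalideal I R \<Longrightarrow> I = \<mm>"

definition krull_dim :: "('a, 'r) ring_scheme \<Rightarrow> enat" where
  "krull_dim R = Sup {enat n | n. \<exists>P :: nat \<Rightarrow> 'a set.
     (\<forall>i\<le>n. primeideal (P i) R) \<and> (\<forall>i<n. P i \<subset> P (Suc i))}"

definition radical :: "('a, 'r) ring_scheme \<Rightarrow> 'a set \<Rightarrow> 'a set" where
  "radical R I = {x \<in> carrier R. \<exists>n::nat. x [^]\<^bsub>R\<^esub> n \<in> I}"

text \<open>A full system of parameters of a local ring \<open>(R, \<mm>)\<close>: a sequence of \<open>dim R\<close> elements of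
  \<open>\<mm>\<close> that generates an \<open>\<mm>\<close>-primary ideal.\<close>

definition system_of_parameters :: "('a, 'r) ring_scheme \<Rightarrow> 'a set \<Rightarrow> 'a list \<Rightarrow> bool" where
  "system_of_parameters R \<mm> xs \<longleftrightarrow>
     set xs \<subseteq> \<mm> \<and> enat (length xs) = krull_dim R \<and> radical R (Idl\<^bsub>R\<^esub> (set xs)) = \<mm>"

definition parameter_ideal :: "('a, 'r) ring_scheme \<Rightarrow> 'a set \<Rightarrow> 'a set \<Rightarrow> bool" where
  "parameter_ideal R \<mm> Q \<longleftrightarrow> (\<exists>xs. system_of_parameters R \<mm> xs \<and> Q = Idl\<^bsub>R\<^esub> (set xs))"

text \<open>The Frobenius power \<open>I\<^sup>[\<^sup>q\<^sup>]\<close>; it is only used with \<open>q\<close> a power of the characteristic.\<close>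

definition frobenius_power :: "('a, 'r) ring_scheme \<Rightarrow> 'a set \<Rightarrow> nat \<Rightarrow> 'a set" where
  "frobenius_power R I q = Idl\<^bsub>R\<^esub> ((\<lambda>x. x [^]\<^bsub>R\<^esub> q) ` I)"

definition frobenius_closure :: "('a, 'r) ring_scheme \<Rightarrow> nat \<Rightarrow> 'a set \<Rightarrow> 'a set" where
  "frobenius_closure R p I =
     {x \<in> carrier R. \<exists>e'. \<forall>e\<ge>e'. x [^]\<^bsub>R\<^esub> (p ^ e) \<in> frobenius_power R I (p ^ e)}"

definition Fte :: "('a, 'r) ring_scheme \<Rightarrow> 'a set \<Rightarrow> nat \<Rightarrow> enat" where
  "Fte R \<mm> p = Inf {enat e | e. \<forall>Q. parameter_ideal R \<mm> Q \<longrightarrow>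
     frobenius_power R (frobenius_closure R p Q) (p ^ e) = frobenius_power R Q (p ^ e)}"


section \<open>Modules\<close>

text \<open>The \<^typ>\<open>('a, 'b) module\<close> record extends the ring record; the fields \<open>mult\<close> and \<open>one\<close> carry
  no meaning for the modules below and are left \<^term>\<open>undefined\<close>.\<close>

definition regular_module :: "('a, 'r) ring_scheme \<Rightarrow> ('a, 'a) module" where
  "regular_module R = \<lparr>carrier = carrier R, mult = mult R, one = \<one>\<^bsub>R\<^esub>,
     zero = \<zero>\<^bsub>R\<^esub>, add = add R, smult = mult R\<rparr>"

definition quot_module :: "('a, 'b, 'm) module_scheme \<Rightarrow> 'b set \<Rightarrow> ('a, 'b set) module" where
  "quot_module M N = \<lparr>carrier = a_rcosets\<^bsub>M\<^esub> N, mult = undefined, one = undefined,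
     zero = N, add = set_add M, smult = (\<lambda>r X. \<Union>x\<in>X. N +>\<^bsub>M\<^esub> (r \<odot>\<^bsub>M\<^esub> x))\<rparr>"

abbreviation ring_mod_ideal :: "('a, 'r) ring_scheme \<Rightarrow> 'a set \<Rightarrow> ('a, 'a set) module" where
  "ring_mod_ideal R I \<equiv> quot_module (regular_module R) I"

definition Ass :: "('a, 'r) ring_scheme \<Rightarrow> ('a, 'b, 'm) module_scheme \<Rightarrow> 'a set set" where
  "Ass R M = {P. primeideal P R \<and>
     (\<exists>x\<in>carrier M. P = {r \<in> carrier R. r \<odot>\<^bsub>M\<^esub> x = \<zero>\<^bsub>M\<^esub>})}"

definition filter_regular :: "('a, 'r) ring_scheme \<Rightarrow> 'a set \<Rightarrow> 'a list \<Rightarrow> bool" where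
  "filter_regular R \<mm> xs \<longleftrightarrow> set xs \<subseteq> \<mm> \<and>
     (\<forall>i<length xs. \<forall>P\<in>Ass R (ring_mod_ideal R (Idl\<^bsub>R\<^esub> (set (take i xs)))).
        P \<noteq> \<mm> \<longrightarrow> xs ! i \<notin> P)"


section \<open>Localization of a module at an element\<close>

text \<open>The pair \<open>(a, n)\<close> stands for the fraction \<open>a / y\<^sup>n\<close> in \<open>M\<^sub>y\<close>. Elements of \<open>M\<^sub>y\<close> are classes of
  such pairs. Operations on classes are written as unions over representatives; as the operations
  respect the relation, such a union is a single class.\<close>

definition loc_rel ::
  "('a, 'r) ring_scheme \<Rightarrow> ('a, 'b, 'm) module_scheme \<Rightarrow> 'a \<Rightarrow> (('b \<times> nat) \<times> ('b \<times> nat)) set" where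
  "loc_rel R M y = {((a, n), (b, k)). a \<in> carrier M \<and> b \<in> carrier M \<and>
     (\<exists>l::nat. (y [^]\<^bsub>R\<^esub> l) \<odot>\<^bsub>M\<^esub> ((y [^]\<^bsub>R\<^esub> k) \<odot>\<^bsub>M\<^esub> a) = (y [^]\<^bsub>R\<^esub> l) \<odot>\<^bsub>M\<^esub> ((y [^]\<^bsub>R\<^esub> n) \<odot>\<^bsub>M\<^esub> b))}"

definition loc_frac ::
  "('a, 'r) ring_scheme \<Rightarrow> ('a, 'b, 'm) module_scheme \<Rightarrow> 'a \<Rightarrow> 'b \<Rightarrow> nat \<Rightarrow> ('b \<times> nat) set" where
  "loc_frac R M y a n = loc_rel R M y `` {(a, n)}"

definition loc_module ::
  "('a, 'r) ring_scheme \<Rightarrow> ('a, 'b, 'm) module_scheme \<Rightarrow> 'a \<Rightarrow> ('a, ('b \<times> nat) set) module" where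
  "loc_module R M y = \<lparr>carrier = (carrier M \<times> UNIV) // loc_rel R M y,
     mult = undefined, one = undefined, zero = loc_frac R M y \<zero>\<^bsub>M\<^esub> 0,
     add = (\<lambda>X Y. \<Union>(a, n)\<in>X. \<Union>(b, k)\<in>Y. loc_frac R M y
              (((y [^]\<^bsub>R\<^esub> k) \<odot>\<^bsub>M\<^esub> a) \<oplus>\<^bsub>M\<^esub> ((y [^]\<^bsub>R\<^esub> n) \<odot>\<^bsub>M\<^esub> b)) (n + k)),
     smult = (\<lambda>r X. \<Union>(a, n)\<in>X. loc_frac R M y (r \<odot>\<^bsub>M\<^esub> a) n)\<rparr>"

text \<open>The map \<open>M\<^sub>y \<rightarrow> N\<^sub>y\<close>, \<open>a / y\<^sup>n \<mapsto> g a / y\<^sup>q\<^sup>n\<close>, induced by a \<open>q\<close>-linear map \<open>g: M \<rightarrow> N\<close>, i.e. an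
  additive map with \<open>g (r a) = r\<^sup>q (g a)\<close>. For \<open>q = 1\<close> it is the localization of a linear map.\<close>

definition loc_map ::
  "('a, 'r) ring_scheme \<Rightarrow> ('a, 'c, 'n) module_scheme \<Rightarrow> 'a \<Rightarrow> nat \<Rightarrow> ('b \<Rightarrow> 'c)
     \<Rightarrow> ('b \<times> nat) set \<Rightarrow> ('c \<times> nat) set" where
  "loc_map R N y q g X = (\<Union>(a, n)\<in>X. loc_frac R N y (g a) (q * n))"

text \<open>The canonical map \<open>M\<^sub>y \<rightarrow> M\<^sub>y\<^sub>z\<close>, \<open>a / y\<^sup>n \<mapsto> z\<^sup>n a / (y z)\<^sup>n\<close>.\<close>

definition loc_res ::
  "('a, 'r) ring_scheme \<Rightarrow> ('a, 'b, 'm) module_scheme \<Rightarrow> 'a \<Rightarrow> 'a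
     \<Rightarrow> ('b \<times> nat) set \<Rightarrow> ('b \<times> nat) set" where
  "loc_res R M y z X = (\<Union>(a, n)\<in>X. loc_frac R M (y \<otimes>\<^bsub>R\<^esub> z) ((z [^]\<^bsub>R\<^esub> n) \<odot>\<^bsub>M\<^esub> a) n)"


section \<open>Cech cohomology\<close>

text \<open>The Cech complex of \<open>M\<close> on \<open>y\<^sub>0, \<dots>, y\<^sub>n\<^sub>-\<^sub>1\<close> has in degree \<open>k\<close> the direct sum of the localizations
  of \<open>M\<close> at \<open>y\<^sub>A = (\<Prod>i\<in>A. y\<^sub>i)\<close>, where \<open>A\<close> ranges over the \<open>k\<close>-element subsets of \<open>{0, \<dots>, n - 1}\<close>.\<close>

definition cech_index :: "'a list \<Rightarrow> nat \<Rightarrow> nat set set" where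
  "cech_index ys k = {A. A \<subseteq> {..<length ys} \<and> card A = k}"

definition cech_elt :: "('a, 'r) ring_scheme \<Rightarrow> 'a list \<Rightarrow> nat set \<Rightarrow> 'a" where
  "cech_elt R ys A = (\<Otimes>\<^bsub>R\<^esub>i\<in>A. ys ! i)"

abbreviation cech_loc ::
  "('a, 'r) ring_scheme \<Rightarrow> 'a list \<Rightarrow> ('a, 'b, 'm) module_scheme \<Rightarrow> nat set
     \<Rightarrow> ('a, ('b \<times> nat) set) module" where
  "cech_loc R ys M A \<equiv> loc_module R M (cech_elt R ys A)"

definition cech_module ::
  "('a, 'r) ring_scheme \<Rightarrow> 'a list \<Rightarrow> ('a, 'b, 'm) module_scheme \<Rightarrow> nat
     \<Rightarrow> ('a, nat set \<Rightarrow> ('b \<times> nat) set) module" where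
  "cech_module R ys M k = \<lparr>carrier = (\<Pi>\<^sub>E A\<in>cech_index ys k. carrier (cech_loc R ys M A)),
     mult = undefined, one = undefined,
     zero = (\<lambda>A\<in>cech_index ys k. \<zero>\<^bsub>cech_loc R ys M A\<^esub>),
     add = (\<lambda>c c'. \<lambda>A\<in>cech_index ys k. c A \<oplus>\<^bsub>cech_loc R ys M A\<^esub> c' A),
     smult = (\<lambda>r c. \<lambda>A\<in>cech_index ys k. r \<odot>\<^bsub>cech_loc R ys M A\<^esub> c A)\<rparr>"

text \<open>The component at \<open>B = {b\<^sub>0 < \<dots> < b\<^sub>k}\<close> of the differential is the sum over \<open>s\<close> of \<open>(-1)\<^sup>s\<close> times
  the image of the component at \<open>B - {b\<^sub>s}\<close>; here \<open>s\<close> is the number of elements of \<open>B\<close> below \<open>b\<^sub>s\<close>.\<close>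

definition cech_diff ::
  "('a, 'r) ring_scheme \<Rightarrow> 'a list \<Rightarrow> ('a, 'b, 'm) module_scheme \<Rightarrow> nat
     \<Rightarrow> (nat set \<Rightarrow> ('b \<times> nat) set) \<Rightarrow> (nat set \<Rightarrow> ('b \<times> nat) set)" where
  "cech_diff R ys M k c = (\<lambda>B\<in>cech_index ys (Suc k). \<Oplus>\<^bsub>cech_loc R ys M B\<^esub>b\<in>B.
     (let x = loc_res R M (cech_elt R ys (B - {b})) (ys ! b) (c (B - {b}))
      in if even (card {b'\<in>B. b' < b}) then x else \<ominus>\<^bsub>cech_loc R ys M B\<^esub> x))"

definition cech_cocycles ::
  "('a, 'r) ring_scheme \<Rightarrow> 'a list \<Rightarrow> ('a, 'b, 'm) module_scheme \<Rightarrow> nat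
     \<Rightarrow> (nat set \<Rightarrow> ('b \<times> nat) set) set" where
  "cech_cocycles R ys M k =
     {c \<in> carrier (cech_module R ys M k). cech_diff R ys M k c = \<zero>\<^bsub>cech_module R ys M (Suc k)\<^esub>}"

definition cech_coboundaries ::
  "('a, 'r) ring_scheme \<Rightarrow> 'a list \<Rightarrow> ('a, 'b, 'm) module_scheme \<Rightarrow> nat
     \<Rightarrow> (nat set \<Rightarrow> ('b \<times> nat) set) set" where
  "cech_coboundaries R ys M k = (case k of
       0 \<Rightarrow> {\<zero>\<^bsub>cech_module R ys M 0\<^esub>}
     | Suc k' \<Rightarrow> cech_diff R ys M k' ` carrier (cech_module R ys M k'))"

text \<open>If \<open>ys\<close> generates an ideal with radical \<open>\<mm>\<close>, this is the local cohomology module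
  \<open>H\<^sup>k\<^sub>\<mm>(M)\<close>.\<close>

definition cech_cohomology ::
  "('a, 'r) ring_scheme \<Rightarrow> 'a list \<Rightarrow> ('a, 'b, 'm) module_scheme \<Rightarrow> nat
     \<Rightarrow> ('a, (nat set \<Rightarrow> ('b \<times> nat) set) set) module" where
  "cech_cohomology R ys M k =
     quot_module ((cech_module R ys M k)\<lparr>carrier := cech_cocycles R ys M k\<rparr>)
       (cech_coboundaries R ys M k)"

text \<open>The map \<open>H\<^sup>k(M) \<rightarrow> H\<^sup>k(N)\<close> induced by a \<open>q\<close>-linear map \<open>g: M \<rightarrow> N\<close> (termwise on the Cech
  complexes).\<close>

definition cech_map ::
  "('a, 'r) ring_scheme \<Rightarrow> 'a list \<Rightarrow> ('a, 'c, 'n) module_scheme \<Rightarrow> nat \<Rightarrow> nat \<Rightarrow> ('b \<Rightarrow> 'c)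
     \<Rightarrow> (nat set \<Rightarrow> ('b \<times> nat) set) \<Rightarrow> (nat set \<Rightarrow> ('c \<times> nat) set)" where
  "cech_map R ys N k q g c =
     (\<lambda>A\<in>cech_index ys k. loc_map R N (cech_elt R ys A) q g (c A))"

definition cohomology_map ::
  "('a, 'r) ring_scheme \<Rightarrow> 'a list \<Rightarrow> ('a, 'c, 'n) module_scheme \<Rightarrow> nat \<Rightarrow> nat \<Rightarrow> ('b \<Rightarrow> 'c)
     \<Rightarrow> (nat set \<Rightarrow> ('b \<times> nat) set) set \<Rightarrow> (nat set \<Rightarrow> ('c \<times> nat) set) set" where
  "cohomology_map R ys N k q g X =
     (\<Union>c\<in>X. cech_coboundaries R ys N k +>\<^bsub>cech_module R ys N k\<^esub> cech_map R ys N k q g c)"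


section \<open>Frobenius actions and the relative Frobenius\<close>

definition nilpotent_part :: "('a, 'b, 'm) module_scheme \<Rightarrow> ('b \<Rightarrow> 'b) \<Rightarrow> 'b set" where
  "nilpotent_part M f = {x \<in> carrier M. \<exists>e. (f ^^ e) x = \<zero>\<^bsub>M\<^esub>}"

text \<open>The Hartshorne-Speiser-Lyubeznik number of a module \<open>M\<close> with Frobenius action \<open>f\<close>.\<close>

definition HSL :: "('a, 'b, 'm) module_scheme \<Rightarrow> ('b \<Rightarrow> 'b) \<Rightarrow> enat" where
  "HSL M f = Inf {enat e | e. \<forall>x\<in>nilpotent_part M f. (f ^^ e) x = \<zero>\<^bsub>M\<^esub>}"

definition frobenius_action ::
  "('a, 'r) ring_scheme \<Rightarrow> 'a list \<Rightarrow> nat \<Rightarrow> nat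
     \<Rightarrow> (nat set \<Rightarrow> ('a \<times> nat) set) set \<Rightarrow> (nat set \<Rightarrow> ('a \<times> nat) set) set" where
  "frobenius_action R ys p k =
     cohomology_map R ys (regular_module R) k p (\<lambda>x. x [^]\<^bsub>R\<^esub> p)"

definition projection :: "('a, 'r) ring_scheme \<Rightarrow> 'a set \<Rightarrow> 'a set \<Rightarrow> 'a set" where
  "projection R J X = (\<Union>x\<in>X. J +>\<^bsub>R\<^esub> x)"

definition relative_frobenius :: "('a, 'r) ring_scheme \<Rightarrow> 'a set \<Rightarrow> nat \<Rightarrow> 'a set \<Rightarrow> 'a set" where
  "relative_frobenius R J q X = (\<Union>x\<in>X. frobenius_power R J q +>\<^bsub>R\<^esub> x [^]\<^bsub>R\<^esub> q)"

definition relative_frobenius_closure ::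
  "('a, 'r) ring_scheme \<Rightarrow> 'a list \<Rightarrow> nat \<Rightarrow> nat \<Rightarrow> 'a set
     \<Rightarrow> (nat set \<Rightarrow> ('a set \<times> nat) set) set set" where
  "relative_frobenius_closure R ys p j J =
     {\<xi> \<in> carrier (cech_cohomology R ys (ring_mod_ideal R J) j).
        \<exists>e. let N = ring_mod_ideal R (frobenius_power R J (p ^ e)) in
          cohomology_map R ys N j (p ^ e) (relative_frobenius R J (p ^ e)) \<xi>
            = \<zero>\<^bsub>cech_cohomology R ys N j\<^esub>}"

end

theory Submission
  imports Defs
begin

text \<open>Multiplication by \<open>x\<^sub>i\<^sup>q\<close> on \<open>R/q\<^sub>i\<^sub>-\<^sub>1\<^sup>[\<^sup>q\<^sup>]\<close> has torsion kernel, because powers of a filter regular sequence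
  are again filter regular, so there are exact sequences
  \<open>H\<^sup>j(R/q\<^sub>i\<^sub>-\<^sub>1\<^sup>[\<^sup>q\<^sup>]) \<rightarrow> H\<^sup>j(R/q\<^sub>i\<^sup>[\<^sup>q\<^sup>]) \<rightarrow> H\<^sup>j\<^sup>+\<^sup>1(R/q\<^sub>i\<^sub>-\<^sub>1\<^sup>[\<^sup>q\<^sup>])\<close> compatible with Frobenius.
  Let \<open>h\<^sub>k\<close> be the HSL number of \<open>H\<^sup>k(R)\<close>. By induction on \<open>i\<close>, a class in the relative Frobenius closure of zero has image killed by
  \<open>\<Sum>k. (i - 1 choose k) h\<^sub>j\<^sub>+\<^sub>1\<^sub>+\<^sub>k\<close> iterations; it then lifts to \<open>H\<^sup>j(R/q\<^sub>i\<^sub>-\<^sub>1\<^sup>[\<^sup>q'\<^sup>])\<close>, by hypothesis the lift is in the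
  closure of zero, and it is killed by \<open>\<Sum>k. (i - 1 choose k) h\<^sub>j\<^sub>+\<^sub>k\<close> further iterations. Pascal's rule adds up
  the two exponents. The case \<open>i = d\<close>, \<open>j = 0\<close> is the claim for parameter ideals generated by a filter
  regular sequence, and by prime avoidance every parameter ideal is of this kind.\<close>

section \<open>The Frobenius endomorphism\<close>

text \<open>The hypothesis compares R/q_{i-1}^[p^e] with R/q_i^[p^e] at one level e, while each
  Frobenius iteration raises the level. So the induction runs over the two-parameter family
  q_i^[p^e], for all e >= e0 at once; if u iterations are spent before lifting, the hypothesis is
  used at level e + u. The bound must depend neither on the class nor on the number of iterations
  that happens to kill it. This uniformity enters at i = 0, where the ideals of all levels are zero
  and the relative Frobenius is the Frobenius action on H^k(R), so that HSL numbers apply. At the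
  other end, an element r of q^F enters as r^(p^e0) in R/q^[p^e0], all of whose elements are degree
  0 cocycles; this is the origin of the summand e0. Multiplication by x_i^q need not be injective,
  so the snake lemma holds only up to torsion. Regularity is therefore tested after inverting one
  element y of the maximal ideal, where a filter regular sequence becomes regular in the weak sense,
  and cohomology is handled through membership conditions on numerators in R.\<close>

lemma (in cring) binomial:
  assumes x: "x \<in> carrier R" and y: "y \<in> carrier R"
  shows "(x \<oplus> y) [^] n = (\<Oplus>k\<in>{..n}. [(n choose k)] \<cdot> (x [^] k \<otimes> y [^] (n - k)))"
proof (induction n)
  case 0
  then show ?case by simp
next
  case (Suc n)
  note xy = x y
  have a: "(\<Oplus>k\<in>{..n}. [(n choose k)] \<cdot> (x [^] k \<otimes> y [^] (n - k))) \<otimes> x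
      = (\<Oplus>k\<in>{..n}. [(n choose k)] \<cdot> (x [^] Suc k \<otimes> y [^] (n - k)))"
    using xy by (subst finsum_ldistr) (auto intro!: finsum_cong' simp: add_pow_ldistr add_pow_rdistr m_ac)
  have b: "(\<Oplus>k\<in>{..n}. [(n choose k)] \<cdot> (x [^] k \<otimes> y [^] (n - k))) \<otimes> y
      = (\<Oplus>k\<in>{..n}. [(n choose k)] \<cdot> (x [^] k \<otimes> y [^] (Suc n - k)))"
    using xy by (subst finsum_ldistr)
      (auto intro!: finsum_cong' simp: add_pow_ldistr add_pow_rdistr m_ac Suc_diff_le)
  \<comment> \<open>The added index \<open>Suc n\<close> has coefficient zero. It makes the sum long
    enough for \<open>d\<close> to split off k = 0 and shift, after which Pascal's rule joins it
    with \<open>a\<close>.\<close>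
  have c: "(\<Oplus>k\<in>{..n}. [(n choose k)] \<cdot> (x [^] k \<otimes> y [^] (Suc n - k)))
      = (\<Oplus>k\<in>{..Suc n}. [(n choose k)] \<cdot> (x [^] k \<otimes> y [^] (Suc n - k)))"
    using xy by (subst finsum_Suc) (auto simp: binomial_eq_0)
  have d: "\<dots> = (\<Oplus>k\<in>{..n}. [(n choose Suc k)] \<cdot> (x [^] Suc k \<otimes> y [^] (n - k))) \<oplus> y [^] Suc n"
    using xy by (subst finsum_Suc2) (auto simp del: nat_pow_Suc)
  have "(\<Oplus>k\<in>{..Suc n}. [(Suc n choose k)] \<cdot> (x [^] k \<otimes> y [^] (Suc n - k)))
     = (\<Oplus>k\<in>{..n}. [(Suc n choose Suc k)] \<cdot> (x [^] Suc k \<otimes> y [^] (n - k))) \<oplus> y [^] Suc n"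
    using xy by (subst finsum_Suc2) (auto simp del: nat_pow_Suc)
  also have "(\<Oplus>k\<in>{..n}. [(Suc n choose Suc k)] \<cdot> (x [^] Suc k \<otimes> y [^] (n - k)))
     = (\<Oplus>k\<in>{..n}. [(n choose k)] \<cdot> (x [^] Suc k \<otimes> y [^] (n - k)))
       \<oplus> (\<Oplus>k\<in>{..n}. [(n choose Suc k)] \<cdot> (x [^] Suc k \<otimes> y [^] (n - k)))"
    using xy by (subst finsum_addf [symmetric])
      (auto intro!: finsum_cong' simp: add.nat_pow_mult simp del: nat_pow_Suc)
  finally have e: "(\<Oplus>k\<in>{..Suc n}. [(Suc n choose k)] \<cdot> (x [^] k \<otimes> y [^] (Suc n - k)))
     = (\<Oplus>k\<in>{..n}. [(n choose k)] \<cdot> (x [^] Suc k \<otimes> y [^] (n - k)))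
       \<oplus> (\<Oplus>k\<in>{..n}. [(n choose Suc k)] \<cdot> (x [^] Suc k \<otimes> y [^] (n - k))) \<oplus> y [^] Suc n" .
  have s: "(\<Oplus>k\<in>{..n}. [(n choose k)] \<cdot> (x [^] k \<otimes> y [^] (n - k))) \<in> carrier R"
    using xy by (intro finsum_closed) auto
  have s1: "(\<Oplus>k\<in>{..n}. [(n choose k)] \<cdot> (x [^] Suc k \<otimes> y [^] (n - k))) \<in> carrier R"
    using xy by (intro finsum_closed) auto
  have s2: "(\<Oplus>k\<in>{..n}. [(n choose Suc k)] \<cdot> (x [^] Suc k \<otimes> y [^] (n - k))) \<in> carrier R"
    using xy by (intro finsum_closed) auto
  have "(x \<oplus> y) [^] Suc n = (\<Oplus>k\<in>{..n}. [(n choose k)] \<cdot> (x [^] k \<otimes> y [^] (n - k))) \<otimes> (x \<oplus> y)"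
    using Suc by simp
  then show ?case
    using r_distr [OF x y s] s1 s2 xy unfolding a b c d e by (simp add: a_assoc)
qed

locale char_p_cring = cring R for R (structure) +
  fixes p :: nat
  assumes prime_p: "Factorial_Ring.prime p" and char_p: "[p] \<cdot> \<one> = \<zero>"
begin

lemma add_pow_dvd_zero:
  assumes "p dvd m" "r \<in> carrier R" shows "[m] \<cdot> r = \<zero>"
proof -
  obtain k where "m = p * k" using assms by blast
  moreover have "[p] \<cdot> r = \<zero>"
    using add_pow_ldistr [OF one_closed assms(2), of p] char_p assms(2) by simp
  ultimately show ?thesis using add.nat_pow_pow [OF assms(2), of k p] by simp
qed

lemma frob_add_p:
  assumes x: "x \<in> carrier R" and y: "y \<in> carrier R"
  shows "(x \<oplus> y) [^] p = x [^] p \<oplus> y [^] p"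
proof -
  have "p \<ge> 2" using prime_p prime_ge_2_nat by blast
  \<comment> \<open>With p = m + 2 the sum can be peeled at both ends; the indices
    \<open>Suc i\<close> with i \<le> m are exactly 1, ..., p - 1, where p divides the binomial
    coefficient.\<close>
  then obtain m where m: "p = Suc (Suc m)" by (metis add_2_eq_Suc le_Suc_ex)
  have z: "[(p choose Suc i)] \<cdot> (x [^] Suc i \<otimes> y [^] (p - Suc i)) = \<zero>" if "i \<le> m" for i
    using that m prime_p x y by (intro add_pow_dvd_zero dvd_choose_prime) auto
  have "(\<Oplus>k\<in>{..p}. [(p choose k)] \<cdot> (x [^] k \<otimes> y [^] (p - k)))
    = x [^] p \<oplus> (\<Oplus>k\<in>{..Suc m}. [(p choose k)] \<cdot> (x [^] k \<otimes> y [^] (p - k)))"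
    unfolding m using x y by (subst finsum_Suc) (auto simp del: nat_pow_Suc)
  also have "(\<Oplus>k\<in>{..Suc m}. [(p choose k)] \<cdot> (x [^] k \<otimes> y [^] (p - k)))
    = (\<Oplus>i\<in>{..m}. [(p choose Suc i)] \<cdot> (x [^] Suc i \<otimes> y [^] (p - Suc i))) \<oplus> y [^] p"
    using x y by (subst finsum_Suc2) (auto simp del: nat_pow_Suc)
  also have "(\<Oplus>i\<in>{..m}. [(p choose Suc i)] \<cdot> (x [^] Suc i \<otimes> y [^] (p - Suc i))) = \<zero>"
    using z by (intro add.finprod_one_eqI) auto
  finally show ?thesis using binomial [OF x y, of p] x y by simp
qed

lemma frob_add:
  assumes x: "x \<in> carrier R" and y: "y \<in> carrier R"
  shows "(x \<oplus> y) [^] (p ^ e) = x [^] (p ^ e) \<oplus> y [^] (p ^ e)"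
proof (induction e)
  case 0
  then show ?case using assms by simp
next
  case (Suc e)
  have "(x \<oplus> y) [^] (p ^ Suc e) = ((x \<oplus> y) [^] (p ^ e)) [^] p"
    using assms by (simp add: nat_pow_pow mult.commute)
  also have "\<dots> = x [^] (p ^ Suc e) \<oplus> y [^] (p ^ Suc e)"
    using assms frob_add_p by (simp add: Suc nat_pow_pow mult.commute)
  finally show ?case .
qed

lemma p_pow_pos [simp]: "0 < p ^ e"
  using prime_p prime_gt_0_nat by simp

lemma frob_zero [simp]: "\<zero> [^] (p ^ e) = \<zero>"
  by (rule nat_pow_zero) (use p_pow_pos [of e] in linarith)

lemma frob_hom: "ring_hom_cring R R (\<lambda>x. x [^] (p ^ e))"
  by (intro ring_hom_cring.intro ring_hom_cring_axioms.intro ring_hom_memI is_cring)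
     (auto simp: frob_add nat_pow_distrib)

lemma frob_neg: "x \<in> carrier R \<Longrightarrow> (\<ominus> x) [^] (p ^ e) = \<ominus> (x [^] (p ^ e))"
  using ring_hom_cring.hom_a_inv [OF frob_hom] .

lemma frob_minus:
  "x \<in> carrier R \<Longrightarrow> y \<in> carrier R \<Longrightarrow> (x \<ominus> y) [^] (p ^ e) = x [^] (p ^ e) \<ominus> y [^] (p ^ e)"
  by (simp add: minus_eq frob_add frob_neg)

lemma frob_finsum:
  "f \<in> A \<rightarrow> carrier R \<Longrightarrow> (\<Oplus>i\<in>A. f i) [^] (p ^ e) = (\<Oplus>i\<in>A. f i [^] (p ^ e))"
  using ring_hom_cring.hom_finsum [OF frob_hom] by (simp add: comp_def)

end

section \<open>Generated ideals and Frobenius powers\<close>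

lemma (in cring) Idl_ideal_eq: "ideal I R \<Longrightarrow> Idl I = I"
  by (meson genideal_minimal genideal_self ideal.Icarr subsetI subset_antisym)

lemma (in cring) Idl_empty: "Idl {} = {\<zero>}"
proof
  show "Idl {} \<subseteq> {\<zero>}" by (rule genideal_minimal [OF zeroideal]) simp
  show "{\<zero>} \<subseteq> Idl {}" using additive_subgroup.zero_closed [OF ideal.axioms(1) [OF genideal_ideal [of "{}"]]] by simp
qed

lemma (in cring) Idl_Un_Idl:
  assumes "S \<subseteq> carrier R" "T \<subseteq> carrier R"
  shows "Idl (Idl S \<union> T) = Idl (S \<union> T)"
proof -
  have IS: "ideal (Idl S) R" and I: "ideal (Idl (S \<union> T)) R"
    using assms by (auto intro: genideal_ideal)
  have c: "Idl S \<union> T \<subseteq> carrier R" using assms ideal.Icarr [OF IS] by auto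
  show ?thesis
  proof (intro subset_antisym genideal_minimal)
    show "Idl S \<union> T \<subseteq> Idl (S \<union> T)"
      using genideal_self [of "S \<union> T"] assms subset_Idl_subset [of "S \<union> T" S] by auto
    show "S \<union> T \<subseteq> Idl (Idl S \<union> T)"
      using genideal_self [OF c] genideal_self [OF assms(1)] by auto
  qed (rule I genideal_ideal [OF c])+
qed

lemma (in cring) Idl_insert_ideal:
  assumes I: "ideal I R" and z: "z \<in> carrier R"
  shows "Idl (insert z I) = {u \<oplus> s \<otimes> z | u s. u \<in> I \<and> s \<in> carrier R}" (is "_ = ?S")
proof
  interpret I: ideal I R by fact
  have "?S = set_add R I (PIdl z)" by (auto simp: set_add_defs cgenideal_def)
  then have S: "ideal ?S R" using add_ideals [OF I cgenideal_ideal [OF z]] by simp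
  have "z = \<zero> \<oplus> \<one> \<otimes> z" using z by simp
  then have 1: "z \<in> ?S" using I.zero_closed by blast
  have 2: "u \<in> ?S" if "u \<in> I" for u
  proof -
    have "u = u \<oplus> \<zero> \<otimes> z" using that z I.Icarr by simp
    then show ?thesis using that by blast
  qed
  show "Idl (insert z I) \<subseteq> ?S" using 1 2 by (intro genideal_minimal S) blast
  have "insert z I \<subseteq> carrier R" using z I.Icarr by blast
  then have J: "ideal (Idl (insert z I)) R" and s: "insert z I \<subseteq> Idl (insert z I)"
    by (rule genideal_ideal, rule genideal_self)
  interpret J: ideal "Idl (insert z I)" R by (rule J)
  show "?S \<subseteq> Idl (insert z I)"
    using s by (auto intro!: J.a_closed J.I_l_closed)
qed

lemma (in cring) ideal_Idl_insert:
  "ideal I R \<Longrightarrow> z \<in> carrier R \<Longrightarrow> ideal (Idl (insert z I)) R"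
  by (intro genideal_ideal) (auto dest: ideal.Icarr)

lemma (in cring) subset_Idl_insert: "ideal I R \<Longrightarrow> z \<in> carrier R \<Longrightarrow> I \<subseteq> Idl (insert z I)"
  using genideal_self [of "insert z I"] ideal.Icarr [of I R] by blast

lemma (in char_p_cring) ideal_frob_vimage:
  assumes "ideal I R" shows "ideal {x \<in> carrier R. x [^] (p ^ e) \<in> I} R"
proof -
  interpret I: ideal I R by fact
  show ?thesis
    by (rule idealI [OF ring_axioms])
       (auto intro!: subgroup.intro simp: frob_add frob_neg nat_pow_distrib
          I.I_l_closed I.I_r_closed simp flip: a_inv_def)
qed

text \<open>Frobenius is a ring endomorphism, so the elements whose p^e-th power lies in the
  right-hand ideal form an ideal; it contains S, hence all of \<open>Idl S\<close>. Frobenius powers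
  can thus be computed on generators.\<close>

lemma (in char_p_cring) frobenius_power_Idl:
  assumes S: "S \<subseteq> carrier R"
  shows "frobenius_power R (Idl S) (p ^ e) = Idl ((\<lambda>x. x [^] (p ^ e)) ` S)" (is "_ = ?I")
proof -
  have I: "ideal ?I R" and s: "(\<lambda>x. x [^] (p ^ e)) ` S \<subseteq> ?I"
    using S by (auto intro!: genideal_ideal genideal_self)
  have IS: "ideal (Idl S) R" using S by (rule genideal_ideal)
  have c: "Idl S \<subseteq> carrier R" using ideal.Icarr [OF IS] by blast
  have "Idl S \<subseteq> {x \<in> carrier R. x [^] (p ^ e) \<in> ?I}"
    using s S by (intro genideal_minimal ideal_frob_vimage I) auto
  then have "(\<lambda>x. x [^] (p ^ e)) ` (Idl S) \<subseteq> ?I" by auto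
  moreover have "(\<lambda>x. x [^] (p ^ e)) ` S \<subseteq> Idl ((\<lambda>x. x [^] (p ^ e)) ` (Idl S))"
    using c genideal_self [OF S] genideal_self [of "(\<lambda>x. x [^] (p ^ e)) ` (Idl S)"] by auto
  ultimately show ?thesis
    unfolding frobenius_power_def using c
    by (intro subset_antisym genideal_minimal I genideal_ideal) auto
qed

lemma (in cring) ideal_frobenius_power: "I \<subseteq> carrier R \<Longrightarrow> ideal (frobenius_power R I q) R"
  unfolding frobenius_power_def by (intro genideal_ideal) auto

lemma (in cring) frobenius_power_mem:
  "I \<subseteq> carrier R \<Longrightarrow> x \<in> I \<Longrightarrow> x [^] q \<in> frobenius_power R I q"
  unfolding frobenius_power_def by (rule set_mp [OF genideal_self]) auto

lemma (in char_p_cring) frobenius_power_frobenius_power: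
  assumes S: "I \<subseteq> carrier R"
  shows "frobenius_power R (frobenius_power R I (p ^ e)) (p ^ e') = frobenius_power R I (p ^ (e + e'))"
proof -
  have "(\<lambda>x. x [^] (p ^ e')) ` (\<lambda>x. x [^] (p ^ e)) ` I = (\<lambda>x. x [^] (p ^ (e + e'))) ` I"
    unfolding image_image using S by (intro image_cong) (auto simp: nat_pow_pow power_add)
  moreover have "(\<lambda>x. x [^] (p ^ e)) ` I \<subseteq> carrier R" using S by auto
  ultimately show ?thesis
    using frobenius_power_Idl [of "(\<lambda>x. x [^] (p ^ e)) ` I" e'] unfolding frobenius_power_def by simp
qed

section \<open>Regular sequences up to torsion\<close>

context cring
begin

text \<open>The kernel of R -> (R/I)_y, that is, the contraction of the extension of I to R_y. It
  allows statements about (R/I)_y to be made inside R.\<close>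

definition sat :: "'a \<Rightarrow> 'a set \<Rightarrow> 'a set" where
  "sat y I = {r \<in> carrier R. \<exists>n::nat. y [^] n \<otimes> r \<in> I}"

lemma sat_subset: "ideal I R \<Longrightarrow> I \<subseteq> sat y I"
  unfolding sat_def by (auto intro!: exI [of _ 0] dest: ideal.Icarr)

lemma sat_mono: "I \<subseteq> J \<Longrightarrow> sat y I \<subseteq> sat y J"
  unfolding sat_def by auto

lemma pow_mult_mem_ideal_mono:
  assumes I: "ideal I R" and y: "y \<in> carrier R" "r \<in> carrier R"
    and m: "y [^] (n::nat) \<otimes> r \<in> I" and le: "n \<le> k"
  shows "y [^] k \<otimes> r \<in> I"
proof -
  have "y [^] k \<otimes> r = y [^] (k - n) \<otimes> (y [^] n \<otimes> r)"
    using y le by (simp add: nat_pow_mult flip: m_assoc)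
  then show ?thesis using ideal.I_l_closed [OF I m] y by simp
qed

lemma ideal_sat:
  assumes I: "ideal I R" and y: "y \<in> carrier R" shows "ideal (sat y I) R"
proof (rule idealI [OF ring_axioms])
  interpret I: ideal I R by fact
  show "subgroup (sat y I) (add_monoid R)"
  proof (rule subgroup.intro)
    fix a b assume ab: "a \<in> sat y I" "b \<in> sat y I"
    obtain n k :: nat where n: "y [^] n \<otimes> a \<in> I" "y [^] k \<otimes> b \<in> I"
      and c: "a \<in> carrier R" "b \<in> carrier R" using ab by (auto simp: sat_def)
    have "y [^] (max n k) \<otimes> a \<in> I" "y [^] (max n k) \<otimes> b \<in> I"
      using pow_mult_mem_ideal_mono [OF I y c(1) n(1)] pow_mult_mem_ideal_mono [OF I y c(2) n(2)]
      by simp_all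
    then have "y [^] (max n k) \<otimes> (a \<oplus> b) \<in> I" using y c by (simp add: r_distr)
    then show "a \<otimes>\<^bsub>add_monoid R\<^esub> b \<in> sat y I" using c by (auto simp: sat_def)
  next
    fix a assume "a \<in> sat y I"
    then obtain n :: nat where n: "y [^] n \<otimes> a \<in> I" and c: "a \<in> carrier R" by (auto simp: sat_def)
    then have "y [^] n \<otimes> (\<ominus> a) \<in> I" using y by (simp add: r_minus)
    then show "inv\<^bsub>add_monoid R\<^esub> a \<in> sat y I" using c by (auto simp: sat_def simp flip: a_inv_def)
  qed (use y in \<open>auto simp: sat_def\<close>)
next
  fix a x assume "a \<in> sat y I" and x: "x \<in> carrier R"
  then obtain n :: nat where n: "y [^] n \<otimes> a \<in> I" and c: "a \<in> carrier R" by (auto simp: sat_def)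
  have "y [^] n \<otimes> (x \<otimes> a) = x \<otimes> (y [^] n \<otimes> a)" using y x c by (simp add: m_lcomm)
  then have "y [^] n \<otimes> (x \<otimes> a) \<in> I" using ideal.I_l_closed [OF I n x] by simp
  then show "x \<otimes> a \<in> sat y I" "a \<otimes> x \<in> sat y I"
    using c x by (auto simp: sat_def m_comm)
qed

lemma sat_pow_mult:
  assumes "y \<in> carrier R" "r \<in> carrier R" and "y [^] (n::nat) \<otimes> r \<in> sat y I"
  shows "r \<in> sat y I"
proof -
  obtain k :: nat where "y [^] k \<otimes> (y [^] n \<otimes> r) \<in> I" using assms by (auto simp: sat_def)
  then have "y [^] (k + n) \<otimes> r \<in> I" using assms by (simp add: m_assoc flip: nat_pow_mult)
  then show ?thesis using assms by (auto simp: sat_def)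
qed

lemma sat_Idl_insertD:
  assumes "ideal I R" "z \<in> carrier R" "r \<in> sat y (Idl (insert z I))"
  obtains n u s where "u \<in> I" "s \<in> carrier R" "y [^] (n::nat) \<otimes> r = u \<oplus> s \<otimes> z"
  using assms by (auto simp: sat_def Idl_insert_ideal)

text \<open>A regular sequence on (R/I)_y in the weak sense: quotients may be zero. The recursion
  adjoins one generator at a time to I, which suits the induction in
  \<open>regseq_extension\<close>.\<close>

fun regseq :: "'a \<Rightarrow> 'a set \<Rightarrow> 'a list \<Rightarrow> bool" where
  "regseq y I [] \<longleftrightarrow> True"
| "regseq y I (z # zs) \<longleftrightarrow>
    (\<forall>r\<in>carrier R. z \<otimes> r \<in> sat y I \<longrightarrow> r \<in> sat y I) \<and> regseq y (Idl (insert z I)) zs"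

declare regseq.simps(2) [simp del]

lemma regseq_ConsD:
  assumes "regseq y I (z # zs)"
  shows "\<And>r. r \<in> carrier R \<Longrightarrow> z \<otimes> r \<in> sat y I \<Longrightarrow> r \<in> sat y I" "regseq y (Idl (insert z I)) zs"
  using assms unfolding regseq.simps by blast+

lemma regseq_ConsI:
  assumes "\<And>r. r \<in> carrier R \<Longrightarrow> z \<otimes> r \<in> sat y I \<Longrightarrow> r \<in> sat y I" "regseq y (Idl (insert z I)) zs"
  shows "regseq y I (z # zs)"
  using assms unfolding regseq.simps by blast

text \<open>The hypotheses say that \<open>0 \<rightarrow> R/Kv \<rightarrow> R/Kw \<rightarrow> R/Ku \<rightarrow> 0\<close>, with multiplication by \<open>u\<close> as first
  map, becomes exact after inverting \<open>y\<close>.\<close>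

lemma regseq_extension:
  assumes "ideal Kv R" "ideal Kw R" and u: "u \<in> carrier R" and y: "y \<in> carrier R"
    and "set zs \<subseteq> carrier R"
    and "\<And>r. r \<in> carrier R \<Longrightarrow> u \<otimes> r \<in> sat y Kw \<longleftrightarrow> r \<in> sat y Kv"
    and "regseq y (Idl (insert u Kw)) zs" and "regseq y Kv zs"
  shows "regseq y Kw zs"
  using assms(1,2,5-)
proof (induction zs arbitrary: Kv Kw)
  case Nil
  then show ?case by simp
next
  case (Cons z zs)
  let ?Ku = "Idl (insert u Kw)" let ?Kv' = "Idl (insert z Kv)" let ?Kw' = "Idl (insert z Kw)"
  have z: "z \<in> carrier R" using Cons.prems by simp
  note exact = Cons.prems(4)
  interpret V: ideal Kv R by fact
  interpret W: ideal Kw R by fact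
  have Ku: "ideal ?Ku R" and Kv': "ideal ?Kv' R" and Kw': "ideal ?Kw' R"
    using z u Cons.prems by (auto intro!: ideal_Idl_insert)
  interpret U: ideal ?Ku R by (rule Ku)
  interpret sW: ideal "sat y Kw" R by (rule ideal_sat [OF Cons.prems(2) y])
  interpret sV': ideal "sat y ?Kv'" R by (rule ideal_sat [OF Kv' y])
  interpret sW': ideal "sat y ?Kw'" R by (rule ideal_sat [OF Kw' y])
  have sub: "Kw \<subseteq> ?Ku" "u \<in> ?Ku" "Kw \<subseteq> ?Kw'" "z \<in> ?Kw'" "Kv \<subseteq> ?Kv'" "z \<in> ?Kv'"
    using genideal_self [of "insert u Kw"] genideal_self [of "insert z Kw"]
      genideal_self [of "insert z Kv"] u z V.Icarr W.Icarr by blast+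
  have regU: "r \<in> sat y ?Ku" if "r \<in> carrier R" "z \<otimes> r \<in> sat y ?Ku" for r
    using regseq_ConsD(1) [OF Cons.prems(5)] that by blast
  have regV: "r \<in> sat y Kv" if "r \<in> carrier R" "z \<otimes> r \<in> sat y Kv" for r
    using regseq_ConsD(1) [OF Cons.prems(6)] that by blast
  \<comment> \<open>z is regular on the middle term because it is regular on both ends: if z r = 0
    in the middle, then r vanishes on the right, so r = s u, and z s = 0 on the left gives s =
    0.\<close>
  have regW: "r \<in> sat y Kw" if r: "r \<in> carrier R" and zr: "z \<otimes> r \<in> sat y Kw" for r
  proof -
    have "r \<in> sat y ?Ku" using regU r zr sat_mono [OF sub(1)] by blast
    then obtain n k s where k: "k \<in> Kw" and s: "s \<in> carrier R"
      and eq: "y [^] (n::nat) \<otimes> r = k \<oplus> s \<otimes> u"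
      using sat_Idl_insertD [OF Cons.prems(2) u] by metis
    have kc: "k \<in> carrier R" using k W.Icarr by blast
    have "u \<otimes> (z \<otimes> s) = z \<otimes> (k \<oplus> s \<otimes> u) \<ominus> z \<otimes> k" using z s u kc by algebra
    also have "\<dots> = y [^] n \<otimes> (z \<otimes> r) \<ominus> z \<otimes> k"
      using z r y by (simp flip: eq add: m_ac)
    finally have "u \<otimes> (z \<otimes> s) = y [^] n \<otimes> (z \<otimes> r) \<ominus> z \<otimes> k" .
    moreover have "z \<otimes> k \<in> sat y Kw" using k z sat_subset [OF Cons.prems(2)] sW.I_l_closed by blast
    ultimately have "u \<otimes> (z \<otimes> s) \<in> sat y Kw"
      using zr y sW.I_l_closed by (auto simp: minus_eq)
    then have "s \<in> sat y Kv" using exact [of "z \<otimes> s"] regV s z by simp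
    then have "s \<otimes> u \<in> sat y Kw" using exact [of s] s u by (simp add: m_comm)
    then have "y [^] n \<otimes> r \<in> sat y Kw"
      unfolding eq using k sat_subset [OF Cons.prems(2)] by blast
    then show ?thesis using sat_pow_mult y r by blast
  qed
  \<comment> \<open>Exactness survives reduction modulo z because z is regular on the right-hand
    term. If u r = t z in the middle, then z t vanishes on the right, hence so does t, say t = s u;
    then u (r - z s) = 0 and r = z s on the left.\<close>
  have exact': "u \<otimes> r \<in> sat y ?Kw' \<longleftrightarrow> r \<in> sat y ?Kv'" if r: "r \<in> carrier R" for r
  proof
    assume "u \<otimes> r \<in> sat y ?Kw'"
    then obtain n k t where k: "k \<in> Kw" and t: "t \<in> carrier R"
      and eq: "y [^] (n::nat) \<otimes> (u \<otimes> r) = k \<oplus> t \<otimes> z"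
      using sat_Idl_insertD [OF Cons.prems(2) z] by metis
    have kc: "k \<in> carrier R" using k W.Icarr by blast
    have "z \<otimes> t = (k \<oplus> t \<otimes> z) \<ominus> k" using z t kc by algebra
    also have "\<dots> = (y [^] n \<otimes> r) \<otimes> u \<ominus> k" using y r u by (simp flip: eq add: m_ac)
    also have "\<dots> \<in> ?Ku" using sub k y r U.I_l_closed by (auto simp: minus_eq)
    finally have "t \<in> sat y ?Ku" using regU t sat_subset [OF Ku] by blast
    then obtain m k' s where k': "k' \<in> Kw" and s: "s \<in> carrier R"
      and eq': "y [^] (m::nat) \<otimes> t = k' \<oplus> s \<otimes> u"
      using sat_Idl_insertD [OF Cons.prems(2) u] by metis
    have kc': "k' \<in> carrier R" using k' W.Icarr by blast
    have "u \<otimes> (y [^] m \<otimes> (y [^] n \<otimes> r) \<ominus> z \<otimes> s)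
        = y [^] m \<otimes> (y [^] n \<otimes> (u \<otimes> r)) \<ominus> z \<otimes> (s \<otimes> u)"
      using y u r z s nat_pow_closed [OF y, of m] nat_pow_closed [OF y, of n] by algebra
    also have "\<dots> = y [^] m \<otimes> k \<oplus> z \<otimes> (y [^] m \<otimes> t) \<ominus> z \<otimes> (s \<otimes> u)"
      unfolding eq using y z t kc nat_pow_closed [OF y, of m] s u by algebra
    also have "\<dots> = y [^] m \<otimes> k \<oplus> z \<otimes> k'"
      unfolding eq' using y z t kc kc' nat_pow_closed [OF y, of m] s u by algebra
    also have "\<dots> \<in> Kw" using k k' y z by (intro W.a_closed W.I_l_closed) auto
    finally have "y [^] m \<otimes> (y [^] n \<otimes> r) \<ominus> z \<otimes> s \<in> sat y ?Kv'"
      using exact [of "y [^] m \<otimes> (y [^] n \<otimes> r) \<ominus> z \<otimes> s"] y r z s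
        sat_subset [OF Cons.prems(2)] sat_mono [OF sub(5), of y] by auto
    moreover have "z \<otimes> s \<in> sat y ?Kv'"
      using sub s sV'.I_r_closed sat_subset [OF Kv'] by blast
    ultimately have "(y [^] m \<otimes> (y [^] n \<otimes> r) \<ominus> z \<otimes> s) \<oplus> z \<otimes> s \<in> sat y ?Kv'" by blast
    also have "(y [^] m \<otimes> (y [^] n \<otimes> r) \<ominus> z \<otimes> s) \<oplus> z \<otimes> s = y [^] (m + n) \<otimes> r"
    proof -
      have "(a \<ominus> b) \<oplus> b = a" if "a \<in> carrier R" "b \<in> carrier R" for a b using that by algebra
      then show ?thesis using y r z s by (simp add: m_assoc flip: nat_pow_mult)
    qed
    finally show "r \<in> sat y ?Kv'" using sat_pow_mult y r by blast
  next
    assume "r \<in> sat y ?Kv'"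
    then obtain n k t where k: "k \<in> Kv" and t: "t \<in> carrier R"
      and eq: "y [^] (n::nat) \<otimes> r = k \<oplus> t \<otimes> z"
      using sat_Idl_insertD [OF Cons.prems(1) z] by metis
    have kc: "k \<in> carrier R" using k V.Icarr by blast
    have "u \<otimes> k \<in> sat y ?Kw'"
      using k kc exact [of k] sat_subset [OF Cons.prems(1)] sat_mono [OF sub(3), of y] by blast
    moreover have "u \<otimes> t \<otimes> z \<in> sat y ?Kw'"
      using sub u t sW'.I_l_closed sat_subset [OF Kw'] by blast
    ultimately have "u \<otimes> k \<oplus> u \<otimes> t \<otimes> z \<in> sat y ?Kw'" by blast
    also have "u \<otimes> k \<oplus> u \<otimes> t \<otimes> z = u \<otimes> (k \<oplus> t \<otimes> z)" using u k kc t z by algebra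
    also have "\<dots> = y [^] n \<otimes> (u \<otimes> r)" using u r y by (simp flip: eq add: m_ac)
    finally show "u \<otimes> r \<in> sat y ?Kw'" using sat_pow_mult y r u by blast
  qed
  \<comment> \<open>Adjoining u and z in either order gives the same ideal, so the right-hand term
    of the reduced sequence is R/Ku modulo z, as the induction hypothesis requires.\<close>
  have "Idl (insert u ?Kw') = Idl (insert u (insert z Kw))"
    using Idl_Un_Idl [of "insert z Kw" "{u}"] u z W.Icarr by (simp add: subset_iff)
  also have "\<dots> = Idl (insert z ?Ku)"
    using Idl_Un_Idl [of "insert u Kw" "{z}"] u z W.Icarr by (simp add: subset_iff insert_commute)
  finally have "regseq y (Idl (insert u ?Kw')) zs" using regseq_ConsD(2) [OF Cons.prems(5)] by simp
  then have "regseq y ?Kw' zs"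
    using Cons.IH [OF Kv' Kw' _ exact' _ regseq_ConsD(2) [OF Cons.prems(6)]] Cons.prems(3) by simp
  with regW show ?case by (rule regseq_ConsI)
qed

text \<open>Instance of \<open>regseq_extension\<close> with Kv = (I, v), Kw = (I, u v) and Ku = (I,
  u). Since u is regular modulo I after inverting y, multiplication by u embeds R/(I, v) into R/(I,
  u v) there; as \<open>zs\<close> is regular on both ends, it is regular on the middle
  term.\<close>

lemma regseq_mult:
  assumes I: "ideal I R" and c: "u \<in> carrier R" "v \<in> carrier R" "y \<in> carrier R"
    and zs: "set zs \<subseteq> carrier R"
    and u: "regseq y I (u # zs)" and v: "regseq y I (v # zs)"
  shows "regseq y I (u \<otimes> v # zs)"
proof -
  let ?Kw = "Idl (insert (u \<otimes> v) I)" let ?Kv = "Idl (insert v I)"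
  interpret I: ideal I R by fact
  have Kw: "ideal ?Kw R" and Kv: "ideal ?Kv R" using c I by (auto intro!: ideal_Idl_insert)
  have sub: "I \<subseteq> ?Kw" "u \<otimes> v \<in> ?Kw" "I \<subseteq> ?Kv" "v \<in> ?Kv"
    using genideal_self [of "insert (u \<otimes> v) I"] genideal_self [of "insert v I"] c I.Icarr by blast+
  interpret sV: ideal "sat y ?Kv" R by (rule ideal_sat [OF Kv c(3)])
  interpret sW: ideal "sat y ?Kw" R by (rule ideal_sat [OF Kw c(3)])
  have exact: "u \<otimes> r \<in> sat y ?Kw \<longleftrightarrow> r \<in> sat y ?Kv" if r: "r \<in> carrier R" for r
  proof
    assume "u \<otimes> r \<in> sat y ?Kw"
    then obtain n k s where k: "k \<in> I" and s: "s \<in> carrier R"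
      and eq: "y [^] (n::nat) \<otimes> (u \<otimes> r) = k \<oplus> s \<otimes> (u \<otimes> v)"
      using sat_Idl_insertD [OF I] c by (metis m_closed)
    have kc: "k \<in> carrier R" using k I.Icarr by blast
    have "u \<otimes> (y [^] n \<otimes> r \<ominus> s \<otimes> v) = y [^] n \<otimes> (u \<otimes> r) \<ominus> s \<otimes> (u \<otimes> v)"
      using c r s nat_pow_closed [OF c(3), of n] by algebra
    also have "\<dots> = k" unfolding eq using kc c s by algebra
    finally have "u \<otimes> (y [^] n \<otimes> r \<ominus> s \<otimes> v) \<in> sat y I"
      using k sat_subset [OF I] by blast
    moreover have "y [^] n \<otimes> r \<ominus> s \<otimes> v \<in> carrier R" using c r s by simp
    ultimately have "y [^] n \<otimes> r \<ominus> s \<otimes> v \<in> sat y ?Kv"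
      using regseq_ConsD(1) [OF u] sat_mono [OF sub(3), of y] by blast
    moreover have "s \<otimes> v \<in> sat y ?Kv" using sub s sV.I_l_closed sat_subset [OF Kv] by blast
    ultimately have "(y [^] n \<otimes> r \<ominus> s \<otimes> v) \<oplus> s \<otimes> v \<in> sat y ?Kv" by blast
    also have "(y [^] n \<otimes> r \<ominus> s \<otimes> v) \<oplus> s \<otimes> v = y [^] n \<otimes> r"
      using c r s nat_pow_closed [OF c(3), of n] by algebra
    finally show "r \<in> sat y ?Kv" using sat_pow_mult c r by blast
  next
    assume "r \<in> sat y ?Kv"
    then obtain n k t where k: "k \<in> I" and t: "t \<in> carrier R"
      and eq: "y [^] (n::nat) \<otimes> r = k \<oplus> t \<otimes> v"
      using sat_Idl_insertD [OF I c(2)] by metis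
    have kc: "k \<in> carrier R" using k I.Icarr by blast
    have "u \<otimes> k \<in> ?Kw" using k c sub I.I_l_closed by blast
    moreover have "t \<otimes> (u \<otimes> v) \<in> ?Kw" using sub t ideal.I_l_closed [OF Kw] by blast
    ultimately have "u \<otimes> k \<oplus> t \<otimes> (u \<otimes> v) \<in> ?Kw"
      using additive_subgroup.a_closed [OF ideal.axioms(1) [OF Kw]] by blast
    also have "u \<otimes> k \<oplus> t \<otimes> (u \<otimes> v) = u \<otimes> (k \<oplus> t \<otimes> v)" using kc t c by algebra
    also have "\<dots> = y [^] n \<otimes> (u \<otimes> r)" using c r by (simp flip: eq add: m_ac)
    finally show "u \<otimes> r \<in> sat y ?Kw" using sat_pow_mult c r sat_subset [OF Kw] by blast
  qed
  have uv_Ku: "u \<otimes> v \<in> Idl (insert u I)" and IKu: "insert u I \<subseteq> Idl (insert u I)"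
    using genideal_self [of "insert u I"] c I.Icarr
      ideal.I_r_closed [OF ideal_Idl_insert [OF I c(1)], of u v] by blast+
  have "Idl (insert u ?Kw) = Idl (insert u (insert (u \<otimes> v) I))"
    using Idl_Un_Idl [of "insert (u \<otimes> v) I" "{u}"] c I.Icarr by (simp add: subset_iff)
  also have "\<dots> = Idl (insert u I)"
  proof (intro subset_antisym genideal_minimal)
    show "insert u I \<subseteq> Idl (insert u (insert (u \<otimes> v) I))"
      using genideal_self [of "insert u (insert (u \<otimes> v) I)"] c I.Icarr by blast
  qed (use uv_Ku IKu c I.Icarr in \<open>auto intro!: genideal_ideal\<close>)
  finally have "regseq y ?Kw zs"
    using regseq_extension [OF Kv Kw c(1,3) zs exact _ regseq_ConsD(2) [OF v]]
      regseq_ConsD(2) [OF u] by simp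
  moreover have "r \<in> sat y I" if "r \<in> carrier R" "u \<otimes> v \<otimes> r \<in> sat y I" for r
    using regseq_ConsD(1) [OF u, of "v \<otimes> r"] regseq_ConsD(1) [OF v, of r] that c
    by (simp add: m_assoc)
  ultimately show ?thesis by (intro regseq_ConsI)
qed

lemma regseq_pow:
  assumes "ideal I R" "x \<in> carrier R" "y \<in> carrier R" "set zs \<subseteq> carrier R"
    and "regseq y I (x # zs)" "0 < (n::nat)"
  shows "regseq y I (x [^] n # zs)"
  using assms(6)
proof (induction n)
  case (Suc n)
  show ?case
  proof (cases "n = 0")
    case True
    then show ?thesis using assms(2,5) by simp
  next
    case False
    then have "regseq y I (x [^] n # zs)" using Suc by blast
    then have "regseq y I (x [^] n \<otimes> x # zs)"
      using assms(2) by (intro regseq_mult [OF assms(1) _ assms(2-4) _ assms(5)]) auto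
    then show ?thesis by simp
  qed
qed simp

text \<open>The entries are raised from the front: first the head, with the tail unchanged, and then
  the tail over the ideal that already contains the power of the head.\<close>

lemma regseq_map_pow:
  assumes "y \<in> carrier R" "0 < (n::nat)" "ideal I R" "set zs \<subseteq> carrier R" "regseq y I zs"
  shows "regseq y I (map (\<lambda>x. x [^] n) zs)"
  using assms(3-)
proof (induction zs arbitrary: I)
  case (Cons z zs)
  have z: "z \<in> carrier R" and zs: "set zs \<subseteq> carrier R" using Cons.prems(2) by auto
  have I: "ideal (Idl (insert (z [^] n) I)) R"
    by (rule ideal_Idl_insert [OF Cons.prems(1) nat_pow_closed [OF z]])
  have r: "regseq y I (z [^] n # zs)"
    by (rule regseq_pow [OF Cons.prems(1) z assms(1) zs Cons.prems(3) assms(2)])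
  from regseq_ConsD(2) [OF r] have "regseq y (Idl (insert (z [^] n) I)) (map (\<lambda>x. x [^] n) zs)"
    by (rule Cons.IH [OF I zs])
  with regseq_ConsD(1) [OF r] show ?case unfolding list.map by (rule regseq_ConsI)
qed simp

text \<open>Bridge between the recursion, used for proving regularity, and the indexed conditions in
  which \<open>filter_regular\<close> and the ideals q_i are phrased.\<close>

lemma regseq_iff_nth:
  assumes "ideal I R" "set zs \<subseteq> carrier R"
  shows "regseq y I zs \<longleftrightarrow> (\<forall>i<length zs. \<forall>r\<in>carrier R.
    zs ! i \<otimes> r \<in> sat y (Idl (I \<union> set (take i zs))) \<longrightarrow> r \<in> sat y (Idl (I \<union> set (take i zs))))"
  using assms
proof (induction zs arbitrary: I)
  case (Cons z zs)
  have z: "z \<in> carrier R" and zs: "set zs \<subseteq> carrier R" and I: "ideal I R" using Cons.prems by auto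
  have Ic: "I \<subseteq> carrier R" using ideal.Icarr [OF I] by blast
  have eq: "Idl (Idl (insert z I) \<union> set (take i zs)) = Idl (I \<union> set (take (Suc i) (z # zs)))" for i
  proof -
    have "insert z I \<subseteq> carrier R" "set (take i zs) \<subseteq> carrier R"
      using z zs Ic by (auto dest: in_set_takeD)
    from Idl_Un_Idl [OF this] show ?thesis by simp
  qed
  show ?case
    unfolding regseq.simps Cons.IH [OF ideal_Idl_insert [OF I z] zs] length_Cons All_less_Suc2 eq
    by (simp add: Idl_ideal_eq [OF I])
qed simp

end

section \<open>Associated primes and filter regular systems of parameters\<close>

text \<open>Provides common exponents: those chosen separately for finitely many generators or
  cochain components are replaced by their maximum, which monotonicity permits.\<close>

lemma finite_uniform_nat:
  fixes Q :: "'c \<Rightarrow> nat \<Rightarrow> bool"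
  assumes "finite A" "\<And>a. a \<in> A \<Longrightarrow> \<exists>n. Q a n" "\<And>a n k. a \<in> A \<Longrightarrow> Q a n \<Longrightarrow> n \<le> k \<Longrightarrow> Q a k"
  shows "\<exists>n. \<forall>a\<in>A. Q a n"
proof -
  obtain f where f: "\<And>a. a \<in> A \<Longrightarrow> Q a (f a)" using assms(2) by metis
  have "Q a (Max (f ` A))" if "a \<in> A" for a
    using assms(3) [OF that f [OF that]] assms(1) that by simp
  then show ?thesis by blast
qed

lemma (in noetherian_ring) ex_maximal_ideal_in:
  assumes "C \<noteq> {}" "C \<subseteq> {I. ideal I R}"
  shows "\<exists>M\<in>C. \<forall>I\<in>C. M \<subseteq> I \<longrightarrow> I = M"
proof (rule subset_Zorn)
  fix D assume D: "subset.chain C D"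
  show "\<exists>U\<in>C. \<forall>X\<in>D. X \<subseteq> U"
  proof (cases "D = {}")
    case True
    then show ?thesis using assms(1) by blast
  next
    case False
    have "subset.chain {I. ideal I R} D" using D assms(2) unfolding pred_on.chain_def by blast
    then have "\<Union>D \<in> D" by (rule ideal_chain_is_trivial [OF False])
    moreover have "D \<subseteq> C" using D unfolding pred_on.chain_def by simp
    ultimately show ?thesis by (intro bexI [of _ "\<Union>D"]) auto
  qed
qed

section \<open>Colon ideals, associated primes of cyclic modules and prime avoidance\<close>

context cring
begin

text \<open>The annihilator of the class of t in R/I; its prime values over all t are the associated
  primes of R/I.\<close>

definition colon :: "'a set \<Rightarrow> 'a \<Rightarrow> 'a set" where
  "colon I t = {r \<in> carrier R. r \<otimes> t \<in> I}"

lemma ideal_colon: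
  assumes "ideal I R" "t \<in> carrier R" shows "ideal (colon I t) R"
proof -
  interpret I: ideal I R by fact
  show ?thesis
  proof (rule idealI [OF ring_axioms])
    show "subgroup (colon I t) (add_monoid R)"
      by (auto intro!: subgroup.intro simp: colon_def assms l_distr l_minus simp flip: a_inv_def)
    fix a x assume a: "a \<in> colon I t" and x: "x \<in> carrier R"
    then have *: "a \<in> carrier R" "a \<otimes> t \<in> I" by (auto simp: colon_def)
    then have "x \<otimes> a \<otimes> t \<in> I" using I.I_l_closed [OF _ x] x assms by (simp add: m_assoc)
    then show "x \<otimes> a \<in> colon I t" "a \<otimes> x \<in> colon I t"
      using x * by (auto simp: colon_def m_comm)
  qed
qed

lemma subset_colon: "ideal I R \<Longrightarrow> t \<in> carrier R \<Longrightarrow> I \<subseteq> colon I t"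
  unfolding colon_def by (auto dest: ideal.Icarr ideal.I_r_closed)

lemma regular_module_coset: "I +>\<^bsub>regular_module R\<^esub> x = I +> x"
  by (simp add: a_r_coset_def r_coset_def regular_module_def)

lemma ring_mod_ideal_carrier: "carrier (ring_mod_ideal R I) = (\<lambda>t. I +> t) ` carrier R"
  by (auto simp: quot_module_def A_RCOSETS_def RCOSETS_def regular_module_def a_r_coset_def r_coset_def)

lemma coset_eq_iff:
  assumes "ideal I R" "a \<in> carrier R" "b \<in> carrier R"
  shows "I +> a = I +> b \<longleftrightarrow> a \<ominus> b \<in> I"
  using quotient_eq_iff_same_a_r_cos [OF assms] by simp

lemma coset_eq_self_iff:
  assumes "ideal I R" "a \<in> carrier R"
  shows "I +> a = I \<longleftrightarrow> a \<in> I"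
  using a_rcos_zero [OF assms(1)] ideal.rcos_const_imp_mem [OF assms] by blast

lemma ring_mod_ideal_smult:
  assumes I: "ideal I R" and r: "r \<in> carrier R" and t: "t \<in> carrier R"
  shows "r \<odot>\<^bsub>ring_mod_ideal R I\<^esub> (I +> t) = I +> (r \<otimes> t)"
proof -
  interpret I: ideal I R by fact
  have "I +> (r \<otimes> x) = I +> (r \<otimes> t)" if x: "x \<in> I +> t" for x
  proof -
    obtain u where u: "u \<in> I" "x = u \<oplus> t" using x by (auto simp: a_r_coset_def')
    have uC: "u \<in> carrier R" using u(1) by (rule I.Icarr)
    have "r \<otimes> (u \<oplus> t) \<ominus> r \<otimes> t = r \<otimes> u" using r t uC by algebra
    then have "r \<otimes> x \<ominus> r \<otimes> t \<in> I" using I.I_l_closed [OF u(1) r] u(2) by simp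
    then show ?thesis using coset_eq_iff [OF I, of "r \<otimes> x" "r \<otimes> t"] u(2) uC r t by simp
  qed
  then have "(\<Union>x\<in>I +> t. I +> (r \<otimes> x)) = (\<Union>x\<in>I +> t. I +> (r \<otimes> t))"
    by (rule SUP_cong [OF refl])
  also have "\<dots> = I +> (r \<otimes> t)" using I.a_rcos_self [OF t] by auto
  finally have "(\<Union>x\<in>I +> t. I +> (r \<otimes> x)) = I +> (r \<otimes> t)" .
  then show ?thesis
    by (simp add: quot_module_def regular_module_coset) (simp add: regular_module_def)
qed

lemma Ass_ring_mod_ideal:
  assumes I: "ideal I R"
  shows "Ass R (ring_mod_ideal R I) = {P. primeideal P R \<and> (\<exists>t\<in>carrier R. P = colon I t)}"
proof -
  have z: "\<zero>\<^bsub>ring_mod_ideal R I\<^esub> = I" by (simp add: quot_module_def)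
  have "{r \<in> carrier R. r \<odot>\<^bsub>ring_mod_ideal R I\<^esub> (I +> t) = \<zero>\<^bsub>ring_mod_ideal R I\<^esub>} = colon I t"
    if "t \<in> carrier R" for t
    using that unfolding z colon_def
    by (intro Collect_cong conj_cong refl) (simp add: ring_mod_ideal_smult [OF I] coset_eq_self_iff [OF I])
  then show ?thesis unfolding Ass_def ring_mod_ideal_carrier by auto
qed

lemma primeideal_pow:
  assumes "primeideal P R" "x \<in> carrier R" "x [^] (n::nat) \<in> P" shows "x \<in> P"
proof -
  interpret P: primeideal P R by fact
  show ?thesis using assms(3)
  proof (induction n)
    case 0
    then show ?case using P.one_imp_carrier assms(2) by auto
  next
    case (Suc n)
    then show ?case using P.I_prime [of "x [^] n" x] assms(2) by auto
  qed
qed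

text \<open>The witness is a product of an element of K and one element of each Q, all chosen
  outside P; primality keeps the product outside P.\<close>

lemma prime_avoidance_aux:
  assumes "finite G" "\<And>Q. Q \<in> G \<Longrightarrow> ideal Q R \<and> \<not> Q \<subseteq> P" "primeideal P R" "ideal K R" "\<not> K \<subseteq> P"
  shows "\<exists>b\<in>K. b \<notin> P \<and> (\<forall>Q\<in>G. b \<in> Q)"
  using assms(1,2)
proof (induction G rule: finite_induct)
  case empty
  then show ?case using assms(5) by auto
next
  case (insert Q G)
  then obtain b where b: "b \<in> K" "b \<notin> P" "\<forall>Q\<in>G. b \<in> Q" by auto
  obtain q where q: "q \<in> Q" "q \<notin> P" and Q: "ideal Q R" using insert.prems by blast
  have c: "b \<in> carrier R" "q \<in> carrier R" using b q Q assms(4) ideal.Icarr by metis+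
  have "b \<otimes> q \<notin> P" using primeideal.I_prime [OF assms(3) c] b q by blast
  moreover have "b \<otimes> q \<in> K" "b \<otimes> q \<in> Q"
    using ideal.I_r_closed [OF assms(4) b(1) c(2)] ideal.I_l_closed [OF Q q(1) c(1)] by auto
  moreover have "b \<otimes> q \<in> Q'" if "Q' \<in> G" for Q'
    using that b(3) insert.prems ideal.I_r_closed [of Q' R b q] c by auto
  ultimately show ?case by blast
qed

text \<open>The coset form is needed because a generator may be altered only by a combination of the
  later generators if the ideal is to stay the same. A minimal member P of F is set aside and a is
  found for the others. If x + a lies in P, then K is not contained in P, and by minimality no other
  member of F is; so some b in K lies in all other members but not in P, and a + b repairs P without
  spoiling them.\<close>

lemma coset_prime_avoidance:
  assumes "finite F" "\<And>P. P \<in> F \<Longrightarrow> primeideal P R" and x: "x \<in> carrier R" and K: "ideal K R"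
    and "\<And>P. P \<in> F \<Longrightarrow> \<not> (x \<in> P \<and> K \<subseteq> P)"
  shows "\<exists>a\<in>K. \<forall>P\<in>F. x \<oplus> a \<notin> P"
  using assms(1,2,5)
proof (induction F rule: finite_psubset_induct)
  case (psubset F)
  show ?case
  proof (cases "F = {}")
    case True
    then show ?thesis using additive_subgroup.zero_closed [OF ideal.axioms(1) [OF K]] by blast
  next
    case False
    then obtain P where P: "P \<in> F" and min: "\<forall>Q\<in>F. Q \<subseteq> P \<longrightarrow> P = Q"
      using finite_has_minimal [OF psubset.hyps] by blast
    have "F - {P} \<subset> F" using P by blast
    then obtain a where a: "a \<in> K" "\<forall>Q\<in>F - {P}. x \<oplus> a \<notin> Q"
      using psubset.IH [of "F - {P}"] psubset.prems by blast
    have aC: "a \<in> carrier R" using a(1) K ideal.Icarr by metis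
    interpret P: primeideal P R using psubset.prems(1) P by blast
    show ?thesis
    proof (cases "x \<oplus> a \<in> P")
      case False
      then show ?thesis using a by blast
    next
      case True
      have "\<not> K \<subseteq> P"
      proof
        assume "K \<subseteq> P"
        then have "(x \<oplus> a) \<ominus> a \<in> P" using True a(1) P.a_closed P.a_inv_closed by (auto simp: minus_eq)
        moreover have "(x \<oplus> a) \<ominus> a = x" using x aC by algebra
        ultimately show False using psubset.prems(2) [OF P] \<open>K \<subseteq> P\<close> by simp
      qed
      moreover have "ideal Q R \<and> \<not> Q \<subseteq> P" if "Q \<in> F - {P}" for Q
        using that min psubset.prems(1) primeideal.axioms(1) by blast
      ultimately obtain b where b: "b \<in> K" "b \<notin> P" "\<forall>Q\<in>F - {P}. b \<in> Q"
        using prime_avoidance_aux [of "F - {P}" P K] psubset.hyps P.primeideal K by blast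
      have bC: "b \<in> carrier R" using b(1) K ideal.Icarr by metis
      have ab: "a \<oplus> b \<in> K" using a(1) b(1) additive_subgroup.a_closed [OF ideal.axioms(1) [OF K]] by blast
      have 1: "(x \<oplus> (a \<oplus> b)) \<ominus> (x \<oplus> a) = b" "(x \<oplus> (a \<oplus> b)) \<ominus> b = x \<oplus> a" using x aC bC by algebra+
      have "x \<oplus> (a \<oplus> b) \<notin> P"
      proof
        assume "x \<oplus> (a \<oplus> b) \<in> P"
        then have "(x \<oplus> (a \<oplus> b)) \<ominus> (x \<oplus> a) \<in> P"
          unfolding minus_eq by (rule P.a_closed [OF _ P.a_inv_closed [OF True]])
        then show False using 1(1) b(2) by simp
      qed
      moreover have "x \<oplus> (a \<oplus> b) \<notin> Q" if "Q \<in> F - {P}" for Q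
      proof
        assume q: "x \<oplus> (a \<oplus> b) \<in> Q"
        interpret Q: ideal Q R using psubset.prems(1) that primeideal.axioms(1) by blast
        have "(x \<oplus> (a \<oplus> b)) \<ominus> b \<in> Q" using q b(3) that Q.a_closed Q.a_inv_closed by (auto simp: minus_eq)
        then show False using 1(2) a(2) that by simp
      qed
      ultimately show ?thesis using ab by blast
    qed
  qed
qed

end

section \<open>Finiteness of associated primes, and zero divisors after localization\<close>

locale noetherian_cring = noetherian_ring R + cring R for R (structure)
begin

text \<open>The classical argument that a maximal annihilator is prime, relative to a set T of
  admissible elements: \<open>closed\<close> ensures that b t remains a competitor whenever b does
  not annihilate t modulo S.\<close>

lemma ex_prime_colon:
  assumes S: "ideal S R" and T: "T \<subseteq> carrier R" "T \<noteq> {}" "T \<inter> S = {}"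
    and closed: "\<And>t b. t \<in> T \<Longrightarrow> b \<in> carrier R \<Longrightarrow> b \<otimes> t \<notin> S \<Longrightarrow> b \<otimes> t \<in> T"
  shows "\<exists>t\<in>T. primeideal (colon S t) R"
proof -
  have "\<exists>M\<in>colon S ` T. \<forall>I\<in>colon S ` T. M \<subseteq> I \<longrightarrow> I = M"
    using T S by (intro ex_maximal_ideal_in) (auto intro!: ideal_colon)
  then obtain t where t: "t \<in> T" and max: "\<And>s. s \<in> T \<Longrightarrow> colon S t \<subseteq> colon S s \<Longrightarrow> colon S s = colon S t"
    by blast
  have tC: "t \<in> carrier R" using t T by blast
  have "primeideal (colon S t) R"
  proof (rule primeidealI)
    show "ideal (colon S t) R" using S tC by (rule ideal_colon)
    show "carrier R \<noteq> colon S t"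
    proof
      assume "carrier R = colon S t"
      then have "\<one> \<in> colon S t" by auto
      then show False using t T tC by (auto simp: colon_def)
    qed
    fix a b assume ab: "a \<in> carrier R" "b \<in> carrier R" "a \<otimes> b \<in> colon S t"
    show "a \<in> colon S t \<or> b \<in> colon S t"
    proof (rule disjCI)
      assume "b \<notin> colon S t"
      then have "b \<otimes> t \<in> T" using closed t ab by (auto simp: colon_def)
      moreover have "colon S t \<subseteq> colon S (b \<otimes> t)"
      proof
        fix r assume r: "r \<in> colon S t"
        then have "r \<in> carrier R" "b \<otimes> (r \<otimes> t) \<in> S"
          using ideal.I_l_closed [OF S _ ab(2)] by (auto simp: colon_def)
        then show "r \<in> colon S (b \<otimes> t)" using ab tC by (auto simp: colon_def m_lcomm)
      qed
      ultimately have "colon S (b \<otimes> t) = colon S t" by (rule max)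
      moreover have "a \<in> colon S (b \<otimes> t)" using ab tC by (auto simp: colon_def m_assoc)
      ultimately show "a \<in> colon S t" by simp
    qed
  qed (rule is_cring)
  then show ?thesis using t by blast
qed

text \<open>Noetherian induction: for a maximal counterexample J and an associated prime P = (J :
  t), every associated prime of R/J is P or an associated prime of R/(J, t), and the latter are
  finite in number.\<close>

lemma finite_prime_colons:
  assumes "ideal I R"
  shows "finite {P. primeideal P R \<and> (\<exists>t\<in>carrier R. P = colon I t)}" (is "finite (?A I)")
proof (rule ccontr)
  assume "infinite (?A I)"
  then have "{I. ideal I R \<and> infinite (?A I)} \<noteq> {}" using assms by blast
  then have "\<exists>M\<in>{I. ideal I R \<and> infinite (?A I)}. \<forall>I\<in>{I. ideal I R \<and> infinite (?A I)}. M \<subseteq> I \<longrightarrow> I = M"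
    by (rule ex_maximal_ideal_in) (simp add: Collect_mono_iff)

  then obtain J where J: "ideal J R" and inf: "infinite (?A J)"
    and max: "\<And>I. ideal I R \<Longrightarrow> infinite (?A I) \<Longrightarrow> J \<subseteq> I \<Longrightarrow> I = J" by (elim bexE CollectE conjE) simp
  have "J \<noteq> carrier R"
  proof
    assume "J = carrier R"
    then have "colon J t = carrier R" if "t \<in> carrier R" for t using that by (auto simp: colon_def)
    then have "?A J \<subseteq> {carrier R}" by auto
    then have "finite (?A J)" by (rule finite_subset) simp
    then show False using inf by contradiction
  qed
  then have "carrier R - J \<noteq> {}" using ideal.Icarr [OF J] by blast
  then have "\<exists>t\<in>carrier R - J. primeideal (colon J t) R"
    by (intro ex_prime_colon [OF J]) auto
  then obtain t where t: "t \<in> carrier R" "t \<notin> J" and P: "primeideal (colon J t) R" by blast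
  let ?J = "Idl (insert t J)"
  have J': "ideal ?J R" using ideal_Idl_insert J t by blast
  have sub: "insert t J \<subseteq> ?J" using genideal_self [of "insert t J"] t ideal.Icarr [OF J] by blast
  then have "?J \<noteq> J" using t by blast
  then have fin: "finite (?A ?J)" using max [OF J'] sub by auto
  have "?A J \<subseteq> insert (colon J t) (?A ?J)"
  proof
    fix Q assume "Q \<in> ?A J"
    then obtain s where Q: "primeideal Q R" and s: "s \<in> carrier R" "Q = colon J s" by blast
    interpret Q: primeideal Q R by fact
    \<comment> \<open>Let Q be the annihilator of s. Either a multiple r s with r outside Q falls
      into (J, t), and the copies of R/Q and R/P generated by s and t in R/J share a nonzero
      element, forcing Q = P; or the annihilator of s stays Q modulo (J, t).\<close>
    show "Q \<in> insert (colon J t) (?A ?J)"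
    proof (cases "\<exists>r\<in>carrier R - Q. r \<otimes> s \<in> ?J")
      case True
      then obtain r where r: "r \<in> carrier R" "r \<notin> Q" "r \<otimes> s \<in> ?J" by blast
      then obtain u c where u: "u \<in> J" "c \<in> carrier R" "r \<otimes> s = u \<oplus> c \<otimes> t"
        using Idl_insert_ideal [OF J t(1)] by auto
      have uC: "u \<in> carrier R" using u(1) ideal.Icarr [OF J] by blast
      \<comment> \<open>Modulo J the elements r s and c t agree, so they have the same annihilator.
        By primality it is Q for the first and \<open>colon J t\<close> for the second.\<close>
      have eq: "k \<otimes> (r \<otimes> s) \<in> J \<longleftrightarrow> k \<otimes> (c \<otimes> t) \<in> J" if k: "k \<in> carrier R" for k
      proof -
        interpret J: ideal J R by fact
        have ku: "k \<otimes> u \<in> J" using u k J.I_l_closed by blast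
        have 1: "k \<otimes> (r \<otimes> s) = k \<otimes> u \<oplus> k \<otimes> (c \<otimes> t)" unfolding u(3) using k uC u(2) t by (simp add: r_distr)
        have 2: "k \<otimes> (c \<otimes> t) = k \<otimes> (r \<otimes> s) \<ominus> k \<otimes> u" unfolding u(3) using k uC u(2) t(1) by algebra
        show ?thesis
        proof
          assume "k \<otimes> (r \<otimes> s) \<in> J"
          then show "k \<otimes> (c \<otimes> t) \<in> J" unfolding 2 minus_eq using ku J.a_closed J.a_inv_closed by blast
        next
          assume "k \<otimes> (c \<otimes> t) \<in> J"
          then show "k \<otimes> (r \<otimes> s) \<in> J" unfolding 1 using ku J.a_closed by blast
        qed
      qed
      have "c \<notin> colon J t"
      proof
        assume "c \<in> colon J t"
        then have "\<one> \<otimes> (c \<otimes> t) \<in> J" using u t by (simp add: colon_def)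
        then have "r \<otimes> s \<in> J" using eq [OF one_closed] r(1) s(1) by simp
        then have "r \<in> colon J s" using r(1) by (simp only: colon_def mem_Collect_eq simp_thms)
        then show False using r(2) s(2) by blast
      qed
      have "k \<in> Q \<longleftrightarrow> k \<in> colon J t" if k: "k \<in> carrier R" for k
      proof -
        have "k \<in> Q \<longleftrightarrow> k \<otimes> r \<in> Q"
          using Q.I_prime [of k r] Q.I_r_closed [of k r] r k by blast
        also have "\<dots> \<longleftrightarrow> k \<otimes> (r \<otimes> s) \<in> J" unfolding s(2) using s(1) r(1) k by (simp add: colon_def m_assoc)
        also have "\<dots> \<longleftrightarrow> k \<otimes> c \<in> colon J t" using eq [OF k] k u(2) t(1) by (simp add: colon_def m_assoc)
        also have "\<dots> \<longleftrightarrow> k \<in> colon J t"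
          using primeideal.I_prime [OF P, of k c] ideal.I_r_closed [OF primeideal.axioms(1) [OF P], of k c]
            k u \<open>c \<notin> colon J t\<close> by blast
        finally show ?thesis .
      qed
      moreover have "colon J t \<subseteq> carrier R" by (auto simp: colon_def)
      ultimately have "Q = colon J t" using Q.Icarr by blast
      then show ?thesis by simp
    next
      case False
      have "colon ?J s = Q"
      proof
        show "colon ?J s \<subseteq> Q" using False unfolding colon_def by blast
        show "Q \<subseteq> colon ?J s" unfolding s(2) colon_def using sub by blast
      qed
      then show ?thesis using Q s by blast
    qed
  qed
  then have "finite (?A J)" by (rule finite_subset) (use fin in simp)
  then show False using inf by contradiction
qed

text \<open>A zero divisor x on (R/I)_y lies in an associated prime of (R/I)_y, whose contraction to
  R avoids y and is associated to R/I.\<close>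

lemma mem_sat_of_not_mem_Ass:
  assumes I: "ideal I R" and x: "x \<in> carrier R" and y: "y \<in> carrier R"
    and avoid: "\<And>P. P \<in> Ass R (ring_mod_ideal R I) \<Longrightarrow> y \<notin> P \<Longrightarrow> x \<notin> P"
    and r: "r \<in> carrier R" "x \<otimes> r \<in> sat y I"
  shows "r \<in> sat y I"
proof (rule ccontr)
  assume nr: "r \<notin> sat y I"
  let ?S = "sat y I" let ?T = "{t \<in> carrier R. t \<notin> ?S \<and> x \<otimes> t \<in> ?S}"
  have S: "ideal ?S R" using I y by (rule ideal_sat)
  have "\<exists>t\<in>?T. primeideal (colon ?S t) R"
  proof (rule ex_prime_colon [OF S])
    show "?T \<noteq> {}" using r nr by blast
    fix t b assume t: "t \<in> ?T" and b: "b \<in> carrier R" "b \<otimes> t \<notin> ?S"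
    then have "x \<otimes> (b \<otimes> t) = b \<otimes> (x \<otimes> t)" using x by (simp add: m_lcomm)
    then show "b \<otimes> t \<in> ?T" using t b ideal.I_l_closed [OF S] by simp
  qed auto
  then obtain t where t: "t \<in> carrier R" "t \<notin> ?S" "x \<otimes> t \<in> ?S" and P: "primeideal (colon ?S t) R" by blast
  let ?P = "colon ?S t"
  have "y \<notin> ?P"
    using sat_pow_mult [OF y t(1), of 1 I] t y by (auto simp: colon_def)
  have "x \<in> ?P" using t x by (simp add: colon_def)
  obtain A where A: "A \<subseteq> carrier R" "finite A" "?P = Idl A"
    using finetely_gen [OF primeideal.axioms(1) [OF P]] by blast
  \<comment> \<open>Since P is finitely generated, one power y^n serves all generators. Replacing t
    by y^n t then turns the annihilator modulo \<open>sat y I\<close> into an annihilator modulo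
    I.\<close>
  have "\<exists>n. \<forall>a\<in>A. y [^] (n::nat) \<otimes> (a \<otimes> t) \<in> I"
  proof (rule finite_uniform_nat [OF A(2)])
    fix a assume "a \<in> A"
    then have "a \<in> ?P" using A genideal_self by blast
    then show "\<exists>n. y [^] (n::nat) \<otimes> (a \<otimes> t) \<in> I" by (simp add: colon_def sat_def)
  next
    fix a and n k :: nat assume "a \<in> A" "y [^] n \<otimes> (a \<otimes> t) \<in> I" "n \<le> k"
    then show "y [^] k \<otimes> (a \<otimes> t) \<in> I"
      using pow_mult_mem_ideal_mono [OF I y, of "a \<otimes> t" n k] A t by blast
  qed
  then obtain n :: nat where n: "\<forall>a\<in>A. y [^] n \<otimes> (a \<otimes> t) \<in> I" by blast
  let ?s = "y [^] n \<otimes> t"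
  have s: "?s \<in> carrier R" using y t by simp
  have "a \<in> colon I ?s" if "a \<in> A" for a
  proof -
    have aC: "a \<in> carrier R" using that A by blast
    then have "a \<otimes> ?s = y [^] n \<otimes> (a \<otimes> t)" using y t by (simp add: m_lcomm)
    then show ?thesis using n that aC by (simp add: colon_def)
  qed
  then have "?P \<subseteq> colon I ?s" unfolding A(3) by (intro genideal_minimal ideal_colon I s) blast
  moreover have "colon I ?s \<subseteq> ?P"
  proof
    fix a assume "a \<in> colon I ?s"
    then have a: "a \<in> carrier R" "a \<otimes> ?s \<in> I" by (auto simp: colon_def)
    then have "y [^] n \<otimes> (a \<otimes> t) \<in> I" using y t by (simp add: m_lcomm)
    then show "a \<in> ?P" using a t by (auto simp: colon_def sat_def)
  qed
  ultimately have "?P \<in> Ass R (ring_mod_ideal R I)"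
    using P s unfolding Ass_ring_mod_ideal [OF I] by blast
  then show False using avoid \<open>x \<in> ?P\<close> \<open>y \<notin> ?P\<close> by blast
qed

text \<open>An associated prime that avoids y differs from \<mm>, because y lies in \<mm>; filter
  regularity therefore keeps the next entry out of it.\<close>

lemma filter_regular_imp_regseq:
  assumes "filter_regular R \<mm> xs" "\<mm> \<subseteq> carrier R" "y \<in> \<mm>"
  shows "regseq y {\<zero>} xs"
proof -
  have xs: "set xs \<subseteq> carrier R" and y: "y \<in> carrier R" using assms by (auto simp: filter_regular_def)
  have eq: "Idl ({\<zero>} \<union> set (take i xs)) = Idl (set (take i xs))" for i
  proof -
    have c: "set (take i xs) \<subseteq> carrier R" using xs by (auto dest: in_set_takeD)
    then show ?thesis using Idl_Un_Idl [of "{}" "set (take i xs)"] by (simp add: Idl_empty)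
  qed
  show ?thesis
    unfolding regseq_iff_nth [OF zeroideal xs] eq
  proof (intro allI impI ballI)
    fix i r assume i: "i < length xs" and r: "r \<in> carrier R"
      and m: "xs ! i \<otimes> r \<in> sat y (Idl (set (take i xs)))"
    have I: "ideal (Idl (set (take i xs))) R" using xs by (intro genideal_ideal) (auto dest: in_set_takeD)
    show "r \<in> sat y (Idl (set (take i xs)))"
    proof (rule mem_sat_of_not_mem_Ass [OF I _ y _ r m])
      show "xs ! i \<in> carrier R" using i xs by auto
      fix P assume "P \<in> Ass R (ring_mod_ideal R (Idl (set (take i xs))))" "y \<notin> P"
      then show "xs ! i \<notin> P" using assms i by (auto simp: filter_regular_def)
    qed
  qed
qed

end

section \<open>Filter regular generators of parameter ideals\<close>

context noetherian_local_ring
begin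

sublocale noetherian_cring R by unfold_locales

lemma max_ideal_subset: "\<mm> \<subseteq> carrier R"
  by (intro subsetI ideal.Icarr [OF maximalideal.axioms(1) [OF maximal]])

lemma prime_over_primary:
  assumes "primeideal P R" "radical R Q = \<mm>" "Q \<subseteq> P" shows "P = \<mm>"
proof -
  interpret P: primeideal P R by fact
  have "\<mm> \<subseteq> P"
  proof
    fix r assume "r \<in> \<mm>"
    then obtain n :: nat where "r \<in> carrier R" "r [^] n \<in> P"
      using assms by (auto simp: radical_def)
    then show "r \<in> P" by (rule primeideal_pow [OF P.primeideal])
  qed
  then have "P = \<mm> \<or> P = carrier R"
    using maximalideal.I_maximal [OF maximal P.is_ideal] P.Icarr by blast
  then show ?thesis using P.I_notcarr by auto
qed

lemma radical_subset_max_ideal: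
  assumes "ideal Q R" "radical R Q = \<mm>" shows "Q \<subseteq> \<mm>"
proof
  fix x assume "x \<in> Q"
  then have "x \<in> radical R Q"
    using ideal.Icarr [OF assms(1)] by (auto simp: radical_def intro!: exI [of _ 1])
  then show "x \<in> \<mm>" using assms by simp
qed

text \<open>Generators are exchanged one at a time, \<open>xs ! i\<close> becoming
  \<open>xs ! i\<close> plus an element of the ideal of the later ones. Avoidance is possible: an
  associated prime of R/(zs) contains \<open>zs\<close>, so if it also contained
  \<open>xs ! i\<close> and all later entries, it would contain the whole \<mm>-primary ideal and
  equal \<mm>.\<close>

lemma ex_filter_regular_generators_aux:
  assumes xs: "set xs \<subseteq> carrier R" and rad: "radical R (Idl (set xs)) = \<mm>" and "i \<le> length xs"
  shows "\<exists>zs. length zs = i \<and> set zs \<subseteq> \<mm> \<and> Idl (set zs \<union> set (drop i xs)) = Idl (set xs) \<and>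
    (\<forall>k<i. \<forall>P\<in>Ass R (ring_mod_ideal R (Idl (set (take k zs)))). P \<noteq> \<mm> \<longrightarrow> zs ! k \<notin> P)"
  using assms(3)
proof (induction i)
  case 0
  then show ?case by simp
next
  case (Suc i)
  then obtain zs where len: "length zs = i" and zs: "set zs \<subseteq> \<mm>"
    and gen: "Idl (set zs \<union> set (drop i xs)) = Idl (set xs)"
    and reg: "\<And>k P. k < i \<Longrightarrow> P \<in> Ass R (ring_mod_ideal R (Idl (set (take k zs)))) \<Longrightarrow> P \<noteq> \<mm> \<Longrightarrow> zs ! k \<notin> P"
    by auto
  let ?x = "xs ! i" let ?D = "set (drop (Suc i) xs)" let ?K = "Idl ?D"
  let ?I = "Idl (set zs)" let ?F = "Ass R (ring_mod_ideal R ?I) - {\<mm>}"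
  have drop: "set (drop i xs) = insert ?x ?D"
    using Suc.prems by (simp add: Cons_nth_drop_Suc [symmetric])
  have zsC: "set zs \<subseteq> carrier R" using zs max_ideal_subset by blast
  have xC: "?x \<in> carrier R" and DC: "?D \<subseteq> carrier R"
    using Suc.prems xs by (auto dest: in_set_dropD)
  have K: "ideal ?K R" and I: "ideal ?I R" and Q: "ideal (Idl (set xs)) R"
    using DC zsC xs by (auto intro: genideal_ideal)
  have Ass: "Ass R (ring_mod_ideal R ?I) = {P. primeideal P R \<and> (\<exists>t\<in>carrier R. P = colon ?I t)}"
    using I by (rule Ass_ring_mod_ideal)
  have "\<exists>a\<in>?K. \<forall>P\<in>?F. ?x \<oplus> a \<notin> P"
  proof (rule coset_prime_avoidance [OF _ _ xC K])
    show "finite ?F" unfolding Ass using finite_prime_colons [OF I] by blast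
    show "primeideal P R" if "P \<in> ?F" for P using that unfolding Ass by blast
    fix P assume P: "P \<in> ?F"
    show "\<not> (?x \<in> P \<and> ?K \<subseteq> P)"
    proof
      assume "?x \<in> P \<and> ?K \<subseteq> P"
      moreover have "?I \<subseteq> P" using P subset_colon [OF I] unfolding Ass by auto
      ultimately have "set zs \<union> set (drop i xs) \<subseteq> P"
        using genideal_self [OF zsC] genideal_self [OF DC] unfolding drop by blast
      moreover have "primeideal P R" using P unfolding Ass by blast
      ultimately have "Idl (set xs) \<subseteq> P"
        unfolding gen [symmetric] by (intro genideal_minimal primeideal.axioms(1))
      then show False using prime_over_primary [OF \<open>primeideal P R\<close> rad] P by blast
    qed
  qed
  then obtain a where a: "a \<in> ?K" and av: "\<And>P. P \<in> ?F \<Longrightarrow> ?x \<oplus> a \<notin> P" by blast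
  let ?z = "?x \<oplus> a"
  have aC: "a \<in> carrier R" using ideal.Icarr [OF K a] .
  let ?J = "Idl (set xs)" let ?J' = "Idl (set (zs @ [?z]) \<union> ?D)"
  interpret J: ideal ?J R by (rule Q)
  have C': "set (zs @ [?z]) \<union> ?D \<subseteq> carrier R" using zsC xC aC DC by auto
  interpret J': ideal ?J' R using C' by (rule genideal_ideal)
  have sub: "set zs \<union> insert ?x ?D \<subseteq> ?J"
    using genideal_self [of "set zs \<union> insert ?x ?D"] gen drop zsC xC DC by auto
  have sub': "set (zs @ [?z]) \<union> ?D \<subseteq> ?J'" using C' by (rule genideal_self)
  have "?K \<subseteq> ?J" using sub by (intro genideal_minimal J.is_ideal) blast
  moreover have "?K \<subseteq> ?J'" using sub' by (intro genideal_minimal J'.is_ideal) blast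
  ultimately have aJ: "a \<in> ?J" "a \<in> ?J'" using a by auto
  have zJ: "?z \<in> ?J" using sub by (intro J.a_closed aJ) auto
  have xJ': "?x \<in> ?J'"
  proof -
    have "?z \<ominus> a \<in> ?J'" unfolding minus_eq using sub' J'.a_closed [OF _ J'.a_inv_closed [OF aJ(2)], of ?z] by simp
    moreover have "?z \<ominus> a = ?x" using xC aC by algebra
    ultimately show ?thesis by simp
  qed
  have gen': "?J' = ?J"
  proof
    show "?J' \<subseteq> ?J" using sub zJ by (intro genideal_minimal J.is_ideal) auto
    have "set zs \<union> insert ?x ?D \<subseteq> ?J'" using sub' xJ' by auto
    then show "?J \<subseteq> ?J'" unfolding gen [symmetric] drop by (intro genideal_minimal J'.is_ideal)
  qed
  have "?z \<in> \<mm>" using zJ radical_subset_max_ideal [OF Q rad] by blast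
  moreover have "(zs @ [?z]) ! k \<notin> P"
    if "k < Suc i" "P \<in> Ass R (ring_mod_ideal R (Idl (set (take k (zs @ [?z])))))" "P \<noteq> \<mm>" for k P
  proof (cases "k = i")
    case True
    then show ?thesis using av [of P] that len by (simp add: nth_append)
  next
    case False
    then have k: "k < i" using that by simp
    then have "take k (zs @ [?z]) = take k zs" "(zs @ [?z]) ! k = zs ! k" using len by (auto simp: nth_append)
    then show ?thesis using reg [OF k] that by simp
  qed
  ultimately show ?case using gen' len zs by (intro exI [of _ "zs @ [?z]"]) auto
qed

lemma parameter_ideal_filter_regular:
  assumes "parameter_ideal R \<mm> Q"
  shows "\<exists>zs. system_of_parameters R \<mm> zs \<and> filter_regular R \<mm> zs \<and> Q = Idl (set zs)"
proof -
  obtain xs where xs: "system_of_parameters R \<mm> xs" "Q = Idl (set xs)"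
    using assms by (auto simp: parameter_ideal_def)
  then have "set xs \<subseteq> carrier R" "radical R (Idl (set xs)) = \<mm>"
    using max_ideal_subset by (auto simp: system_of_parameters_def)
  from ex_filter_regular_generators_aux [OF this order_refl]
  obtain zs where "length zs = length xs" "set zs \<subseteq> \<mm>" "Idl (set zs) = Idl (set xs)"
    "\<forall>k<length xs. \<forall>P\<in>Ass R (ring_mod_ideal R (Idl (set (take k zs)))). P \<noteq> \<mm> \<longrightarrow> zs ! k \<notin> P"
    by auto
  then show ?thesis
    using xs by (intro exI [of _ zs]) (auto simp: system_of_parameters_def filter_regular_def)
qed

end

section \<open>Cech cochains represented by numerators\<close>

text \<open>A cochain of degree \<open>k\<close> with values in \<open>R/J\<close> has a common exponent \<open>n\<close>, so it is given by numerators
  \<open>a A\<close>, the component at \<open>A\<close> being \<open>a A / y\<^sub>A\<^sup>n\<close>. Cocycles and coboundaries thus become conditions in \<open>R\<close>.\<close>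

locale cech_cring = cring R for R (structure) +
  fixes ys :: "'a list"
  assumes ys_closed: "set ys \<subseteq> carrier R"
begin

abbreviation yprod :: "nat set \<Rightarrow> 'a" where "yprod \<equiv> cech_elt R ys"

text \<open>Numerators are given on subsets of every size at once; a degree enters only through the
  index sets on which a condition is imposed. So differentials need no change of carrier.\<close>

definition cochains :: "(nat set \<Rightarrow> 'a) set" where
  "cochains = Pow {..<length ys} \<rightarrow> carrier R"

definition sgn :: "nat set \<Rightarrow> nat \<Rightarrow> 'a" where
  "sgn B b = (if even (card {b'\<in>B. b' < b}) then \<one> else \<ominus> \<one>)"

text \<open>The numerator of the Cech differential: passing from \<open>B - {b}\<close> to B
  multiplies both numerator and denominator by the n-th power of \<open>ys ! b\<close>, so the
  common exponent n is kept.\<close>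

definition cobound :: "nat \<Rightarrow> (nat set \<Rightarrow> 'a) \<Rightarrow> nat set \<Rightarrow> 'a" where
  "cobound n a B = (\<Oplus>b\<in>B. sgn B b \<otimes> ((ys ! b) [^] n \<otimes> a (B - {b})))"

definition is_cocycle :: "'a set \<Rightarrow> nat \<Rightarrow> nat \<Rightarrow> (nat set \<Rightarrow> 'a) \<Rightarrow> bool" where
  "is_cocycle J k n a \<longleftrightarrow>
     (\<exists>l::nat. \<forall>B\<in>cech_index ys (Suc k). yprod B [^] l \<otimes> cobound n a B \<in> J)"

text \<open>The number m has two roles: it expands a / y^n to the denominator y^(n + m) of the
  differential of b, and it absorbs the power of y that witnesses equality in the localization. In
  degree 0 the differential is an empty sum, so the condition says that a represents zero.\<close>

definition is_coboundary :: "'a set \<Rightarrow> nat \<Rightarrow> nat \<Rightarrow> (nat set \<Rightarrow> 'a) \<Rightarrow> bool" where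
  "is_coboundary J k n a \<longleftrightarrow>
     (\<exists>m. \<exists>b\<in>cochains. \<forall>A\<in>cech_index ys k. yprod A [^] m \<otimes> a A \<ominus> cobound (n + m) b A \<in> J)"

lemma cochainsD: "a \<in> cochains \<Longrightarrow> A \<subseteq> {..<length ys} \<Longrightarrow> a A \<in> carrier R"
  by (auto simp: cochains_def)

lemma cochainsI: "(\<And>A. A \<subseteq> {..<length ys} \<Longrightarrow> a A \<in> carrier R) \<Longrightarrow> a \<in> cochains"
  by (auto simp: cochains_def)

lemma cech_indexD:
  assumes "A \<in> cech_index ys k" shows "A \<subseteq> {..<length ys}" "finite A" "card A = k"
  using assms finite_subset [of A "{..<length ys}"] by (auto simp: cech_index_def)

lemma finite_cech_index: "finite (cech_index ys k)"
  unfolding cech_index_def by (rule finite_subset [of _ "Pow {..<length ys}"]) auto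

lemma cech_index_Diff:
  assumes "B \<in> cech_index ys (Suc k)" "b \<in> B" shows "B - {b} \<in> cech_index ys k"
  using cech_indexD [OF assms(1)] assms(2) unfolding cech_index_def
  by (simp add: card_Diff_singleton subset_iff)

lemma ys_nth_closed [simp]: "b < length ys \<Longrightarrow> ys ! b \<in> carrier R"
  using ys_closed by auto

lemma yprod_closed: "A \<subseteq> {..<length ys} \<Longrightarrow> yprod A \<in> carrier R"
  unfolding cech_elt_def by (intro finprod_closed) auto

lemma yprod_insert:
  assumes "B \<subseteq> {..<length ys}" "b \<in> B" shows "yprod B = yprod (B - {b}) \<otimes> ys ! b"
proof -
  have f: "finite (B - {b})" using assms finite_subset by blast
  have "(\<Otimes>i\<in>insert b (B - {b}). ys ! i) = ys ! b \<otimes> (\<Otimes>i\<in>B - {b}. ys ! i)"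
    using assms by (intro finprod_insert f) auto
  moreover have "insert b (B - {b}) = B" using assms by blast
  ultimately have "yprod B = ys ! b \<otimes> yprod (B - {b})" by (simp add: cech_elt_def)
  moreover have "yprod (B - {b}) \<in> carrier R" "ys ! b \<in> carrier R"
    using assms by (auto intro: yprod_closed)
  ultimately show ?thesis by (simp add: m_comm)
qed

lemma sgn_closed [simp]: "sgn B b \<in> carrier R"
  by (simp add: sgn_def)

lemma cobound_term_closed:
  "a \<in> cochains \<Longrightarrow> B \<subseteq> {..<length ys} \<Longrightarrow> b \<in> B \<Longrightarrow> (ys ! b) [^] (n::nat) \<otimes> a (B - {b}) \<in> carrier R"
  using ys_nth_closed cochainsD [of a "B - {b}"] by (auto intro!: m_closed nat_pow_closed)

lemma cobound_summand:
  assumes "a \<in> cochains" "B \<subseteq> {..<length ys}"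
  shows "(\<lambda>b. sgn B b \<otimes> ((ys ! b) [^] (n::nat) \<otimes> a (B - {b}))) \<in> B \<rightarrow> carrier R"
  by (rule Pi_I, rule m_closed [OF sgn_closed], rule cobound_term_closed [OF assms])

lemma mult_summand:
  "x \<in> carrier R \<Longrightarrow> f \<in> B \<rightarrow> carrier R \<Longrightarrow> (\<lambda>b. x \<otimes> f b) \<in> B \<rightarrow> carrier R"
  by (auto simp: Pi_iff)

lemma cobound_closed: "a \<in> cochains \<Longrightarrow> B \<subseteq> {..<length ys} \<Longrightarrow> cobound n a B \<in> carrier R"
  unfolding cobound_def by (intro finsum_closed cobound_summand)

lemma cobound_cochain: "a \<in> cochains \<Longrightarrow> cobound n a \<in> cochains"
  by (rule cochainsI, rule cobound_closed)

lemma cobound_lin: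
  assumes a: "a \<in> cochains" and b: "b \<in> cochains" and x: "x \<in> carrier R" and B: "B \<subseteq> {..<length ys}"
  shows "cobound n (\<lambda>A. a A \<oplus> x \<otimes> b A) B = cobound n a B \<oplus> x \<otimes> cobound n b B"
proof -
  have fin: "finite B" using B finite_subset by blast
  have "cobound n (\<lambda>A. a A \<oplus> x \<otimes> b A) B =
    (\<Oplus>i\<in>B. sgn B i \<otimes> ((ys ! i) [^] n \<otimes> a (B - {i})) \<oplus> x \<otimes> (sgn B i \<otimes> ((ys ! i) [^] n \<otimes> b (B - {i}))))"
    unfolding cobound_def
  proof (rule finsum_cong' [OF refl])
    fix i assume i: "i \<in> B"
    then have y: "(ys ! i) [^] n \<in> carrier R" using B by auto
    have c: "a (B - {i}) \<in> carrier R" "b (B - {i}) \<in> carrier R" using cochainsD a b B by blast+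
    show "sgn B i \<otimes> ((ys ! i) [^] n \<otimes> (a (B - {i}) \<oplus> x \<otimes> b (B - {i})))
        = sgn B i \<otimes> ((ys ! i) [^] n \<otimes> a (B - {i})) \<oplus> x \<otimes> (sgn B i \<otimes> ((ys ! i) [^] n \<otimes> b (B - {i})))"
      using y c x sgn_closed [of B i] by algebra
  qed (use cobound_summand [OF a B, of n] mult_summand [OF x cobound_summand [OF b B, of n]] in
        \<open>auto simp: Pi_iff\<close>)
  also have "\<dots> = cobound n a B \<oplus> (\<Oplus>i\<in>B. x \<otimes> (sgn B i \<otimes> ((ys ! i) [^] n \<otimes> b (B - {i}))))"
    unfolding cobound_def
    by (intro finsum_addf mult_summand cobound_summand x a b B)
  also have "(\<Oplus>i\<in>B. x \<otimes> (sgn B i \<otimes> ((ys ! i) [^] n \<otimes> b (B - {i})))) = x \<otimes> cobound n b B"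
    unfolding cobound_def
    by (intro finsum_rdistr [symmetric] cobound_summand x b B fin)
  finally show ?thesis .
qed

lemma cobound_cong:
  assumes "a \<in> cochains" "B \<subseteq> {..<length ys}" "\<And>b. b \<in> B \<Longrightarrow> a (B - {b}) = a' (B - {b})"
  shows "cobound n a B = cobound n a' B"
  unfolding cobound_def
  by (rule finsum_cong' [OF refl cobound_summand [OF assms(1,2)], symmetric]) (simp add: assms(3))

lemma cobound_minus:
  assumes "a \<in> cochains" "b \<in> cochains" "x \<in> carrier R" "B \<subseteq> {..<length ys}"
  shows "cobound n (\<lambda>A. a A \<ominus> x \<otimes> b A) B = cobound n a B \<ominus> x \<otimes> cobound n b B"
proof -
  have "cobound n (\<lambda>A. a A \<ominus> x \<otimes> b A) B = cobound n (\<lambda>A. a A \<oplus> (\<ominus> x) \<otimes> b A) B"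
  proof (rule cobound_cong [OF _ assms(4)])
    show "(\<lambda>A. a A \<ominus> x \<otimes> b A) \<in> cochains"
      using assms(1-3) by (intro cochainsI minus_closed m_closed) (auto dest: cochainsD)
    fix i
    have "b (B - {i}) \<in> carrier R" using assms(4) by (intro cochainsD [OF assms(2)]) blast
    then show "a (B - {i}) \<ominus> x \<otimes> b (B - {i}) = a (B - {i}) \<oplus> (\<ominus> x) \<otimes> b (B - {i})"
      using assms(3) by (simp add: minus_eq l_minus)
  qed
  also have "\<dots> = cobound n a B \<oplus> (\<ominus> x) \<otimes> cobound n b B" using assms by (intro cobound_lin) auto
  finally show ?thesis using assms cobound_closed by (simp add: minus_eq l_minus)
qed

text \<open>Expansion of the fraction a A / y_A^n by y_A^m: together with the exponent n + m it
  denotes the same cochain.\<close>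

definition scale :: "nat \<Rightarrow> (nat set \<Rightarrow> 'a) \<Rightarrow> nat set \<Rightarrow> 'a" where
  "scale m a A = yprod A [^] m \<otimes> a A"

lemma scale_cochain: "a \<in> cochains \<Longrightarrow> scale m a \<in> cochains"
  unfolding scale_def
  by (rule cochainsI, rule m_closed, rule nat_pow_closed, erule yprod_closed, erule (1) cochainsD)

text \<open>Since y_B is the product of y_{B - b} and y_b, the factor y_b^m added to the
  differential completes y_{B - b}^m to y_B^m in every summand.\<close>

lemma cobound_scale:
  assumes a: "a \<in> cochains" and B: "B \<subseteq> {..<length ys}"
  shows "cobound (n + m) (scale m a) B = yprod B [^] m \<otimes> cobound n a B"
proof -
  have fin: "finite B" using B finite_subset by blast
  have "cobound (n + m) (scale m a) B
      = (\<Oplus>b\<in>B. yprod B [^] m \<otimes> (sgn B b \<otimes> ((ys ! b) [^] n \<otimes> a (B - {b}))))"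
    unfolding cobound_def scale_def
  proof (rule finsum_cong' [OF refl])
    fix b assume b: "b \<in> B"
    then have y: "ys ! b \<in> carrier R" using B by auto
    have c: "a (B - {b}) \<in> carrier R" "yprod (B - {b}) \<in> carrier R"
      using cochainsD [OF a] yprod_closed B by blast+
    have e: "yprod B [^] m = yprod (B - {b}) [^] m \<otimes> (ys ! b) [^] m"
      unfolding yprod_insert [OF B b] using c y by (simp add: nat_pow_distrib)
    have f: "(ys ! b) [^] (n + m) = (ys ! b) [^] n \<otimes> (ys ! b) [^] m" using y by (simp add: nat_pow_mult)
    show "sgn B b \<otimes> ((ys ! b) [^] (n + m) \<otimes> (yprod (B - {b}) [^] m \<otimes> a (B - {b})))
      = yprod B [^] m \<otimes> (sgn B b \<otimes> ((ys ! b) [^] n \<otimes> a (B - {b})))"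
      unfolding e f using c(1) nat_pow_closed [OF y, of m] nat_pow_closed [OF y, of n]
        nat_pow_closed [OF c(2), of m] sgn_closed [of B b] by algebra
  qed (intro mult_summand cobound_summand nat_pow_closed yprod_closed a B)
  also have "\<dots> = yprod B [^] m \<otimes> cobound n a B"
    unfolding cobound_def
    by (intro finsum_rdistr [symmetric] cobound_summand nat_pow_closed yprod_closed a B fin)
  finally show ?thesis .
qed

text \<open>The terms t b c and t c b cancel. They are matched by induction on C, because s = - s
  would not give s = 0 in characteristic 2.\<close>

lemma finsum_antisym_zero:
  assumes "finite C" "\<And>b c. b \<in> C \<Longrightarrow> c \<in> C \<Longrightarrow> t b c \<in> carrier R"
    "\<And>b c. b \<in> C \<Longrightarrow> c \<in> C \<Longrightarrow> b \<noteq> c \<Longrightarrow> t b c = \<ominus> t c b"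
  shows "(\<Oplus>c\<in>C. \<Oplus>b\<in>C - {c}. t c b) = \<zero>"
  using assms
proof (induction C rule: finite_induct)
  case empty
  then show ?case by simp
next
  case (insert x C)
  have cl: "t b c \<in> carrier R" if "b \<in> insert x C" "c \<in> insert x C" for b c using insert.prems(1) that .
  have inner: "(\<Oplus>b\<in>insert x C - {c}. t c b) = t c x \<oplus> (\<Oplus>b\<in>C - {c}. t c b)" if c: "c \<in> C" for c
  proof -
    have "insert x C - {c} = insert x (C - {c})" using c insert.hyps by auto
    then show ?thesis using c insert.hyps cl by (auto intro!: finsum_insert)
  qed
  have "(\<Oplus>c\<in>insert x C. \<Oplus>b\<in>insert x C - {c}. t c b)
      = (\<Oplus>b\<in>insert x C - {x}. t x b) \<oplus> (\<Oplus>c\<in>C. \<Oplus>b\<in>insert x C - {c}. t c b)"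
    using insert.hyps cl by (intro finsum_insert) (auto intro!: finsum_closed)
  also have "insert x C - {x} = C" using insert.hyps by auto
  also have "(\<Oplus>c\<in>C. \<Oplus>b\<in>insert x C - {c}. t c b) = (\<Oplus>c\<in>C. t c x \<oplus> (\<Oplus>b\<in>C - {c}. t c b))"
    using inner cl by (intro finsum_cong') (auto intro!: finsum_closed)
  also have "\<dots> = (\<Oplus>c\<in>C. t c x) \<oplus> (\<Oplus>c\<in>C. \<Oplus>b\<in>C - {c}. t c b)"
    using cl by (intro finsum_addf) (auto intro!: finsum_closed)
  also have "(\<Oplus>c\<in>C. \<Oplus>b\<in>C - {c}. t c b) = \<zero>"
    by (intro insert.IH insert.prems) auto
  also have "(\<Oplus>b\<in>C. t x b) \<oplus> ((\<Oplus>c\<in>C. t c x) \<oplus> \<zero>) = (\<Oplus>b\<in>C. t x b) \<oplus> (\<Oplus>c\<in>C. t c x)"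
    using cl by (simp add: finsum_closed)
  also have "\<dots> = (\<Oplus>b\<in>C. t x b \<oplus> t b x)"
    using cl by (intro finsum_addf [symmetric]) auto
  also have "\<dots> = \<zero>"
  proof (intro add.finprod_one_eqI)
    fix b assume b: "b \<in> C"
    then have "t x b = \<ominus> t b x" using insert.hyps by (intro insert.prems(2)) auto
    then show "t x b \<oplus> t b x = \<zero>" using cl b by (simp add: l_neg)
  qed
  finally show ?case .
qed

text \<open>Deleting the larger element c leaves the position of b unchanged, whereas deleting b
  lowers the position of c by one; hence the single change of sign.\<close>

lemma sgn_antisym_less:
  assumes "finite C" "b \<in> C" "c \<in> C" "b < c"
  shows "sgn C c \<otimes> sgn (C - {c}) b = \<ominus> (sgn C b \<otimes> sgn (C - {b}) c)"
proof -
  have "{b' \<in> C - {c}. b' < b} = {b' \<in> C. b' < b}" using assms by auto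
  moreover have "{b' \<in> C. b' < c} = insert b {b' \<in> C - {b}. b' < c}" using assms by auto
  then have "card {b' \<in> C. b' < c} = Suc (card {b' \<in> C - {b}. b' < c})" using assms by simp
  ultimately show ?thesis by (simp add: sgn_def l_minus r_minus)
qed

lemma sgn_antisym:
  assumes "finite C" "b \<in> C" "c \<in> C" "b \<noteq> c"
  shows "sgn C c \<otimes> sgn (C - {c}) b = \<ominus> (sgn C b \<otimes> sgn (C - {b}) c)"
proof (cases "b < c")
  case True
  then show ?thesis using sgn_antisym_less assms by blast
next
  case False
  then have "c < b" using assms by simp
  from sgn_antisym_less [OF assms(1,3,2) this] show ?thesis by simp
qed

lemma cobound_cobound:
  assumes a: "a \<in> cochains" and C: "C \<subseteq> {..<length ys}"
  shows "cobound n (cobound n a) C = \<zero>"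
proof -
  have fin: "finite C" using C finite_subset by blast
  let ?y = "\<lambda>b. (ys ! b) [^] n"
  let ?t = "\<lambda>c b. (sgn C c \<otimes> sgn (C - {c}) b) \<otimes> (?y c \<otimes> ?y b) \<otimes> a (C - {c} - {b})"
  have y: "?y b \<in> carrier R" if "b \<in> C" for b using that C by auto
  have aC': "a (C - {c} - {b}) \<in> carrier R" for b c
    using C by (intro cochainsD [OF a]) blast
  have t: "?t c b \<in> carrier R" if "c \<in> C" "b \<in> C" for c b using y that aC' by auto
  have "cobound n (cobound n a) C = (\<Oplus>c\<in>C. \<Oplus>b\<in>C - {c}. ?t c b)"
    unfolding cobound_def
  proof (rule finsum_cong' [OF refl])
    fix c assume c: "c \<in> C"
    have "sgn C c \<otimes> (?y c \<otimes> (\<Oplus>b\<in>C - {c}. sgn (C - {c}) b \<otimes> (?y b \<otimes> a (C - {c} - {b}))))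
      = (sgn C c \<otimes> ?y c) \<otimes> (\<Oplus>b\<in>C - {c}. sgn (C - {c}) b \<otimes> (?y b \<otimes> a (C - {c} - {b})))"
      using y c aC' by (intro m_assoc [symmetric] finsum_closed) auto
    also have "\<dots> = (\<Oplus>b\<in>C - {c}. (sgn C c \<otimes> ?y c) \<otimes> (sgn (C - {c}) b \<otimes> (?y b \<otimes> a (C - {c} - {b}))))"
      using y c aC' fin by (intro finsum_rdistr) auto
    also have "\<dots> = (\<Oplus>b\<in>C - {c}. ?t c b)"
    proof (rule finsum_cong' [OF refl])
      fix b assume b: "b \<in> C - {c}"
      then have "b \<in> C" by simp
      show "(sgn C c \<otimes> ?y c) \<otimes> (sgn (C - {c}) b \<otimes> (?y b \<otimes> a (C - {c} - {b}))) = ?t c b"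
        using y [OF c] y [OF \<open>b \<in> C\<close>] aC' [of c b] sgn_closed [of C c] sgn_closed [of "C - {c}" b]
        by algebra
    qed (use t c in auto)
    finally show "sgn C c \<otimes> (?y c \<otimes> (\<Oplus>b\<in>C - {c}. sgn (C - {c}) b \<otimes> (?y b \<otimes> a (C - {c} - {b}))))
      = (\<Oplus>b\<in>C - {c}. ?t c b)" .
  qed (use t in \<open>auto intro!: finsum_closed\<close>)
  also have "\<dots> = \<zero>"
  proof (rule finsum_antisym_zero [OF fin])
    fix b c assume b: "b \<in> C" and c: "c \<in> C" and "b \<noteq> c"
    have "C - {b} - {c} = C - {c} - {b}" by auto
    moreover have "sgn C b \<otimes> sgn (C - {b}) c = \<ominus> (sgn C c \<otimes> sgn (C - {c}) b)"
      using b c \<open>b \<noteq> c\<close> by (intro sgn_antisym fin) auto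
    moreover have "?y b \<otimes> ?y c = ?y c \<otimes> ?y b" using y b c by (simp add: m_comm)
    moreover have "(\<ominus> (sgn C c \<otimes> sgn (C - {c}) b)) \<otimes> (?y c \<otimes> ?y b) \<otimes> a (C - {c} - {b}) = \<ominus> ?t c b"
      using y b c aC' [of c b] by (simp add: l_minus)
    ultimately show "?t b c = \<ominus> ?t c b" by simp
  qed (use t in auto)
  finally show ?thesis .
qed

lemma finsum_mem_ideal:
  assumes "ideal J R" "finite S" "\<And>s. s \<in> S \<Longrightarrow> f s \<in> J"
  shows "finsum R f S \<in> J"
  using assms(2,3)
proof (induction S rule: finite_induct)
  case empty
  then show ?case using additive_subgroup.zero_closed [OF ideal.axioms(1) [OF assms(1)]] by simp
next
  case (insert x S)
  have "f \<in> S \<rightarrow> carrier R" "f x \<in> carrier R" using insert.prems ideal.Icarr [OF assms(1)] by auto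
  then have "finsum R f (insert x S) = f x \<oplus> finsum R f S" using insert.hyps by (intro finsum_insert)
  then show ?case
    using insert additive_subgroup.a_closed [OF ideal.axioms(1) [OF assms(1)]] by simp
qed

lemma cobound_mem_ideal:
  assumes J: "ideal J R" and B: "B \<in> cech_index ys (Suc k)" and a: "\<And>A. A \<in> cech_index ys k \<Longrightarrow> a A \<in> J"
  shows "cobound n a B \<in> J"
  unfolding cobound_def
proof (rule finsum_mem_ideal [OF J])
  show "finite B" using cech_indexD B by blast
  fix b assume b: "b \<in> B"
  then have "b < length ys" using cech_indexD(1) [OF B] by auto
  then show "sgn B b \<otimes> ((ys ! b) [^] n \<otimes> a (B - {b})) \<in> J"
    by (intro ideal.I_l_closed [OF J] a cech_index_Diff [OF B b]) auto
qed

lemma is_cocycle_mono: "J \<subseteq> J' \<Longrightarrow> is_cocycle J k n a \<Longrightarrow> is_cocycle J' k n a"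
  unfolding is_cocycle_def by blast

lemma is_coboundary_mono: "J \<subseteq> J' \<Longrightarrow> is_coboundary J k n a \<Longrightarrow> is_coboundary J' k n a"
  unfolding is_coboundary_def by blast

lemma is_coboundary_cong:
  assumes J: "ideal J R" and a: "a \<in> cochains" "a' \<in> cochains"
    and d: "\<And>A. A \<in> cech_index ys k \<Longrightarrow> a' A \<ominus> a A \<in> J" and "is_coboundary J k n a"
  shows "is_coboundary J k n a'"
proof -
  obtain m b where b: "b \<in> cochains"
    and *: "\<And>A. A \<in> cech_index ys k \<Longrightarrow> yprod A [^] m \<otimes> a A \<ominus> cobound (n + m) b A \<in> J"
    using assms by (auto simp: is_coboundary_def)
  have "yprod A [^] m \<otimes> a' A \<ominus> cobound (n + m) b A \<in> J" if A: "A \<in> cech_index ys k" for A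
  proof -
    note A' = cech_indexD(1) [OF A]
    note c = yprod_closed [OF A', THEN nat_pow_closed, of m] cochainsD [OF a(1) A'] cochainsD [OF a(2) A']
      cobound_closed [OF b A', of "n + m"]
    have "yprod A [^] m \<otimes> a' A \<ominus> cobound (n + m) b A
        = yprod A [^] m \<otimes> (a' A \<ominus> a A) \<oplus> (yprod A [^] m \<otimes> a A \<ominus> cobound (n + m) b A)"
      using c by algebra
    then show ?thesis
      using ideal.I_l_closed [OF J d [OF A] c(1)] * [OF A]
        additive_subgroup.a_closed [OF ideal.axioms(1) [OF J]] by simp
  qed
  then show ?thesis using b unfolding is_coboundary_def by blast
qed

lemma is_coboundary_unscale:
  assumes "a \<in> cochains" "is_coboundary J k (n + m) (scale m a)" shows "is_coboundary J k n a"
proof -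
  obtain l b where b: "b \<in> cochains"
    and *: "\<And>A. A \<in> cech_index ys k \<Longrightarrow> yprod A [^] l \<otimes> scale m a A \<ominus> cobound (n + m + l) b A \<in> J"
    using assms by (auto simp: is_coboundary_def)
  have "yprod A [^] (m + l) \<otimes> a A \<ominus> cobound (n + (m + l)) b A \<in> J" if A: "A \<in> cech_index ys k" for A
  proof -
    note A' = cech_indexD(1) [OF A]
    have "yprod A [^] l \<otimes> scale m a A = yprod A [^] (m + l) \<otimes> a A"
      using yprod_closed [OF A'] cochainsD [OF assms(1) A']
      by (simp add: scale_def add.commute flip: nat_pow_mult m_assoc)
    then show ?thesis using * [OF A] by (simp add: add.assoc)
  qed
  then show ?thesis using b unfolding is_coboundary_def by blast
qed

lemma is_coboundary_scale:
  assumes J: "ideal J R" and a: "a \<in> cochains" and "is_coboundary J k n a"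
  shows "is_coboundary J k (n + m) (scale m a)"
proof -
  obtain l b where b: "b \<in> cochains"
    and *: "\<And>A. A \<in> cech_index ys k \<Longrightarrow> yprod A [^] l \<otimes> a A \<ominus> cobound (n + l) b A \<in> J"
    using assms by (auto simp: is_coboundary_def)
  have "yprod A [^] l \<otimes> scale m a A \<ominus> cobound (n + m + l) (scale m b) A \<in> J" if A: "A \<in> cech_index ys k" for A
  proof -
    note A' = cech_indexD(1) [OF A]
    note c = yprod_closed [OF A', THEN nat_pow_closed, of m] yprod_closed [OF A', THEN nat_pow_closed, of l]
      cochainsD [OF a A'] cobound_closed [OF b A', of "n + l"]
    have e: "n + m + l = n + l + m" by simp
    have "yprod A [^] l \<otimes> scale m a A \<ominus> cobound (n + m + l) (scale m b) A
        = yprod A [^] m \<otimes> (yprod A [^] l \<otimes> a A \<ominus> cobound (n + l) b A)"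
      unfolding e cobound_scale [OF b A'] scale_def using c by algebra
    then show ?thesis using ideal.I_l_closed [OF J * [OF A] c(1)] by simp
  qed
  then show ?thesis using scale_cochain [OF b] unfolding is_coboundary_def by blast
qed

end

context cech_cring
begin

lemma is_coboundary_eq:
  assumes "is_coboundary J k n a" "\<And>A. A \<in> cech_index ys k \<Longrightarrow> a A = a' A"
  shows "is_coboundary J k n a'"
  using assms unfolding is_coboundary_def by simp

section \<open>The connecting homomorphism\<close>

text \<open>\<open>z\<close> represents the image of the class of \<open>a\<close> under
  \<open>H\<^sup>k(R/(J + (x))) \<rightarrow> H\<^sup>k\<^sup>+\<^sup>1(R/(J : x)) \<cong> H\<^sup>k\<^sup>+\<^sup>1(R/J)\<close>. Choosing \<open>z\<close> modulo \<open>(J : x)\<close> suffices because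
  \<open>(J : x)/J\<close> is torsion.\<close>

definition connects :: "'a set \<Rightarrow> 'a \<Rightarrow> nat \<Rightarrow> nat \<Rightarrow> (nat set \<Rightarrow> 'a) \<Rightarrow> (nat set \<Rightarrow> 'a) \<Rightarrow> bool" where
  "connects J x k n a z \<longleftrightarrow> (\<forall>B\<in>cech_index ys (Suc k). cobound n a B \<ominus> x \<otimes> z B \<in> J)"

text \<open>Says that (J : x)/J vanishes after inverting any member of \<open>ys\<close>. All terms
  of positive degree in its Cech complex are then zero, so R/(J : x) and R/J have the same
  cohomology in positive degrees.\<close>

definition colon_torsion :: "'a set \<Rightarrow> 'a \<Rightarrow> bool" where
  "colon_torsion J x \<longleftrightarrow> (\<forall>y\<in>set ys. \<forall>r\<in>carrier R. x \<otimes> r \<in> J \<longrightarrow> r \<in> sat y J)"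

text \<open>In positive degree every index set B contains some c, so y_B is a multiple of
  \<open>ys ! c\<close>, a power of which moves g B into J.\<close>

lemma colon_torsion_uniform:
  assumes J: "ideal J R" and tors: "colon_torsion J x" and g: "g \<in> cochains"
    and xg: "\<And>B. B \<in> cech_index ys (Suc k) \<Longrightarrow> x \<otimes> g B \<in> J"
  shows "\<exists>n. \<forall>B\<in>cech_index ys (Suc k). yprod B [^] (n::nat) \<otimes> g B \<in> J"
proof (rule finite_uniform_nat [OF finite_cech_index])
  fix B assume B: "B \<in> cech_index ys (Suc k)"
  note B' = cech_indexD(1) [OF B]
  have gB: "g B \<in> carrier R" using cochainsD [OF g B'] .
  have "B \<noteq> {}" using cech_indexD [OF B] by auto
  then obtain c where c: "c \<in> B" by blast
  have y: "ys ! c \<in> set ys" "ys ! c \<in> carrier R" using c B' by auto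
  have pc: "yprod (B - {c}) \<in> carrier R" using B' by (intro yprod_closed) blast
  obtain n :: nat where n: "(ys ! c) [^] n \<otimes> g B \<in> J"
    using tors y(1) gB xg [OF B] unfolding colon_torsion_def sat_def by blast
  have "yprod B [^] n \<otimes> g B = yprod (B - {c}) [^] n \<otimes> ((ys ! c) [^] n \<otimes> g B)"
    unfolding yprod_insert [OF B' c] using pc y gB by (simp add: nat_pow_distrib m_assoc)
  then have "yprod B [^] n \<otimes> g B \<in> J" using ideal.I_l_closed [OF J n nat_pow_closed [OF pc]] by simp
  then show "\<exists>n. yprod B [^] (n::nat) \<otimes> g B \<in> J" by blast
next
  fix B and n m :: nat
  assume B: "B \<in> cech_index ys (Suc k)" and n: "yprod B [^] n \<otimes> g B \<in> J" "n \<le> m"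
  note B' = cech_indexD(1) [OF B]
  show "yprod B [^] m \<otimes> g B \<in> J"
    by (rule pow_mult_mem_ideal_mono [OF J yprod_closed [OF B'] cochainsD [OF g B'] n])
qed

lemma connects_exists:
  assumes J: "ideal J R" and x: "x \<in> carrier R" and a: "a \<in> cochains"
    and cyc: "is_cocycle (Idl (insert x J)) k n a"
  shows "\<exists>l. \<exists>z\<in>cochains. connects J x k (n + l) (scale l a) z"
proof -
  obtain l :: nat where l: "\<And>B. B \<in> cech_index ys (Suc k) \<Longrightarrow> yprod B [^] l \<otimes> cobound n a B \<in> Idl (insert x J)"
    using cyc unfolding is_cocycle_def by blast
  have "\<exists>s\<in>carrier R. yprod B [^] l \<otimes> cobound n a B \<ominus> x \<otimes> s \<in> J" if B: "B \<in> cech_index ys (Suc k)" for B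
  proof -
    obtain u s where us: "u \<in> J" "s \<in> carrier R" "yprod B [^] l \<otimes> cobound n a B = u \<oplus> s \<otimes> x"
      using l [OF B] unfolding Idl_insert_ideal [OF J x] by blast
    have "u \<in> carrier R" using ideal.Icarr [OF J us(1)] .
    then have "u \<oplus> s \<otimes> x \<ominus> x \<otimes> s = u" using us(2) x by algebra
    then show ?thesis unfolding us(3) using us(1,2) by (intro bexI [of _ s]) simp_all
  qed
  then obtain s where s: "\<And>B. B \<in> cech_index ys (Suc k) \<Longrightarrow> s B \<in> carrier R"
    "\<And>B. B \<in> cech_index ys (Suc k) \<Longrightarrow> yprod B [^] l \<otimes> cobound n a B \<ominus> x \<otimes> s B \<in> J"
    by metis
  \<comment> \<open>The value zero off the index sets of size \<open>Suc k\<close> makes the choice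
    a total cochain.\<close>
  define z where "z B = (if B \<in> cech_index ys (Suc k) then s B else \<zero>)" for B
  have "z \<in> cochains" using s(1) by (intro cochainsI) (simp add: z_def)
  moreover have "connects J x k (n + l) (scale l a) z"
    unfolding connects_def
  proof
    fix B assume B: "B \<in> cech_index ys (Suc k)"
    show "cobound (n + l) (scale l a) B \<ominus> x \<otimes> z B \<in> J"
      unfolding cobound_scale [OF a cech_indexD(1) [OF B]] using s(2) [OF B] B by (simp add: z_def)
  qed
  ultimately show ?thesis by blast
qed

text \<open>Applying the differential to d a - x z in J leaves - x d z, as d d = 0. Thus d z lies in
  (J : x), and torsion removes it.\<close>

lemma connects_cocycle:
  assumes J: "ideal J R" and x: "x \<in> carrier R" and tors: "colon_torsion J x"
    and a: "a \<in> cochains" and z: "z \<in> cochains" and con: "connects J x k n a z"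
  shows "is_cocycle J (Suc k) n z"
proof -
  have "x \<otimes> cobound n z C \<in> J" if C: "C \<in> cech_index ys (Suc (Suc k))" for C
  proof -
    note C' = cech_indexD(1) [OF C]
    have "cobound n (\<lambda>B. cobound n a B \<ominus> x \<otimes> z B) C \<in> J"
      using con unfolding connects_def by (intro cobound_mem_ideal [OF J C]) blast
    also have "cobound n (\<lambda>B. cobound n a B \<ominus> x \<otimes> z B) C = \<ominus> (x \<otimes> cobound n z C)"
      using cobound_minus [OF cobound_cochain [OF a] z x C'] cobound_cobound [OF a C']
        cobound_closed [OF z C'] x by (simp add: minus_eq)
    finally have "\<ominus> (\<ominus> (x \<otimes> cobound n z C)) \<in> J"
      by (rule additive_subgroup.a_inv_closed [OF ideal.axioms(1) [OF J]])
    then show ?thesis using cobound_closed [OF z C'] x by simp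
  qed
  from colon_torsion_uniform [OF J tors cobound_cochain [OF z] this]
  show ?thesis unfolding is_cocycle_def by blast
qed

text \<open>If y^m a - d b = x v modulo J, then applying d and comparing with d a = x z gives x (y^m
  z - d v) = 0. So y^m z - d v is torsion, and after a further power of y it shows z to be a
  coboundary.\<close>

lemma connects_coboundary:
  assumes J: "ideal J R" and x: "x \<in> carrier R" and tors: "colon_torsion J x"
    and a: "a \<in> cochains" and z: "z \<in> cochains" and con: "connects J x k n a z"
    and cob: "is_coboundary (Idl (insert x J)) k n a"
  shows "is_coboundary J (Suc k) n z"
proof -
  obtain m b where b: "b \<in> cochains"
    and *: "\<And>A. A \<in> cech_index ys k \<Longrightarrow> yprod A [^] m \<otimes> a A \<ominus> cobound (n + m) b A \<in> Idl (insert x J)"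
    using cob unfolding is_coboundary_def by blast
  \<comment> \<open>The factor \<open>\<one>\<close> brings the difference into the form required by
    \<open>cobound_minus\<close>; the same device is used for g below.\<close>
  define c where "c A = scale m a A \<ominus> \<one> \<otimes> cobound (n + m) b A" for A
  have c: "c \<in> cochains"
    unfolding c_def using cochainsD [OF scale_cochain [OF a]] cochainsD [OF cobound_cochain [OF b]]
    by (intro cochainsI minus_closed m_closed one_closed) auto
  have "\<exists>v\<in>carrier R. c A \<ominus> x \<otimes> v \<in> J" if A: "A \<in> cech_index ys k" for A
  proof -
    have "c A \<in> Idl (insert x J)"
      using * [OF A] cobound_closed [OF b cech_indexD(1) [OF A]] by (simp add: c_def scale_def)
    then obtain u s where us: "u \<in> J" "s \<in> carrier R" "c A = u \<oplus> s \<otimes> x"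
      unfolding Idl_insert_ideal [OF J x] by blast
    have "u \<in> carrier R" using ideal.Icarr [OF J us(1)] .
    then have "u \<oplus> s \<otimes> x \<ominus> x \<otimes> s = u" using us(2) x by algebra
    then show ?thesis unfolding us(3) using us(1,2) by (intro bexI [of _ s]) simp_all
  qed
  then obtain v' where v': "\<And>A. A \<in> cech_index ys k \<Longrightarrow> v' A \<in> carrier R"
    "\<And>A. A \<in> cech_index ys k \<Longrightarrow> c A \<ominus> x \<otimes> v' A \<in> J" by metis
  define v where "v A = (if A \<in> cech_index ys k then v' A else \<zero>)" for A
  have v: "v \<in> cochains" using v'(1) by (intro cochainsI) (simp add: v_def)
  define g where "g B = scale m z B \<ominus> \<one> \<otimes> cobound (n + m) v B" for B
  have g: "g \<in> cochains"
    unfolding g_def using cochainsD [OF scale_cochain [OF z]] cochainsD [OF cobound_cochain [OF v]]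
    by (intro cochainsI minus_closed m_closed one_closed) auto
  have "x \<otimes> g B \<in> J" if B: "B \<in> cech_index ys (Suc k)" for B
  proof -
    note B' = cech_indexD(1) [OF B]
    note cl = cobound_closed [OF v B', of "n + m"] cobound_closed [OF a B', of n]
      nat_pow_closed [OF yprod_closed [OF B'], of m] cochainsD [OF z B']
    have "cobound (n + m) (\<lambda>A. c A \<ominus> x \<otimes> v A) B \<in> J"
      using v'(2) by (intro cobound_mem_ideal [OF J B]) (simp add: v_def)
    also have "cobound (n + m) (\<lambda>A. c A \<ominus> x \<otimes> v A) B
        = cobound (n + m) c B \<ominus> x \<otimes> cobound (n + m) v B"
      by (rule cobound_minus [OF c v x B'])
    also have "cobound (n + m) c B = yprod B [^] m \<otimes> cobound n a B"
      unfolding c_def cobound_minus [OF scale_cochain [OF a] cobound_cochain [OF b] one_closed B']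
        cobound_cobound [OF b B'] cobound_scale [OF a B'] using cl by (simp add: minus_eq)
    finally have 1: "yprod B [^] m \<otimes> cobound n a B \<ominus> x \<otimes> cobound (n + m) v B \<in> J" .
    have 2: "yprod B [^] m \<otimes> (cobound n a B \<ominus> x \<otimes> z B) \<in> J"
      using con B cl unfolding connects_def by (intro ideal.I_l_closed [OF J]) auto
    have "x \<otimes> g B = (yprod B [^] m \<otimes> cobound n a B \<ominus> x \<otimes> cobound (n + m) v B)
        \<oplus> \<ominus> (yprod B [^] m \<otimes> (cobound n a B \<ominus> x \<otimes> z B))"
      unfolding g_def scale_def using cl x by algebra
    then show ?thesis
      using additive_subgroup.a_closed [OF ideal.axioms(1) [OF J] 1
          additive_subgroup.a_inv_closed [OF ideal.axioms(1) [OF J] 2]] by simp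
  qed
  from colon_torsion_uniform [OF J tors g this]
  obtain N :: nat where N: "\<And>B. B \<in> cech_index ys (Suc k) \<Longrightarrow> yprod B [^] N \<otimes> g B \<in> J" by blast
  have "yprod B [^] (N + m) \<otimes> z B \<ominus> cobound (n + (N + m)) (scale N v) B \<in> J"
    if B: "B \<in> cech_index ys (Suc k)" for B
  proof -
    note B' = cech_indexD(1) [OF B]
    have e: "n + (N + m) = (n + m) + N" by simp
    have "yprod B [^] (N + m) \<otimes> z B \<ominus> cobound (n + (N + m)) (scale N v) B = yprod B [^] N \<otimes> g B"
      unfolding e cobound_scale [OF v B'] g_def scale_def nat_pow_mult [OF yprod_closed [OF B'], symmetric]
      using cobound_closed [OF v B', of "n + m"] nat_pow_closed [OF yprod_closed [OF B'], of m]
        nat_pow_closed [OF yprod_closed [OF B'], of N] cochainsD [OF z B'] by algebra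
    then show ?thesis using N [OF B] by simp
  qed
  then show ?thesis using scale_cochain [OF v] unfolding is_coboundary_def by blast
qed

text \<open>Exactness at H^k(R/(J, x)): if y^m z = d b, then y^m a - x b is a cocycle already modulo
  J, and it agrees with y^m a modulo x.\<close>

lemma connects_lift:
  assumes J: "ideal J R" and x: "x \<in> carrier R"
    and a: "a \<in> cochains" and z: "z \<in> cochains" and con: "connects J x k n a z"
    and cob: "is_coboundary J (Suc k) n z"
  shows "\<exists>m. \<exists>a'\<in>cochains. is_cocycle J k (n + m) a' \<and>
    (\<forall>A\<in>cech_index ys k. a' A \<ominus> scale m a A \<in> Idl (insert x J))"
proof -
  obtain m b where b: "b \<in> cochains"
    and *: "\<And>B. B \<in> cech_index ys (Suc k) \<Longrightarrow> yprod B [^] m \<otimes> z B \<ominus> cobound (n + m) b B \<in> J"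
    using cob unfolding is_coboundary_def by blast
  define a' where "a' A = scale m a A \<ominus> x \<otimes> b A" for A
  have a': "a' \<in> cochains"
    unfolding a'_def using cochainsD [OF scale_cochain [OF a]] cochainsD [OF b] x
    by (intro cochainsI minus_closed m_closed) auto
  have "cobound (n + m) a' B \<in> J" if B: "B \<in> cech_index ys (Suc k)" for B
  proof -
    note B' = cech_indexD(1) [OF B]
    note cl = cobound_closed [OF b B', of "n + m"] cobound_closed [OF a B', of n]
      nat_pow_closed [OF yprod_closed [OF B'], of m] cochainsD [OF z B']
    have 1: "yprod B [^] m \<otimes> (cobound n a B \<ominus> x \<otimes> z B) \<in> J"
      using con B cl unfolding connects_def by (intro ideal.I_l_closed [OF J]) auto
    have 2: "x \<otimes> (yprod B [^] m \<otimes> z B \<ominus> cobound (n + m) b B) \<in> J"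
      by (rule ideal.I_l_closed [OF J * [OF B] x])
    have "cobound (n + m) a' B = yprod B [^] m \<otimes> cobound n a B \<ominus> x \<otimes> cobound (n + m) b B"
      unfolding a'_def cobound_minus [OF scale_cochain [OF a] b x B'] cobound_scale [OF a B'] ..
    also have "\<dots> = yprod B [^] m \<otimes> (cobound n a B \<ominus> x \<otimes> z B)
        \<oplus> x \<otimes> (yprod B [^] m \<otimes> z B \<ominus> cobound (n + m) b B)"
      using cl x by algebra
    finally show ?thesis using additive_subgroup.a_closed [OF ideal.axioms(1) [OF J] 1 2] by simp
  qed
  then have "is_cocycle J k (n + m) a'"
    unfolding is_cocycle_def using a' cobound_closed cech_indexD(1)
    by (intro exI [of _ 0]) simp
  moreover have "a' A \<ominus> scale m a A \<in> Idl (insert x J)" if A: "A \<in> cech_index ys k" for A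
  proof -
    note A' = cech_indexD(1) [OF A]
    note cl = cochainsD [OF scale_cochain [OF a] A', of m] cochainsD [OF b A']
    have I: "ideal (Idl (insert x J)) R" using ideal_Idl_insert [OF J x] .
    have "x \<in> Idl (insert x J)"
      using genideal_self [of "insert x J"] x ideal.Icarr [OF J] by blast
    then have "(\<ominus> b A) \<otimes> x \<in> Idl (insert x J)" using cl by (intro ideal.I_l_closed [OF I]) auto
    moreover have "a' A \<ominus> scale m a A = (\<ominus> b A) \<otimes> x" unfolding a'_def using cl x by algebra
    ultimately show ?thesis by simp
  qed
  ultimately show ?thesis using a' by blast
qed

end

section \<open>Frobenius on cochains\<close>

locale cech_char_p_cring = cech_cring R ys + char_p_cring R p for R (structure) and ys p
begin

definition frob :: "nat \<Rightarrow> (nat set \<Rightarrow> 'a) \<Rightarrow> nat set \<Rightarrow> 'a" where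
  "frob e a A = a A [^] (p ^ e)"

lemma frob_cochain: "a \<in> cochains \<Longrightarrow> frob e a \<in> cochains"
  unfolding frob_def by (rule cochainsI, rule nat_pow_closed, erule (1) cochainsD)

lemma sgn_frob: "sgn B b [^] (p ^ e) = sgn B b"
  by (simp add: sgn_def frob_neg)

lemma cobound_frob:
  assumes a: "a \<in> cochains" and B: "B \<subseteq> {..<length ys}"
  shows "cobound (p ^ e * n) (frob e a) B = cobound n a B [^] (p ^ e)"
proof -
  have "cobound n a B [^] (p ^ e) = (\<Oplus>b\<in>B. (sgn B b \<otimes> ((ys ! b) [^] n \<otimes> a (B - {b}))) [^] (p ^ e))"
    unfolding cobound_def by (rule frob_finsum [OF cobound_summand [OF a B]])
  also have "\<dots> = cobound (p ^ e * n) (frob e a) B"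
    unfolding cobound_def
  proof (rule finsum_cong' [OF refl cobound_summand [OF frob_cochain [OF a] B]])
    fix b assume b: "b \<in> B"
    then have y: "ys ! b \<in> carrier R" using B by auto
    have c: "a (B - {b}) \<in> carrier R" using B by (intro cochainsD [OF a]) blast
    show "(sgn B b \<otimes> ((ys ! b) [^] n \<otimes> a (B - {b}))) [^] (p ^ e)
      = sgn B b \<otimes> ((ys ! b) [^] (p ^ e * n) \<otimes> frob e a (B - {b}))"
      using y c by (simp add: nat_pow_distrib nat_pow_pow sgn_frob frob_def mult.commute)
  qed
  finally show ?thesis by simp
qed

lemma is_coboundary_frob:
  assumes J: "\<And>r. r \<in> J \<Longrightarrow> r [^] (p ^ e) \<in> J'" and a: "a \<in> cochains"
    and "is_coboundary J k n a"
  shows "is_coboundary J' k (p ^ e * n) (frob e a)"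
proof -
  obtain m b where b: "b \<in> cochains"
    and *: "\<And>A. A \<in> cech_index ys k \<Longrightarrow> yprod A [^] m \<otimes> a A \<ominus> cobound (n + m) b A \<in> J"
    using assms(3) unfolding is_coboundary_def by blast
  have "yprod A [^] (p ^ e * m) \<otimes> frob e a A \<ominus> cobound (p ^ e * n + p ^ e * m) (frob e b) A \<in> J'"
    if A: "A \<in> cech_index ys k" for A
  proof -
    note A' = cech_indexD(1) [OF A]
    have "(yprod A [^] m \<otimes> a A \<ominus> cobound (n + m) b A) [^] (p ^ e)
      = (yprod A [^] m \<otimes> a A) [^] (p ^ e) \<ominus> cobound (n + m) b A [^] (p ^ e)"
      using yprod_closed [OF A'] cochainsD [OF a A'] cobound_closed [OF b A'] by (intro frob_minus) auto
    also have "\<dots> = yprod A [^] (p ^ e * m) \<otimes> frob e a A \<ominus> cobound (p ^ e * n + p ^ e * m) (frob e b) A"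
      using yprod_closed [OF A'] cochainsD [OF a A'] cobound_frob [OF b A', of e "n + m"]
      by (simp add: frob_def nat_pow_distrib nat_pow_pow mult.commute distrib_left distrib_right)
    finally show ?thesis using J [OF * [OF A]] by simp
  qed
  then show ?thesis using frob_cochain [OF b] unfolding is_coboundary_def by blast
qed

text \<open>Frobenius commutes with the connecting homomorphism, but it changes the sequence: the
  multiplier x becomes x^(p^e) and J becomes J'. This is why the main induction follows a whole
  family of ideals.\<close>

lemma connects_frob:
  assumes J: "\<And>r. r \<in> J \<Longrightarrow> r [^] (p ^ e) \<in> J'" and x: "x \<in> carrier R"
    and a: "a \<in> cochains" and z: "z \<in> cochains" and con: "connects J x k n a z"
  shows "connects J' (x [^] (p ^ e)) k (p ^ e * n) (frob e a) (frob e z)"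
  unfolding connects_def
proof
  fix B assume B: "B \<in> cech_index ys (Suc k)"
  note B' = cech_indexD(1) [OF B]
  have "(cobound n a B \<ominus> x \<otimes> z B) [^] (p ^ e)
      = cobound (p ^ e * n) (frob e a) B \<ominus> x [^] (p ^ e) \<otimes> frob e z B"
    using x cochainsD [OF z B'] cobound_closed [OF a B']
    by (simp add: frob_minus cobound_frob [OF a B'] frob_def nat_pow_distrib)
  moreover have "cobound n a B \<ominus> x \<otimes> z B \<in> J" using con B by (simp add: connects_def)
  ultimately show "cobound (p ^ e * n) (frob e a) B \<ominus> x [^] (p ^ e) \<otimes> frob e z B \<in> J'"
    using J by metis
qed

lemma frob_frob:
  assumes "a \<in> cochains" "A \<in> cech_index ys k" shows "frob e (frob f a) A = frob (f + e) a A"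
  using cochainsD [OF assms(1) cech_indexD(1) [OF assms(2)]]
  by (simp add: frob_def nat_pow_pow power_add)

lemma frob_scale:
  assumes "a \<in> cochains" "A \<in> cech_index ys k"
  shows "frob e (scale m a) A = scale (p ^ e * m) (frob e a) A"
  using cochainsD [OF assms(1) cech_indexD(1) [OF assms(2)]] yprod_closed [OF cech_indexD(1) [OF assms(2)]]
  by (simp add: frob_def scale_def nat_pow_pow nat_pow_distrib mult.commute)

text \<open>The two summands come from the image of a class under the connecting homomorphism and from its lift
  along the projection.\<close>

fun killing_exponent :: "(nat \<Rightarrow> nat) \<Rightarrow> nat \<Rightarrow> nat \<Rightarrow> nat" where
  "killing_exponent h 0 j = h j"
| "killing_exponent h (Suc i) j = killing_exponent h i (Suc j) + killing_exponent h i j"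

lemma killing_exponent_eq: "killing_exponent h i j = (\<Sum>k\<le>i. (i choose k) * h (j + k))"
proof (induction i arbitrary: j)
  case (Suc i)
  have "(\<Sum>k\<le>Suc i. (Suc i choose k) * h (j + k))
      = h j + (\<Sum>k\<le>i. (Suc i choose Suc k) * h (j + Suc k))"
    by (subst sum.atMost_Suc_shift) simp
  also have "\<dots> = (\<Sum>k\<le>i. (i choose k) * h (Suc j + k)) + (h j + (\<Sum>k\<le>i. (i choose Suc k) * h (j + Suc k)))"
    by (simp add: distrib_right sum.distrib)
  also have "h j + (\<Sum>k\<le>i. (i choose Suc k) * h (j + Suc k)) = (\<Sum>k\<le>Suc i. (i choose k) * h (j + k))"
    by (subst sum.atMost_Suc_shift) simp
  also have "\<dots> = (\<Sum>k\<le>i. (i choose k) * h (j + k))" by simp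
  finally show ?case using Suc by simp
qed simp

text \<open>Abstract form of the main induction, with J i e standing for q_i^[p^e]:
  \<open>base\<close> is the HSL bound and \<open>descent\<close> the hypothesis on \<alpha>. The
  exponent f that happens to kill a class is replaced by one depending on i and j only. The step to
  (Suc i, j) uses (i, Suc j) and (i, j), which stay within i + j \<le> d. It uses the latter at
  level e + u, so the level must be arbitrary in the induction.\<close>

lemma killing_exponent_kills:
  fixes J :: "nat \<Rightarrow> nat \<Rightarrow> 'a set" and x :: "nat \<Rightarrow> 'a"
  assumes J: "\<And>i e. ideal (J i e) R"
    and JF: "\<And>i e f r. r \<in> J i e \<Longrightarrow> r [^] (p ^ f) \<in> J i (e + f)"
    and Jx: "\<And>i e. i < d \<Longrightarrow> J (Suc i) e = Idl (insert (x i [^] (p ^ e)) (J i e))"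
    and x: "\<And>i. i < d \<Longrightarrow> x i \<in> carrier R"
    and tors: "\<And>i e. i < d \<Longrightarrow> colon_torsion (J i e) (x i [^] (p ^ e))"
    and base: "\<And>j e n f a. j \<le> d \<Longrightarrow> a \<in> cochains \<Longrightarrow> is_cocycle (J 0 e) j n a \<Longrightarrow>
      is_coboundary (J 0 (e + f)) j (p ^ f * n) (frob f a) \<Longrightarrow>
      is_coboundary (J 0 (e + h j)) j (p ^ h j * n) (frob (h j) a)"
    and descent: "\<And>i j e n f a. e \<ge> e0 \<Longrightarrow> Suc i + j \<le> d \<Longrightarrow> a \<in> cochains \<Longrightarrow> is_cocycle (J i e) j n a \<Longrightarrow>
      is_coboundary (J (Suc i) (e + f)) j (p ^ f * n) (frob f a) \<Longrightarrow>
      \<exists>g. is_coboundary (J i (e + g)) j (p ^ g * n) (frob g a)"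
    and "e \<ge> e0" "i + j \<le> d" "a \<in> cochains" "is_cocycle (J i e) j n a"
    and "is_coboundary (J i (e + f)) j (p ^ f * n) (frob f a)"
  shows "is_coboundary (J i (e + killing_exponent h i j)) j
    (p ^ killing_exponent h i j * n) (frob (killing_exponent h i j) a)"
  using assms(8-)
proof (induction i arbitrary: j e n f a)
  case 0
  then show ?case using base [of j a e n f] by simp
next
  case (Suc i)
  have id: "i < d" using Suc.prems by simp
  have a: "a \<in> cochains" using Suc.prems by simp
  \<comment> \<open>u bounds the iterations that kill the connecting image, in degree j + 1, and v
    the further ones that kill the lift, in degree j.\<close>
  define u where "u = killing_exponent h i (Suc j)"
  define v where "v = killing_exponent h i j"
  note xe = nat_pow_closed [OF x [OF id]]
  obtain l z where z: "z \<in> cochains"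
    and con: "connects (J i e) (x i [^] (p ^ e)) j (n + l) (scale l a) z"
    using connects_exists [OF J xe a] Suc.prems(4) unfolding Jx [OF id] by blast
  let ?al = "scale l a"
  have al: "?al \<in> cochains" using a by (rule scale_cochain)
  have cob_al: "is_coboundary (J (Suc i) (e + f)) j (p ^ f * (n + l)) (frob f ?al)"
  proof (rule is_coboundary_eq)
    show "is_coboundary (J (Suc i) (e + f)) j (p ^ f * (n + l)) (scale (p ^ f * l) (frob f a))"
      using is_coboundary_scale [OF J frob_cochain [OF a] Suc.prems(5)] by (simp add: distrib_left)
  qed (simp add: frob_scale [OF a])
  \<comment> \<open>After g iterations the pair is connected at level e + g, with multiplier
    x_i^(p^(e + g)).\<close>
  have con_frob: "connects (J i (e + g)) (x i [^] (p ^ (e + g))) j (p ^ g * (n + l)) (frob g ?al) (frob g z)" for g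
    using connects_frob [where J = "J i e" and J' = "J i (e + g)", OF JF xe al z con] x [OF id] by (simp add: nat_pow_pow power_add)
  \<comment> \<open>By naturality the f iterations that kill a also kill z. This only makes z
    eligible for the induction hypothesis, which supplies the bound u.\<close>
  have "is_coboundary (J i (e + f)) (Suc j) (p ^ f * (n + l)) (frob f z)"
    by (rule connects_coboundary [OF J xe tors [OF id] frob_cochain [OF al] frob_cochain [OF z] con_frob])
       (use cob_al Jx [OF id] in simp)
  moreover have "is_cocycle (J i e) (Suc j) (n + l) z"
    by (rule connects_cocycle [OF J xe tors [OF id] al z con])
  ultimately have "is_coboundary (J i (e + u)) (Suc j) (p ^ u * (n + l)) (frob u z)"
    using Suc.IH [OF Suc.prems(1) _ z, of "Suc j"] Suc.prems(2) unfolding u_def by simp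
  from connects_lift [OF J xe frob_cochain [OF al] frob_cochain [OF z] con_frob this]
  obtain m a' where a': "a' \<in> cochains" "is_cocycle (J i (e + u)) j (p ^ u * (n + l) + m) a'"
    and diff: "\<And>A. A \<in> cech_index ys j \<Longrightarrow> a' A \<ominus> scale m (frob u ?al) A \<in> J (Suc i) (e + u)"
    unfolding Jx [OF id] by blast
  let ?w = "scale m (frob u ?al)" and ?N = "p ^ u * (n + l) + m"
  have w: "?w \<in> cochains" by (rule scale_cochain [OF frob_cochain [OF al]])
  have diff_frob: "frob g a' A \<ominus> frob g ?w A \<in> J (Suc i) (e + u + g)"
    if A: "A \<in> cech_index ys j" for A g
    using JF [OF diff [OF A], of g] frob_minus [of "a' A" "?w A" g] cochainsD [OF a'(1) cech_indexD(1) [OF A]]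
      cochainsD [OF w cech_indexD(1) [OF A]] by (simp add: frob_def)
  have frob_w: "frob g ?w A = scale (p ^ g * m) (frob (u + g) ?al) A" if "A \<in> cech_index ys j" for A g
    using frob_scale [OF frob_cochain [OF al] that, of g m u] frob_frob [OF al that, of g u]
    by (simp add: scale_def)
  \<comment> \<open>Modulo J (Suc i) the lift a' agrees with w, a rescaling of \<open>frob u\<close>
    of the original class. Applying Frobenius u times to \<open>cob_al\<close> and exchanging the
    order of the exponents shows that f iterations from level e + u kill it; \<open>descent\<close>
    then transfers nilpotence to J i.\<close>
  have "is_coboundary (J (Suc i) (e + u + f)) j (p ^ f * ?N) (frob f a')"
  proof (rule is_coboundary_cong [OF J _ frob_cochain [OF a'(1)] diff_frob])
    show fw: "frob f ?w \<in> cochains" using w by (rule frob_cochain)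
    have "is_coboundary (J (Suc i) (e + f + u)) j (p ^ u * (p ^ f * (n + l))) (frob u (frob f ?al))"
      by (rule is_coboundary_frob [OF JF frob_cochain [OF al] cob_al])
    moreover have "e + f + u = e + u + f" "p ^ u * (p ^ f * (n + l)) = p ^ f * (p ^ u * (n + l))"
      by simp_all
    ultimately have "is_coboundary (J (Suc i) (e + u + f)) j (p ^ f * (p ^ u * (n + l))) (frob u (frob f ?al))"
      by (simp only:)
    then have "is_coboundary (J (Suc i) (e + u + f)) j (p ^ f * (p ^ u * (n + l))) (frob (u + f) ?al)"
      by (rule is_coboundary_eq) (simp add: frob_frob [OF al] add.commute [of f u])
    from is_coboundary_scale [OF J frob_cochain [OF al] this, of "p ^ f * m"]
    have "is_coboundary (J (Suc i) (e + u + f)) j (p ^ f * ?N) (scale (p ^ f * m) (frob (u + f) ?al))"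
      by (simp add: distrib_left)
    then show "is_coboundary (J (Suc i) (e + u + f)) j (p ^ f * ?N) (frob f ?w)"
      by (rule is_coboundary_eq) (simp add: frob_w)
  qed
  then obtain g where "is_coboundary (J i (e + u + g)) j (p ^ g * ?N) (frob g a')"
    using descent [of "e + u" i j a' ?N f] Suc.prems(1,2) a' by auto
  then have "is_coboundary (J i (e + u + v)) j (p ^ v * ?N) (frob v a')"
    using Suc.IH [of "e + u" j a' ?N g] Suc.prems(1,2) a' unfolding v_def by simp
  \<comment> \<open>The uniform bound found for the lift over J i is carried along the projection to
    J (Suc i), where a' may again be replaced by w.\<close>
  moreover have "J i (e + u + v) \<subseteq> J (Suc i) (e + u + v)"
    unfolding Jx [OF id] using genideal_self [of "insert (x i [^] p ^ (e + u + v)) (J i (e + u + v))"]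
      xe ideal.Icarr [OF J] by blast
  ultimately have *: "is_coboundary (J (Suc i) (e + u + v)) j (p ^ v * ?N) (frob v a')"
    by (rule is_coboundary_mono [rotated])
  have "is_coboundary (J (Suc i) (e + u + v)) j (p ^ v * ?N) (frob v ?w)"
  proof (rule is_coboundary_cong [OF J frob_cochain [OF a'(1)] frob_cochain [OF w] _ *])
    fix A assume A: "A \<in> cech_index ys j"
    note A' = cech_indexD(1) [OF A]
    have "frob v ?w A \<ominus> frob v a' A = \<ominus> (frob v a' A \<ominus> frob v ?w A)"
      using cochainsD [OF frob_cochain [OF a'(1)] A', of v] cochainsD [OF frob_cochain [OF w] A', of v] by algebra
    then show "frob v ?w A \<ominus> frob v a' A \<in> J (Suc i) (e + u + v)"
      using additive_subgroup.a_inv_closed [OF ideal.axioms(1) [OF J] diff_frob [OF A, of v]] by simp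
  qed
  \<comment> \<open>Two expansions of denominators have accumulated, m from the lift and l from the
    choice of z. They are cancelled in turn to return to a.\<close>
  then have "is_coboundary (J (Suc i) (e + u + v)) j (p ^ v * ?N) (scale (p ^ v * m) (frob (u + v) ?al))"
    by (rule is_coboundary_eq) (simp add: frob_w)
  then have "is_coboundary (J (Suc i) (e + u + v)) j (p ^ v * (p ^ u * (n + l))) (frob (u + v) ?al)"
    by (intro is_coboundary_unscale [OF frob_cochain [OF al], of _ _ _ "p ^ v * m"]) (simp add: distrib_left)
  then have "is_coboundary (J (Suc i) (e + u + v)) j (p ^ (u + v) * n + p ^ (u + v) * l)
      (frob (u + v) ?al)"
    by (simp add: power_add algebra_simps)
  then have "is_coboundary (J (Suc i) (e + u + v)) j (p ^ (u + v) * n + p ^ (u + v) * l)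
      (scale (p ^ (u + v) * l) (frob (u + v) a))"
    by (rule is_coboundary_eq) (simp add: frob_scale [OF a])
  then have "is_coboundary (J (Suc i) (e + u + v)) j (p ^ (u + v) * n) (frob (u + v) a)"
    by (rule is_coboundary_unscale [OF frob_cochain [OF a]])
  then show ?case by (simp add: u_def v_def add.assoc)
qed

end

section \<open>The Cech complex of a cyclic module\<close>

text \<open>\<open>M\<close> is \<open>R/J\<close> with projection \<open>\<pi>\<close>. Both \<open>R\<close> itself and the quotients by Frobenius powers are of
  this form.\<close>

locale cyclic_cech = cech_cring R ys + J: ideal J R
  for R :: "('a, 'r) ring_scheme" (structure) and ys :: "'a list" and J :: "'a set"
    and M :: "('a, 'b, 'm) module_scheme" and \<pi> :: "'a \<Rightarrow> 'b" +
  assumes M_carrier: "carrier M = \<pi> ` carrier R"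
    and M_add: "r \<in> carrier R \<Longrightarrow> s \<in> carrier R \<Longrightarrow> \<pi> r \<oplus>\<^bsub>M\<^esub> \<pi> s = \<pi> (r \<oplus> s)"
    and M_smult: "r \<in> carrier R \<Longrightarrow> s \<in> carrier R \<Longrightarrow> r \<odot>\<^bsub>M\<^esub> \<pi> s = \<pi> (r \<otimes> s)"
    and M_zero: "\<zero>\<^bsub>M\<^esub> = \<pi> \<zero>"
    and \<pi>_eq_iff: "r \<in> carrier R \<Longrightarrow> s \<in> carrier R \<Longrightarrow> \<pi> r = \<pi> s \<longleftrightarrow> r \<ominus> s \<in> J"
begin

definition frac :: "'a \<Rightarrow> 'a \<Rightarrow> nat \<Rightarrow> ('b \<times> nat) set" where
  "frac y a n = loc_frac R M y (\<pi> a) n"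

lemma loc_rel_iff:
  assumes "y \<in> carrier R" "a \<in> carrier R" "b \<in> carrier R"
  shows "((\<pi> a, n), (\<pi> b, k)) \<in> loc_rel R M y
    \<longleftrightarrow> (\<exists>l::nat. y [^] l \<otimes> (y [^] k \<otimes> a \<ominus> y [^] n \<otimes> b) \<in> J)"
proof -
  have "(y [^] l \<odot>\<^bsub>M\<^esub> (y [^] k \<odot>\<^bsub>M\<^esub> \<pi> a) = y [^] l \<odot>\<^bsub>M\<^esub> (y [^] n \<odot>\<^bsub>M\<^esub> \<pi> b))
    \<longleftrightarrow> y [^] l \<otimes> (y [^] k \<otimes> a \<ominus> y [^] n \<otimes> b) \<in> J" for l :: nat
  proof -
    have "y [^] l \<otimes> (y [^] k \<otimes> a) \<ominus> y [^] l \<otimes> (y [^] n \<otimes> b) = y [^] l \<otimes> (y [^] k \<otimes> a \<ominus> y [^] n \<otimes> b)"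
      using assms nat_pow_closed [of y l] nat_pow_closed [of y k] nat_pow_closed [of y n] by algebra
    then show ?thesis using assms by (simp add: M_smult \<pi>_eq_iff)
  qed
  then show ?thesis using assms by (auto simp: loc_rel_def M_carrier)
qed

lemma equiv_loc_rel:
  assumes y: "y \<in> carrier R" shows "equiv (carrier M \<times> UNIV) (loc_rel R M y)"
proof (rule equivI)
  show "loc_rel R M y \<subseteq> (carrier M \<times> UNIV) \<times> (carrier M \<times> UNIV)" by (auto simp: loc_rel_def)
  show "refl_on (carrier M \<times> UNIV) (loc_rel R M y)"
    by (rule refl_onI) (auto simp: loc_rel_def)
  show "sym (loc_rel R M y)" 
    unfolding loc_rel_def by (rule symI, clarsimp, rule exI, erule sym)
  show "trans (loc_rel R M y)"
  proof (rule transI)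
    fix s t u assume st: "(s, t) \<in> loc_rel R M y" and tu: "(t, u) \<in> loc_rel R M y"
    obtain s' n t' k u' m where eq: "s = (s', n)" "t = (t', k)" "u = (u', m)" by (metis surj_pair)
    have "s' \<in> carrier M" "t' \<in> carrier M" "u' \<in> carrier M" using st tu eq by (auto simp: loc_rel_def)
    then obtain a b c where abc: "s' = \<pi> a" "t' = \<pi> b" "u' = \<pi> c"
      and c: "a \<in> carrier R" "b \<in> carrier R" "c \<in> carrier R" unfolding M_carrier by blast
    obtain l l' :: nat where l: "y [^] l \<otimes> (y [^] k \<otimes> a \<ominus> y [^] n \<otimes> b) \<in> J"
      "y [^] l' \<otimes> (y [^] m \<otimes> b \<ominus> y [^] k \<otimes> c) \<in> J"
      using st tu loc_rel_iff [OF y c(1,2)] loc_rel_iff [OF y c(2,3)] unfolding eq abc by blast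
    have p: "y [^] i \<in> carrier R" for i :: nat using y by simp
    \<comment> \<open>Besides the two witnesses l and l', the denominator y^k of the middle fraction
      is needed to eliminate b.\<close>
    have "y [^] (l + l' + k) \<otimes> (y [^] m \<otimes> a \<ominus> y [^] n \<otimes> c)
      = (y [^] l' \<otimes> y [^] m) \<otimes> (y [^] l \<otimes> (y [^] k \<otimes> a \<ominus> y [^] n \<otimes> b))
        \<oplus> (y [^] l \<otimes> y [^] n) \<otimes> (y [^] l' \<otimes> (y [^] m \<otimes> b \<ominus> y [^] k \<otimes> c))"
      unfolding nat_pow_mult [OF y, symmetric]
      using c p [of l] p [of l'] p [of k] p [of m] p [of n] by algebra
    also have "\<dots> \<in> J" using p by (intro J.a_closed J.I_l_closed l) simp_all
    finally show "(s, u) \<in> loc_rel R M y" using loc_rel_iff [OF y c(1,3)] unfolding eq abc by blast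
  qed
qed

lemma frac_eq_iff:
  assumes "y \<in> carrier R" "a \<in> carrier R" "b \<in> carrier R"
  shows "frac y a n = frac y b k \<longleftrightarrow> (\<exists>l::nat. y [^] l \<otimes> (y [^] k \<otimes> a \<ominus> y [^] n \<otimes> b) \<in> J)"
  using eq_equiv_class_iff [OF equiv_loc_rel [OF assms(1)], of "(\<pi> a, n)" "(\<pi> b, k)"]
    loc_rel_iff [OF assms] assms by (simp add: frac_def loc_frac_def M_carrier)

lemma loc_carrier:
  "y \<in> carrier R \<Longrightarrow> carrier (loc_module R M y) = {frac y a n | a n. a \<in> carrier R}"
  by (auto simp: loc_module_def quotient_def frac_def loc_frac_def M_carrier)

text \<open>Operations on classes are unions over representatives. If every representative yields
  the same set, the nonempty union is that set; it suffices to compare each one with the fixed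
  representative (\<pi> a, n).\<close>

lemma UN_frac:
  assumes y: "y \<in> carrier R" and a: "a \<in> carrier R"
    and wd: "\<And>b k l. b \<in> carrier R \<Longrightarrow> y [^] (l::nat) \<otimes> (y [^] n \<otimes> b \<ominus> y [^] k \<otimes> a) \<in> J \<Longrightarrow> f (\<pi> b) k = f (\<pi> a) n"
  shows "(\<Union>(x, m)\<in>frac y a n. f x m) = f (\<pi> a) n"
proof -
  have eqv: "equiv (carrier M \<times> UNIV) (loc_rel R M y)" using y by (rule equiv_loc_rel)
  have "(\<pi> a, n) \<in> frac y a n"
    unfolding frac_def loc_frac_def by (rule equiv_class_self [OF eqv]) (use a M_carrier in auto)
  moreover have "f x m = f (\<pi> a) n" if "(x, m) \<in> frac y a n" for x m
  proof -
    have "((\<pi> a, n), (x, m)) \<in> loc_rel R M y" using that by (simp add: frac_def loc_frac_def)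
    then have "((x, m), (\<pi> a, n)) \<in> loc_rel R M y" using eqv by (meson equivE symD)
    moreover from this obtain b where b: "x = \<pi> b" "b \<in> carrier R"
      by (auto simp: loc_rel_def M_carrier)
    ultimately show ?thesis using loc_rel_iff [OF y b(2) a] wd [OF b(2)] unfolding b(1) by blast
  qed
  ultimately show ?thesis by blast
qed

lemma frac_add:
  assumes y: "y \<in> carrier R" and ab: "a \<in> carrier R" "b \<in> carrier R"
  shows "frac y a n \<oplus>\<^bsub>loc_module R M y\<^esub> frac y b k = frac y (y [^] k \<otimes> a \<oplus> y [^] n \<otimes> b) (n + k)"
proof -
  have p: "y [^] i \<in> carrier R" for i :: nat using y by simp
  let ?g = "\<lambda>x m z j. loc_frac R M y (y [^] j \<odot>\<^bsub>M\<^esub> x \<oplus>\<^bsub>M\<^esub> y [^] m \<odot>\<^bsub>M\<^esub> z) (m + j)"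
  have g: "?g (\<pi> c) m (\<pi> d) j = frac y (y [^] j \<otimes> c \<oplus> y [^] m \<otimes> d) (m + j)"
    if "c \<in> carrier R" "d \<in> carrier R" for c d and m j :: nat
    using that p by (simp add: frac_def M_smult M_add)
  \<comment> \<open>Independence of representatives is checked one summand at a time: here for the
    second with the first fixed, then in \<open>outer\<close> for the first.\<close>
  have inner: "(\<Union>(z, j)\<in>frac y b k. ?g (\<pi> c) m z j) = ?g (\<pi> c) m (\<pi> b) k" if c: "c \<in> carrier R" for c and m :: nat
  proof (rule UN_frac [OF y ab(2)])
    fix d and j l :: nat assume d: "d \<in> carrier R" and l: "y [^] l \<otimes> (y [^] k \<otimes> d \<ominus> y [^] j \<otimes> b) \<in> J"
    have "y [^] l \<otimes> (y [^] (m + k) \<otimes> (y [^] j \<otimes> c \<oplus> y [^] m \<otimes> d)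
          \<ominus> y [^] (m + j) \<otimes> (y [^] k \<otimes> c \<oplus> y [^] m \<otimes> b))
       = (y [^] m \<otimes> y [^] m) \<otimes> (y [^] l \<otimes> (y [^] k \<otimes> d \<ominus> y [^] j \<otimes> b))"
      unfolding nat_pow_mult [OF y, symmetric]
      using c d ab(2) p [of l] p [of m] p [of k] p [of j] by algebra
    also have "\<dots> \<in> J" using p by (intro J.I_l_closed l) simp
    finally show "?g (\<pi> c) m (\<pi> d) j = ?g (\<pi> c) m (\<pi> b) k"
      unfolding g [OF c d] g [OF c ab(2)] using c d ab(2) p by (subst frac_eq_iff [OF y]) auto
  qed
  have outer: "(\<Union>(x, m)\<in>frac y a n. ?g x m (\<pi> b) k) = ?g (\<pi> a) n (\<pi> b) k"
  proof (rule UN_frac [OF y ab(1)])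
    fix c and m l :: nat assume c: "c \<in> carrier R" and l: "y [^] l \<otimes> (y [^] n \<otimes> c \<ominus> y [^] m \<otimes> a) \<in> J"
    have "y [^] l \<otimes> (y [^] (n + k) \<otimes> (y [^] k \<otimes> c \<oplus> y [^] m \<otimes> b)
          \<ominus> y [^] (m + k) \<otimes> (y [^] k \<otimes> a \<oplus> y [^] n \<otimes> b))
       = (y [^] k \<otimes> y [^] k) \<otimes> (y [^] l \<otimes> (y [^] n \<otimes> c \<ominus> y [^] m \<otimes> a))"
      unfolding nat_pow_mult [OF y, symmetric]
      using c ab p [of l] p [of m] p [of k] p [of n] by algebra
    also have "\<dots> \<in> J" using p by (intro J.I_l_closed l) simp
    finally show "?g (\<pi> c) m (\<pi> b) k = ?g (\<pi> a) n (\<pi> b) k"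
      unfolding g [OF c ab(2)] g [OF ab] using c ab p by (subst frac_eq_iff [OF y]) auto
  qed
  have "frac y a n \<oplus>\<^bsub>loc_module R M y\<^esub> frac y b k
      = (\<Union>(x, m)\<in>frac y a n. \<Union>(z, j)\<in>frac y b k. ?g x m z j)"
    by (simp add: loc_module_def)
  also have "\<dots> = (\<Union>(x, m)\<in>frac y a n. ?g x m (\<pi> b) k)"
  proof (rule SUP_cong [OF refl])
    fix w assume w: "w \<in> frac y a n"
    then have "fst w \<in> carrier M" by (auto simp: frac_def loc_frac_def loc_rel_def)
    then obtain c where "fst w = \<pi> c" "c \<in> carrier R" unfolding M_carrier by blast
    then show "(case w of (x, m) \<Rightarrow> \<Union>(z, j)\<in>frac y b k. ?g x m z j) = (case w of (x, m) \<Rightarrow> ?g x m (\<pi> b) k)"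
      using inner [of c "snd w"] by (simp add: case_prod_beta)
  qed
  also have "\<dots> = ?g (\<pi> a) n (\<pi> b) k" by (rule outer)
  also have "\<dots> = frac y (y [^] k \<otimes> a \<oplus> y [^] n \<otimes> b) (n + k)" by (rule g [OF ab])
  finally show ?thesis .
qed

lemma frac_eqI:
  assumes "y \<in> carrier R" "a \<in> carrier R" "b \<in> carrier R" "y [^] k \<otimes> a = y [^] n \<otimes> b"
  shows "frac y a n = frac y b k"
proof -
  have "y [^] (0::nat) \<otimes> (y [^] k \<otimes> a \<ominus> y [^] n \<otimes> b) = \<zero>" using assms by simp
  then show ?thesis using frac_eq_iff [OF assms(1-3), of n k] J.zero_closed by metis
qed

lemma frac_scale:
  assumes "y \<in> carrier R" "a \<in> carrier R" shows "frac y (y [^] m \<otimes> a) (n + m) = frac y a n"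
  using assms by (intro frac_eqI) (auto simp: m_assoc [symmetric] nat_pow_mult)

lemma frac_zero: "y \<in> carrier R \<Longrightarrow> frac y \<zero> n = \<zero>\<^bsub>loc_module R M y\<^esub>"
  using frac_eqI [of y \<zero> \<zero> 0 n] by (simp add: loc_module_def frac_def M_zero)

lemma frac_closed: "y \<in> carrier R \<Longrightarrow> a \<in> carrier R \<Longrightarrow> frac y a n \<in> carrier (loc_module R M y)"
  by (auto simp: loc_carrier)

lemma frac_add_same:
  assumes y: "y \<in> carrier R" and ab: "a \<in> carrier R" "b \<in> carrier R"
  shows "frac y a n \<oplus>\<^bsub>loc_module R M y\<^esub> frac y b n = frac y (a \<oplus> b) n"
proof -
  have "y [^] n \<otimes> a \<oplus> y [^] n \<otimes> b = y [^] n \<otimes> (a \<oplus> b)" using y ab by (simp add: r_distr)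
  then show ?thesis using frac_add [OF y ab, of n n] frac_scale [OF y, of "a \<oplus> b" n n] ab by simp
qed

lemma loc_abelian_group:
  assumes y: "y \<in> carrier R" shows "abelian_group (loc_module R M y)"
proof (rule abelian_groupI)
  let ?L = "loc_module R M y"
  have p: "y [^] i \<in> carrier R" for i :: nat using y by simp
  fix X assume "X \<in> carrier ?L"
  then obtain a n where a: "a \<in> carrier R" "X = frac y a n" using loc_carrier y by auto
  show "\<zero>\<^bsub>?L\<^esub> \<oplus>\<^bsub>?L\<^esub> X = X"
    using frac_add_same [OF y zero_closed a(1), of n] a by (simp add: frac_zero y)
  have "frac y (\<ominus> a) n \<oplus>\<^bsub>?L\<^esub> X = \<zero>\<^bsub>?L\<^esub>"
    using frac_add_same [OF y a_inv_closed [OF a(1)] a(1), of n] a by (simp add: frac_zero y l_neg)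
  then show "\<exists>Y\<in>carrier ?L. Y \<oplus>\<^bsub>?L\<^esub> X = \<zero>\<^bsub>?L\<^esub>" using frac_closed [OF y, of "\<ominus> a" n] a by auto
  fix Y assume "Y \<in> carrier ?L"
  then obtain b k where b: "b \<in> carrier R" "Y = frac y b k" using loc_carrier y by auto
  show "X \<oplus>\<^bsub>?L\<^esub> Y \<in> carrier ?L"
    unfolding a b frac_add [OF y a(1) b(1)] using p a b by (intro frac_closed y) simp
  show "X \<oplus>\<^bsub>?L\<^esub> Y = Y \<oplus>\<^bsub>?L\<^esub> X"
    unfolding a b frac_add [OF y a(1) b(1)] frac_add [OF y b(1) a(1)]
    using p a b by (simp add: a_comm add.commute)
  fix Z assume "Z \<in> carrier ?L"
  then obtain c m where c: "c \<in> carrier R" "Z = frac y c m" using loc_carrier y by auto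
  have e: "y [^] m \<otimes> (y [^] k \<otimes> a \<oplus> y [^] n \<otimes> b) \<oplus> y [^] (n + k) \<otimes> c
      = y [^] (k + m) \<otimes> a \<oplus> y [^] n \<otimes> (y [^] m \<otimes> b \<oplus> y [^] k \<otimes> c)"
    unfolding nat_pow_mult [OF y, symmetric] using a(1) b(1) c(1) p [of k] p [of m] p [of n] by algebra
  have c1: "y [^] k \<otimes> a \<oplus> y [^] n \<otimes> b \<in> carrier R" "y [^] m \<otimes> b \<oplus> y [^] k \<otimes> c \<in> carrier R"
    using p a b c by simp_all
  show "X \<oplus>\<^bsub>?L\<^esub> Y \<oplus>\<^bsub>?L\<^esub> Z = X \<oplus>\<^bsub>?L\<^esub> (Y \<oplus>\<^bsub>?L\<^esub> Z)"
    unfolding a(2) b(2) c(2) frac_add [OF y a(1) b(1)] frac_add [OF y b(1) c(1)]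
      frac_add [OF y c1(1) c(1)] frac_add [OF y a(1) c1(2)] e by (simp add: add.assoc)
qed (use frac_closed [OF y zero_closed] frac_zero [OF y] in metis)

lemma frac_neg:
  assumes y: "y \<in> carrier R" and a: "a \<in> carrier R"
  shows "\<ominus>\<^bsub>loc_module R M y\<^esub> frac y a n = frac y (\<ominus> a) n"
proof -
  interpret L: abelian_group "loc_module R M y" using y by (rule loc_abelian_group)
  show ?thesis
    using frac_add_same [OF y a_inv_closed [OF a] a, of n] frac_closed [OF y a] frac_closed [OF y a_inv_closed [OF a]] a
    by (intro L.minus_equality) (simp_all add: frac_zero y l_neg)
qed

lemma finsum_frac:
  assumes y: "y \<in> carrier R" and B: "finite B" and f: "f \<in> B \<rightarrow> carrier R"
  shows "(\<Oplus>\<^bsub>loc_module R M y\<^esub>b\<in>B. frac y (f b) n) = frac y (\<Oplus>b\<in>B. f b) n"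
  using B f
proof (induction B rule: finite_induct)
  interpret L: abelian_group "loc_module R M y" using y by (rule loc_abelian_group)
  case empty
  then show ?case by (simp add: frac_zero y)
next
  interpret L: abelian_group "loc_module R M y" using y by (rule loc_abelian_group)
  case (insert x B)
  have fx: "f x \<in> carrier R" and fB: "f \<in> B \<rightarrow> carrier R" using insert.prems by auto
  have "(\<Oplus>\<^bsub>loc_module R M y\<^esub>b\<in>insert x B. frac y (f b) n)
      = frac y (f x) n \<oplus>\<^bsub>loc_module R M y\<^esub> (\<Oplus>\<^bsub>loc_module R M y\<^esub>b\<in>B. frac y (f b) n)"
    using insert.hyps fx fB frac_closed [OF y] by (intro L.finsum_insert) auto
  also have "\<dots> = frac y (f x \<oplus> (\<Oplus>b\<in>B. f b)) n"
    unfolding insert.IH [OF fB] using fx fB by (intro frac_add_same y finsum_closed)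
  also have "f x \<oplus> (\<Oplus>b\<in>B. f b) = (\<Oplus>b\<in>insert x B. f b)"
    using insert.hyps fx fB by (intro finsum_insert [symmetric])
  finally show ?case .
qed

lemma loc_res_frac:
  assumes y: "y \<in> carrier R" and z: "z \<in> carrier R" and a: "a \<in> carrier R"
  shows "loc_res R M y z (frac y a n) = frac (y \<otimes> z) (z [^] n \<otimes> a) n"
proof -
  have p: "y [^] i \<in> carrier R" "z [^] i \<in> carrier R" for i :: nat using y z by simp_all
  have g: "loc_frac R M (y \<otimes> z) (z [^] m \<odot>\<^bsub>M\<^esub> \<pi> c) m = frac (y \<otimes> z) (z [^] m \<otimes> c) m"
    if "c \<in> carrier R" for c and m :: nat using that p by (simp add: frac_def M_smult)
  have "(\<Union>(x, m)\<in>frac y a n. loc_frac R M (y \<otimes> z) (z [^] m \<odot>\<^bsub>M\<^esub> x) m)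
      = loc_frac R M (y \<otimes> z) (z [^] n \<odot>\<^bsub>M\<^esub> \<pi> a) n"
  proof (rule UN_frac [OF y a])
    fix b and k l :: nat assume b: "b \<in> carrier R" and l: "y [^] l \<otimes> (y [^] n \<otimes> b \<ominus> y [^] k \<otimes> a) \<in> J"
    have "(y \<otimes> z) [^] l \<otimes> ((y \<otimes> z) [^] n \<otimes> (z [^] k \<otimes> b) \<ominus> (y \<otimes> z) [^] k \<otimes> (z [^] n \<otimes> a))
        = (z [^] l \<otimes> z [^] n \<otimes> z [^] k) \<otimes> (y [^] l \<otimes> (y [^] n \<otimes> b \<ominus> y [^] k \<otimes> a))"
      unfolding nat_pow_distrib [OF y z]
      using a b p(1) [of l] p(1) [of n] p(1) [of k] p(2) [of l] p(2) [of n] p(2) [of k] by algebra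
    also have "\<dots> \<in> J" using p by (intro J.I_l_closed l) simp
    finally show "loc_frac R M (y \<otimes> z) (z [^] k \<odot>\<^bsub>M\<^esub> \<pi> b) k = loc_frac R M (y \<otimes> z) (z [^] n \<odot>\<^bsub>M\<^esub> \<pi> a) n"
      unfolding g [OF a] g [OF b] using a b p y z by (subst frac_eq_iff) auto
  qed
  then show ?thesis unfolding loc_res_def g [OF a] .
qed

text \<open>The restriction meets the extensional product in \<open>cech_module\<close>: values of a
  off the index sets of size k are forgotten, so numerators need agree only there.\<close>

definition coch :: "nat \<Rightarrow> nat \<Rightarrow> (nat set \<Rightarrow> 'a) \<Rightarrow> nat set \<Rightarrow> ('b \<times> nat) set" where
  "coch k n a = (\<lambda>A\<in>cech_index ys k. frac (yprod A) (a A) n)"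

abbreviation "CM \<equiv> cech_module R ys M"

lemma yprodI: "A \<in> cech_index ys k \<Longrightarrow> yprod A \<in> carrier R"
  by (rule yprod_closed [OF cech_indexD(1)])

lemma cochI: "a \<in> cochains \<Longrightarrow> A \<in> cech_index ys k \<Longrightarrow> a A \<in> carrier R"
  by (rule cochainsD [OF _ cech_indexD(1)])

lemma coch_closed: "a \<in> cochains \<Longrightarrow> coch k n a \<in> carrier (CM k)"
  unfolding cech_module_def coch_def by (auto intro!: frac_closed yprodI cochI)

lemma coch_cong: "(\<And>A. A \<in> cech_index ys k \<Longrightarrow> a A = b A) \<Longrightarrow> coch k n a = coch k n b"
  unfolding coch_def by (rule restrict_ext) simp

lemma coch_eq_iff:
  assumes a: "a \<in> cochains" and b: "b \<in> cochains"
  shows "coch k n a = coch k m b \<longleftrightarrow>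
    (\<exists>l::nat. \<forall>A\<in>cech_index ys k. yprod A [^] l \<otimes> (yprod A [^] m \<otimes> a A \<ominus> yprod A [^] n \<otimes> b A) \<in> J)"
    (is "_ \<longleftrightarrow> (\<exists>l. \<forall>A\<in>_. ?Q A l)")
proof -
  have "coch k n a = coch k m b \<longleftrightarrow>
      (\<forall>A\<in>cech_index ys k. frac (yprod A) (a A) n = frac (yprod A) (b A) m)"
    unfolding coch_def by (auto simp: fun_eq_iff restrict_def)
  also have "\<dots> \<longleftrightarrow> (\<forall>A\<in>cech_index ys k. \<exists>l. ?Q A l)"
    by (intro ball_cong refl frac_eq_iff yprodI cochI a b)
  also have "\<dots> \<longleftrightarrow> (\<exists>l. \<forall>A\<in>cech_index ys k. ?Q A l)"
  proof
    assume *: "\<forall>A\<in>cech_index ys k. \<exists>l. ?Q A l"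
    show "\<exists>l. \<forall>A\<in>cech_index ys k. ?Q A l"
    proof (rule finite_uniform_nat [OF finite_cech_index])
      fix A and i j :: nat assume A: "A \<in> cech_index ys k" and i: "?Q A i" "i \<le> j"
      show "?Q A j"
        using yprodI [OF A] cochI [OF a A] cochI [OF b A]
        by (intro pow_mult_mem_ideal_mono [OF J.is_ideal _ _ i]) auto
    qed (use * in blast)
  qed blast
  finally show ?thesis .
qed

lemma coch_scale: "a \<in> cochains \<Longrightarrow> coch k (n + m) (scale m a) = coch k n a"
  unfolding coch_def scale_def by (intro restrict_ext frac_scale yprodI cochI)

text \<open>All large exponents are provided, not just one, so that several cochains can be written
  with the same exponent before they are added.\<close>

lemma ex_coch_ge:
  assumes "c \<in> carrier (CM k)"
  shows "\<exists>n0. \<forall>n\<ge>n0. \<exists>a\<in>cochains. c = coch k n a"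
proof -
  have "\<exists>a n. a \<in> carrier R \<and> c A = frac (yprod A) a n" if A: "A \<in> cech_index ys k" for A
  proof -
    have "c A \<in> carrier (loc_module R M (yprod A))"
      using assms A by (auto simp: cech_module_def)
    then show ?thesis using loc_carrier [OF yprodI [OF A]] by auto
  qed
  then obtain a n where a: "\<And>A. A \<in> cech_index ys k \<Longrightarrow> a A \<in> carrier R"
    "\<And>A. A \<in> cech_index ys k \<Longrightarrow> c A = frac (yprod A) (a A) (n A)" by metis
  \<comment> \<open>The sum bounds every component exponent and, unlike a maximum, also covers an
    empty index set.\<close>
  define n0 where "n0 = sum n (cech_index ys k)"
  have "\<exists>b\<in>cochains. c = coch k m b" if m: "m \<ge> n0" for m
  proof -
    have le: "n A \<le> m" if "A \<in> cech_index ys k" for A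
      using m member_le_sum [OF that, of n] finite_cech_index [of k] unfolding n0_def by auto
    define b where "b A = (if A \<in> cech_index ys k then yprod A [^] (m - n A) \<otimes> a A else \<zero>)" for A
    have "b \<in> cochains" using a(1) by (intro cochainsI) (auto simp: b_def intro: yprodI)
    moreover have "c = coch k m b"
    proof
      fix A
      show "c A = coch k m b A"
      proof (cases "A \<in> cech_index ys k")
        case True
        then show ?thesis
          using frac_scale [OF yprodI [OF True] a(1) [OF True], of "m - n A" "n A"] le [OF True] a(2) [OF True]
          by (simp add: coch_def b_def)
      next
        case False
        then show ?thesis using assms by (auto simp: coch_def cech_module_def PiE_def extensional_def)
      qed
    qed
    ultimately show ?thesis by blast
  qed
  then show ?thesis by blast
qed

lemma ex_coch:
  assumes "c \<in> carrier (CM k)" obtains n a where "a \<in> cochains" "c = coch k n a"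
  using ex_coch_ge [OF assms] by blast

lemma ex_coch2:
  assumes "c \<in> carrier (CM k)" "c' \<in> carrier (CM k)"
  obtains n a a' where "a \<in> cochains" "c = coch k n a" "a' \<in> cochains" "c' = coch k n a'"
proof -
  obtain n0 n1 where "\<forall>n\<ge>n0. \<exists>a\<in>cochains. c = coch k n a" "\<forall>n\<ge>n1. \<exists>a\<in>cochains. c' = coch k n a"
    using ex_coch_ge assms by metis
  then show ?thesis using that by (metis max.cobounded1 max.cobounded2)
qed

lemma coch_add:
  assumes "a \<in> cochains" "b \<in> cochains"
  shows "coch k n a \<oplus>\<^bsub>CM k\<^esub> coch k n b = coch k n (\<lambda>A. a A \<oplus> b A)"
proof -
  have "coch k n a \<oplus>\<^bsub>CM k\<^esub> coch k n b
      = (\<lambda>A\<in>cech_index ys k. coch k n a A \<oplus>\<^bsub>cech_loc R ys M A\<^esub> coch k n b A)"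
    by (simp add: cech_module_def)
  also have "\<dots> = coch k n (\<lambda>A. a A \<oplus> b A)"
    unfolding coch_def
    by (rule restrict_ext) (simp add: frac_add_same yprodI cochI [OF assms(1)] cochI [OF assms(2)])
  finally show ?thesis .
qed

lemma coch_zero: "coch k n (\<lambda>_. \<zero>) = \<zero>\<^bsub>CM k\<^esub>"
proof -
  have "\<zero>\<^bsub>CM k\<^esub> = (\<lambda>A\<in>cech_index ys k. \<zero>\<^bsub>cech_loc R ys M A\<^esub>)" by (simp add: cech_module_def)
  also have "\<dots> = coch k n (\<lambda>_. \<zero>)"
    unfolding coch_def by (rule restrict_ext) (simp add: frac_zero yprodI)
  finally show ?thesis by simp
qed

lemma cochains_add: "a \<in> cochains \<Longrightarrow> b \<in> cochains \<Longrightarrow> (\<lambda>A. a A \<oplus> b A) \<in> cochains"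
  by (auto simp: cochains_def Pi_iff)

lemma cochains_zero: "(\<lambda>_. \<zero>) \<in> cochains"
  by (auto simp: cochains_def)

lemma CM_abelian_group: "abelian_group (CM k)"
proof (rule abelian_groupI)
  show "\<zero>\<^bsub>CM k\<^esub> \<in> carrier (CM k)" using coch_closed [OF cochains_zero, of k 0] coch_zero by simp
  fix c assume c: "c \<in> carrier (CM k)"
  obtain n a where a: "a \<in> cochains" "c = coch k n a" using ex_coch [OF c] .
  show "\<zero>\<^bsub>CM k\<^esub> \<oplus>\<^bsub>CM k\<^esub> c = c"
    unfolding a coch_zero [of k n, symmetric] coch_add [OF cochains_zero a(1)]
    using a by (intro coch_cong) (auto dest: cochI)
  have na: "(\<lambda>A. \<ominus> a A) \<in> cochains" using a(1) by (auto simp: cochains_def Pi_iff)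
  have "coch k n (\<lambda>A. \<ominus> a A) \<oplus>\<^bsub>CM k\<^esub> c = \<zero>\<^bsub>CM k\<^esub>"
    unfolding a coch_zero [of k n, symmetric] coch_add [OF na a(1)]
    using a by (intro coch_cong) (auto dest: cochI simp: l_neg)
  then show "\<exists>c'\<in>carrier (CM k). c' \<oplus>\<^bsub>CM k\<^esub> c = \<zero>\<^bsub>CM k\<^esub>" using coch_closed [OF na] by blast
  fix d assume d: "d \<in> carrier (CM k)"
  obtain m b b' where b: "b \<in> cochains" "c = coch k m b" "b' \<in> cochains" "d = coch k m b'"
    using ex_coch2 [OF c d] .
  show "c \<oplus>\<^bsub>CM k\<^esub> d \<in> carrier (CM k)"
    unfolding b coch_add [OF b(1,3)] by (rule coch_closed [OF cochains_add [OF b(1,3)]])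
  show "c \<oplus>\<^bsub>CM k\<^esub> d = d \<oplus>\<^bsub>CM k\<^esub> c"
    unfolding b coch_add [OF b(1,3)] coch_add [OF b(3,1)]
    using b(1,3) by (intro coch_cong a_comm) (auto dest: cochI)
  fix e assume e: "e \<in> carrier (CM k)"
  obtain m0 m1 m2 where "\<forall>n\<ge>m0. \<exists>a\<in>cochains. c = coch k n a" "\<forall>n\<ge>m1. \<exists>a\<in>cochains. d = coch k n a"
    "\<forall>n\<ge>m2. \<exists>a\<in>cochains. e = coch k n a"
    using ex_coch_ge c d e by metis
  moreover define m where "m = m0 + m1 + m2"
  ultimately obtain u v w where u: "u \<in> cochains" "c = coch k m u" and v: "v \<in> cochains" "d = coch k m v"
    and w: "w \<in> cochains" "e = coch k m w" by (metis le_add1 le_add2 trans_le_add1)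
  show "c \<oplus>\<^bsub>CM k\<^esub> d \<oplus>\<^bsub>CM k\<^esub> e = c \<oplus>\<^bsub>CM k\<^esub> (d \<oplus>\<^bsub>CM k\<^esub> e)"
    unfolding u(2) v(2) w(2) coch_add [OF u(1) v(1)] coch_add [OF v(1) w(1)]
      coch_add [OF cochains_add [OF u(1) v(1)] w(1)] coch_add [OF u(1) cochains_add [OF v(1) w(1)]]
    using u(1) v(1) w(1) by (intro coch_cong a_assoc) (auto dest: cochI)
qed

lemma diff_coch:
  assumes a: "a \<in> cochains"
  shows "cech_diff R ys M k (coch k n a) = coch (Suc k) n (cobound n a)"
  unfolding cech_diff_def coch_def
proof (rule restrict_ext)
  fix B assume B: "B \<in> cech_index ys (Suc k)"
  note B' = cech_indexD [OF B]
  have yB: "yprod B \<in> carrier R" by (rule yprodI [OF B])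
  interpret L: abelian_group "cech_loc R ys M B" by (rule loc_abelian_group [OF yB])
  let ?x = "\<lambda>b. loc_res R M (yprod (B - {b})) (ys ! b)
      ((\<lambda>A\<in>cech_index ys k. frac (yprod A) (a A) n) (B - {b}))"
  have "(\<Oplus>\<^bsub>cech_loc R ys M B\<^esub>b\<in>B.
      let x = ?x b in if even (card {b'\<in>B. b' < b}) then x else \<ominus>\<^bsub>cech_loc R ys M B\<^esub> x)
    = (\<Oplus>\<^bsub>cech_loc R ys M B\<^esub>b\<in>B. frac (yprod B) (sgn B b \<otimes> ((ys ! b) [^] n \<otimes> a (B - {b}))) n)"
  proof (rule L.finsum_cong' [OF refl])
    show "(\<lambda>b. frac (yprod B) (sgn B b \<otimes> ((ys ! b) [^] n \<otimes> a (B - {b}))) n)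
        \<in> B \<rightarrow> carrier (cech_loc R ys M B)"
      using cobound_summand [OF a B'(1)] frac_closed [OF yB] by blast
    fix b assume b: "b \<in> B"
    have i: "B - {b} \<in> cech_index ys k" by (rule cech_index_Diff [OF B b])
    have c: "ys ! b \<in> carrier R" "a (B - {b}) \<in> carrier R" using b B' cochI [OF a i] by auto
    have x: "?x b = frac (yprod B) ((ys ! b) [^] n \<otimes> a (B - {b})) n"
      using i c loc_res_frac [OF yprodI [OF i] c] yprod_insert [OF B'(1) b] by simp
    show "(let x = ?x b in if even (card {b'\<in>B. b' < b}) then x else \<ominus>\<^bsub>cech_loc R ys M B\<^esub> x)
      = frac (yprod B) (sgn B b \<otimes> ((ys ! b) [^] n \<otimes> a (B - {b}))) n"
      unfolding x Let_def using c by (simp add: sgn_def frac_neg yB l_minus)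
  qed
  also have "\<dots> = frac (yprod B) (cobound n a B) n"
    unfolding cobound_def by (rule finsum_frac [OF yB B'(2) cobound_summand [OF a B'(1)]])
  finally show "(\<Oplus>\<^bsub>cech_loc R ys M B\<^esub>b\<in>B.
      let x = ?x b in if even (card {b'\<in>B. b' < b}) then x else \<ominus>\<^bsub>cech_loc R ys M B\<^esub> x)
    = frac (yprod B) (cobound n a B) n" .
qed

lemma coch_cocycle_iff:
  assumes a: "a \<in> cochains"
  shows "coch k n a \<in> cech_cocycles R ys M k \<longleftrightarrow> is_cocycle J k n a"
proof -
  have "coch (Suc k) n (cobound n a) = coch (Suc k) 0 (\<lambda>_. \<zero>) \<longleftrightarrow> is_cocycle J k n a"
    unfolding coch_eq_iff [OF cobound_cochain [OF a] cochains_zero] is_cocycle_def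
  proof (intro ex_cong1 ball_cong refl)
    fix l :: nat and B assume B: "B \<in> cech_index ys (Suc k)"
    have "yprod B [^] (0::nat) \<otimes> cobound n a B \<ominus> yprod B [^] n \<otimes> \<zero> = cobound n a B"
      using yprodI [OF B] cochI [OF cobound_cochain [OF a] B] by (simp add: minus_eq)
    then show "(yprod B [^] l \<otimes> (yprod B [^] (0::nat) \<otimes> cobound n a B \<ominus> yprod B [^] n \<otimes> \<zero>) \<in> J)
      = (yprod B [^] l \<otimes> cobound n a B \<in> J)" by simp
  qed
  then show ?thesis
    using coch_closed [OF a] by (simp add: cech_cocycles_def diff_coch [OF a] coch_zero)
qed

lemma coch_coboundary_iff:
  assumes a: "a \<in> cochains"
  shows "coch k n a \<in> cech_coboundaries R ys M k \<longleftrightarrow> is_coboundary J k n a"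
proof (cases k)
  case 0
  have c0: "cobound i b {} = \<zero>" for i b by (simp add: cobound_def)
  have i0: "cech_index ys 0 = {{}}" by (auto simp: cech_index_def finite_subset [of _ "{..<length ys}"])
  have "coch 0 n a = coch 0 0 (\<lambda>_. \<zero>) \<longleftrightarrow> is_coboundary J 0 n a"
    unfolding coch_eq_iff [OF a cochains_zero] is_coboundary_def i0
    using cochains_zero cochainsD [OF a, of "{}"] yprod_closed [of "{}"]
    by (auto simp: c0 minus_eq)
  then show ?thesis using 0 by (simp add: cech_coboundaries_def coch_zero)
next
  case (Suc k')
  have "coch k n a \<in> cech_diff R ys M k' ` carrier (CM k') \<longleftrightarrow> is_coboundary J k n a"
  proof
    assume "coch k n a \<in> cech_diff R ys M k' ` carrier (CM k')"
    then obtain c where c: "c \<in> carrier (CM k')" "coch k n a = cech_diff R ys M k' c" by blast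
    obtain m b where b: "b \<in> cochains" "c = coch k' m b" using ex_coch [OF c(1)] .
    have "coch k n a = coch k m (cobound m b)" using c(2) diff_coch [OF b(1)] b(2) Suc by simp
    then obtain l :: nat where l: "\<And>A. A \<in> cech_index ys k \<Longrightarrow>
        yprod A [^] l \<otimes> (yprod A [^] m \<otimes> a A \<ominus> yprod A [^] n \<otimes> cobound m b A) \<in> J"
      unfolding coch_eq_iff [OF a cobound_cochain [OF b(1)]] by blast
    \<comment> \<open>Equality of a / y^n and d b / y^m gives y^l (y^m a - y^n d b) in J. Expanding
      b by l + n produces the form of \<open>is_coboundary\<close> with l + m in place of m, because
      n + (l + m) = m + (l + n).\<close>
    have "yprod A [^] (l + m) \<otimes> a A \<ominus> cobound (n + (l + m)) (scale (l + n) b) A \<in> J"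
      if A: "A \<in> cech_index ys k" for A
    proof -
      have p: "yprod A [^] i \<in> carrier R" for i :: nat using yprodI [OF A] by simp
      have e: "n + (l + m) = m + (l + n)" by simp
      have "yprod A [^] (l + m) \<otimes> a A \<ominus> cobound (n + (l + m)) (scale (l + n) b) A
        = yprod A [^] l \<otimes> (yprod A [^] m \<otimes> a A \<ominus> yprod A [^] n \<otimes> cobound m b A)"
        unfolding e cobound_scale [OF b(1) cech_indexD(1) [OF A]] nat_pow_mult [OF yprodI [OF A], symmetric]
        using p [of l] p [of m] p [of n] cochI [OF a A] cochI [OF cobound_cochain [OF b(1)] A, of m]
        by algebra
      then show ?thesis using l [OF A] by simp
    qed
    then show "is_coboundary J k n a" using scale_cochain [OF b(1)] unfolding is_coboundary_def by blast
  next
    assume "is_coboundary J k n a"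
    then obtain m b where b: "b \<in> cochains"
      and *: "\<And>A. A \<in> cech_index ys k \<Longrightarrow> yprod A [^] m \<otimes> a A \<ominus> cobound (n + m) b A \<in> J"
      unfolding is_coboundary_def by blast
    have "coch k (n + m) (scale m a) = coch k (n + m) (cobound (n + m) b)"
      unfolding coch_eq_iff [OF scale_cochain [OF a] cobound_cochain [OF b]]
    proof (intro exI [of _ 0] ballI)
      fix A assume A: "A \<in> cech_index ys k"
      note c = yprodI [OF A, THEN nat_pow_closed, of m] yprodI [OF A, THEN nat_pow_closed, of "n + m"]
        cochI [OF a A] cochI [OF cobound_cochain [OF b] A, of "n + m"]
      have "yprod A [^] (0::nat) \<otimes> (yprod A [^] (n + m) \<otimes> scale m a A \<ominus> yprod A [^] (n + m) \<otimes> cobound (n + m) b A)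
        = yprod A [^] (n + m) \<otimes> (yprod A [^] m \<otimes> a A \<ominus> cobound (n + m) b A)"
        unfolding scale_def nat_pow_0 using c by algebra
      then show "yprod A [^] (0::nat) \<otimes> (yprod A [^] (n + m) \<otimes> scale m a A \<ominus> yprod A [^] (n + m) \<otimes> cobound (n + m) b A) \<in> J"
        using J.I_l_closed [OF * [OF A] c(2)] by simp
    qed
    then have "coch k n a = cech_diff R ys M k' (coch k' (n + m) b)"
      using coch_scale [OF a] diff_coch [OF b] Suc by simp
    then show "coch k n a \<in> cech_diff R ys M k' ` carrier (CM k')" using coch_closed [OF b] by blast
  qed
  then show ?thesis using Suc by (simp add: cech_coboundaries_def)
qed

abbreviation "Cob \<equiv> cech_coboundaries R ys M"

lemma subgroup_coboundaries: "subgroup (Cob k) (add_monoid (CM k))"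
proof (cases k)
  case 0
  interpret C: abelian_group "CM 0" by (rule CM_abelian_group)
  show ?thesis using C.a_group group.triv_subgroup unfolding 0 cech_coboundaries_def by fastforce
next
  case (Suc k')
  have "cech_diff R ys M k' \<in> hom (add_monoid (CM k')) (add_monoid (CM k))"
  proof (rule homI)
    fix c assume "c \<in> carrier (add_monoid (CM k'))"
    then have "c \<in> carrier (CM k')" by simp
    then obtain n a where a: "a \<in> cochains" "c = coch k' n a" by (rule ex_coch)
    show "cech_diff R ys M k' c \<in> carrier (add_monoid (CM k))"
      using coch_closed [OF cobound_cochain [OF a(1)], of k n n] diff_coch [OF a(1)] a(2) Suc by simp
  next
    fix c d assume "c \<in> carrier (add_monoid (CM k'))" "d \<in> carrier (add_monoid (CM k'))"
    then have "c \<in> carrier (CM k')" "d \<in> carrier (CM k')" by simp_all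
    then obtain n a b where ab: "a \<in> cochains" "c = coch k' n a" "b \<in> cochains" "d = coch k' n b"
      by (rule ex_coch2)
    have "cech_diff R ys M k' (c \<oplus>\<^bsub>CM k'\<^esub> d) = coch k n (cobound n (\<lambda>A. a A \<oplus> b A))"
      unfolding ab coch_add [OF ab(1,3)] diff_coch [OF cochains_add [OF ab(1,3)]] Suc ..
    also have "\<dots> = coch k n (\<lambda>B. cobound n a B \<oplus> cobound n b B)"
    proof (rule coch_cong)
      fix B assume B: "B \<in> cech_index ys k"
      have "cobound n (\<lambda>A. a A \<oplus> b A) B = cobound n (\<lambda>A. a A \<oplus> \<one> \<otimes> b A) B"
        using cech_indexD(1) [OF B]
        by (intro cobound_cong cochains_add ab) (auto intro!: l_one [symmetric] arg_cong2 [of _ _ _ _ "(\<oplus>)"] cochainsD [OF ab(3)])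
      then show "cobound n (\<lambda>A. a A \<oplus> b A) B = cobound n a B \<oplus> cobound n b B"
        using cobound_lin [OF ab(1,3) one_closed cech_indexD(1) [OF B]] cochI [OF cobound_cochain [OF ab(3)] B]
        by simp
    qed
    also have "\<dots> = cech_diff R ys M k' c \<oplus>\<^bsub>CM k\<^esub> cech_diff R ys M k' d"
      unfolding ab diff_coch [OF ab(1)] diff_coch [OF ab(3)] Suc
      by (rule coch_add [OF cobound_cochain [OF ab(1)] cobound_cochain [OF ab(3)], symmetric])
    finally show "cech_diff R ys M k' (c \<otimes>\<^bsub>add_monoid (CM k')\<^esub> d)
      = cech_diff R ys M k' c \<otimes>\<^bsub>add_monoid (CM k)\<^esub> cech_diff R ys M k' d" by simp
  qed
  then have "group_hom (add_monoid (CM k')) (add_monoid (CM k)) (cech_diff R ys M k')"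
    by (intro group_hom.intro group_hom_axioms.intro abelian_group.a_group CM_abelian_group)
  from group_hom.img_is_subgroup [OF this] show ?thesis using Suc by (simp add: cech_coboundaries_def)
qed

definition cls :: "nat \<Rightarrow> nat \<Rightarrow> (nat set \<Rightarrow> 'a) \<Rightarrow> (nat set \<Rightarrow> ('b \<times> nat) set) set" where
  "cls k n a = Cob k +>\<^bsub>CM k\<^esub> coch k n a"

lemma cohomology_carrier:
  "carrier (cech_cohomology R ys M k) = {cls k n a | n a. a \<in> cochains \<and> is_cocycle J k n a}"
proof -
  have "carrier (cech_cohomology R ys M k) = (\<lambda>c. Cob k +>\<^bsub>CM k\<^esub> c) ` cech_cocycles R ys M k"
    by (auto simp: cech_cohomology_def quot_module_def A_RCOSETS_def RCOSETS_def a_r_coset_def r_coset_def)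
  also have "cech_cocycles R ys M k = {coch k n a | n a. a \<in> cochains \<and> is_cocycle J k n a}"
  proof
    show "cech_cocycles R ys M k \<subseteq> {coch k n a | n a. a \<in> cochains \<and> is_cocycle J k n a}"
    proof
      fix c assume c: "c \<in> cech_cocycles R ys M k"
      then have "c \<in> carrier (CM k)" by (simp add: cech_cocycles_def)
      then obtain n a where "a \<in> cochains" "c = coch k n a" by (rule ex_coch)
      then show "c \<in> {coch k n a | n a. a \<in> cochains \<and> is_cocycle J k n a}"
        using c coch_cocycle_iff by blast
    qed
  qed (use coch_cocycle_iff in blast)
  finally show ?thesis unfolding cls_def by blast
qed

lemma cls_eq_zero_iff:
  assumes a: "a \<in> cochains"
  shows "cls k n a = \<zero>\<^bsub>cech_cohomology R ys M k\<^esub> \<longleftrightarrow> is_coboundary J k n a"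
proof -
  interpret G: group "add_monoid (CM k)" by (rule abelian_group.a_group [OF CM_abelian_group])
  have c: "coch k n a \<in> carrier (add_monoid (CM k))" using coch_closed [OF a] by simp
  have "cls k n a = Cob k \<longleftrightarrow> coch k n a \<in> Cob k"
    unfolding cls_def a_r_coset_def
    using G.coset_join1 [OF _ c subgroup_coboundaries] G.coset_join2 [OF c subgroup_coboundaries] by blast
  then show ?thesis
    unfolding coch_coboundary_iff [OF a] by (simp add: cech_cohomology_def quot_module_def)
qed

end

text \<open>A finite infimum is a least element, hence attained; a finite HSL number is therefore
  itself an exponent that kills the nilpotent part.\<close>

lemma Inf_enat_mem:
  assumes "Inf S = enat h" shows "enat h \<in> S"
proof -
  have "S \<noteq> {}" using assms by (auto simp: Inf_enat_def)
  then obtain x where "x \<in> S" by blast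
  then have "(LEAST x. x \<in> S) \<in> S" by (rule LeastI)
  then show ?thesis using assms \<open>S \<noteq> {}\<close> by (simp add: Inf_enat_def)
qed

section \<open>Maps induced by Frobenius-linear maps\<close>

text \<open>For \<open>e = 0\<close> this covers the projections \<open>R/J \<rightarrow> R/J'\<close>.\<close>

locale cyclic_cech_map = cech_char_p_cring R ys p + M: cyclic_cech R ys J M \<pi> + N: cyclic_cech R ys J' N \<pi>'
  for R :: "('a, 'r) ring_scheme" (structure) and ys :: "'a list" and J :: "'a set"
    and M :: "('a, 'b, 'm) module_scheme" and \<pi> :: "'a \<Rightarrow> 'b"
    and J' :: "'a set" and N :: "('a, 'c, 'n) module_scheme" and \<pi>' :: "'a \<Rightarrow> 'c" and p +
  fixes e :: nat and g :: "'b \<Rightarrow> 'c"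
  assumes g: "r \<in> carrier R \<Longrightarrow> g (\<pi> r) = \<pi>' (r [^] (p ^ e))"
    and frob_JJ': "r \<in> J \<Longrightarrow> r [^] (p ^ e) \<in> J'"
begin

lemma loc_map_frac:
  assumes y: "y \<in> carrier R" and a: "a \<in> carrier R"
  shows "loc_map R N y (p ^ e) g (M.frac y a n) = N.frac y (a [^] (p ^ e)) (p ^ e * n)"
proof -
  have g': "loc_frac R N y (g (\<pi> b)) m = N.frac y (b [^] (p ^ e)) m" if "b \<in> carrier R" for b m
    using g [OF that] by (simp add: N.frac_def)
  have "(\<Union>(x, m)\<in>M.frac y a n. loc_frac R N y (g x) (p ^ e * m)) = loc_frac R N y (g (\<pi> a)) (p ^ e * n)"
  proof (rule M.UN_frac [OF y a])
    fix b and k l :: nat assume b: "b \<in> carrier R" and l: "y [^] l \<otimes> (y [^] n \<otimes> b \<ominus> y [^] k \<otimes> a) \<in> J"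
    have "(y [^] l \<otimes> (y [^] n \<otimes> b \<ominus> y [^] k \<otimes> a)) [^] (p ^ e)
      = y [^] (p ^ e * l) \<otimes> (y [^] (p ^ e * n) \<otimes> b [^] (p ^ e) \<ominus> y [^] (p ^ e * k) \<otimes> a [^] (p ^ e))"
      using y a b by (simp add: nat_pow_distrib frob_minus nat_pow_pow mult.commute)
    then have "y [^] (p ^ e * l) \<otimes> (y [^] (p ^ e * n) \<otimes> b [^] (p ^ e) \<ominus> y [^] (p ^ e * k) \<otimes> a [^] (p ^ e)) \<in> J'"
      using frob_JJ' [OF l] by simp
    then show "loc_frac R N y (g (\<pi> b)) (p ^ e * k) = loc_frac R N y (g (\<pi> a)) (p ^ e * n)"
      unfolding g' [OF a] g' [OF b] using y a b by (subst N.frac_eq_iff) auto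
  qed
  then show ?thesis unfolding loc_map_def g' [OF a] .
qed

lemma cech_map_coch:
  assumes a: "a \<in> cochains"
  shows "cech_map R ys N k (p ^ e) g (M.coch k n a) = N.coch k (p ^ e * n) (frob e a)"
  unfolding cech_map_def N.coch_def
proof (rule restrict_ext)
  fix A assume A: "A \<in> cech_index ys k"
  show "loc_map R N (yprod A) (p ^ e) g (M.coch k n a A) = N.frac (yprod A) (frob e a A) (p ^ e * n)"
    using A loc_map_frac [OF M.yprodI [OF A] M.cochI [OF a A]] by (simp add: M.coch_def frob_def)
qed

lemma cohomology_map_cls:
  assumes a: "a \<in> cochains"
  shows "cohomology_map R ys N k (p ^ e) g (M.cls k n a) = N.cls k (p ^ e * n) (frob e a)"
proof -
  interpret G: group "add_monoid (N.CM k)" by (rule abelian_group.a_group [OF N.CM_abelian_group])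
  interpret GM: group "add_monoid (M.CM k)" by (rule abelian_group.a_group [OF M.CM_abelian_group])
  have const: "N.Cob k +>\<^bsub>N.CM k\<^esub> cech_map R ys N k (p ^ e) g c = N.cls k (p ^ e * n) (frob e a)"
    if c: "c \<in> M.cls k n a" for c
  proof -
    obtain h where h: "h \<in> M.Cob k" "c = h \<oplus>\<^bsub>M.CM k\<^esub> M.coch k n a"
      using c unfolding M.cls_def a_r_coset_def' by blast
    have "h \<in> carrier (M.CM k)" using subgroup.mem_carrier [OF M.subgroup_coboundaries h(1)] by simp
    \<comment> \<open>A representative of the class is a coboundary h plus the given cochain. Both
      are rewritten with one exponent m so that they can be added on numerators.\<close>
    then obtain m b b' where b: "b \<in> cochains" "h = M.coch k m b" "b' \<in> cochains" "M.coch k n a = M.coch k m b'"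
      using M.ex_coch2 [OF _ M.coch_closed [OF a]] by blast
    note fb = frob_cochain [OF b(1), of e] frob_cochain [OF b(3), of e]
    have "cech_map R ys N k (p ^ e) g c = N.coch k (p ^ e * m) (frob e (\<lambda>A. b A \<oplus> b' A))"
      unfolding h(2) b(2,4) M.coch_add [OF b(1,3)] by (rule cech_map_coch [OF M.cochains_add [OF b(1,3)]])
    also have "\<dots> = N.coch k (p ^ e * m) (\<lambda>A. frob e b A \<oplus> frob e b' A)"
      using M.cochI [OF b(1)] M.cochI [OF b(3)] by (intro N.coch_cong) (simp add: frob_def frob_add)
    also have "\<dots> = N.coch k (p ^ e * m) (frob e b) \<oplus>\<^bsub>N.CM k\<^esub> N.coch k (p ^ e * m) (frob e b')"
      by (rule N.coch_add [OF fb, symmetric])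
    \<comment> \<open>Both sides are images of the same cochain under \<open>cech_map\<close>,
      written once with exponent m and once with exponent n; this returns to the original numerators
      a.\<close>
    also have "N.coch k (p ^ e * m) (frob e b') = N.coch k (p ^ e * n) (frob e a)"
      using cech_map_coch [OF a, of k n] cech_map_coch [OF b(3), of k m] b(4) by simp
    finally have eq: "cech_map R ys N k (p ^ e) g c
      = N.coch k (p ^ e * m) (frob e b) \<oplus>\<^bsub>N.CM k\<^esub> N.coch k (p ^ e * n) (frob e a)" .
    have "is_coboundary J' k (p ^ e * m) (frob e b)"
      using is_coboundary_frob [OF frob_JJ' b(1)] M.coch_coboundary_iff [OF b(1)] h(1) b(2) by blast
    then have "N.coch k (p ^ e * m) (frob e b) \<in> N.Cob k" using N.coch_coboundary_iff [OF fb(1)] by blast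
    then have "N.Cob k +>\<^bsub>N.CM k\<^esub> N.coch k (p ^ e * m) (frob e b) = N.Cob k"
      unfolding a_r_coset_def using N.coch_closed [OF fb(1)]
      by (intro G.coset_join2 N.subgroup_coboundaries) simp_all
    then show ?thesis
      unfolding eq N.cls_def a_r_coset_def
      using G.coset_mult_assoc [OF subgroup.subset [OF N.subgroup_coboundaries],
          of "N.coch k (p ^ e * m) (frob e b)" "N.coch k (p ^ e * n) (frob e a)"]
        N.coch_closed [OF fb(1)] N.coch_closed [OF frob_cochain [OF a]] by simp
  qed
  have "M.coch k n a \<in> M.cls k n a"
    unfolding M.cls_def a_r_coset_def
    using GM.rcos_self [OF _ M.subgroup_coboundaries] M.coch_closed [OF a] by simp
  then show ?thesis unfolding cohomology_map_def using const by blast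
qed

end

lemma (in cech_cring) regular_module_cyclic: "cyclic_cech R ys {\<zero>} (regular_module R) (\<lambda>r. r)"
  by (intro cyclic_cech.intro cyclic_cech_axioms.intro cech_cring_axioms zeroideal)
     (auto simp: regular_module_def)

lemma (in cech_cring) ring_mod_ideal_cyclic:
  assumes J: "ideal J R" shows "cyclic_cech R ys J (ring_mod_ideal R J) (\<lambda>r. J +> r)"
proof (intro cyclic_cech.intro cyclic_cech_axioms.intro cech_cring_axioms J)
  fix r s assume rs: "r \<in> carrier R" "s \<in> carrier R"
  have "(J +> r) <+>\<^bsub>regular_module R\<^esub> (J +> s) = (J +> r) <+>\<^bsub>R\<^esub> (J +> s)"
    by (simp add: set_add_def set_mult_def regular_module_def)
  then show "(J +> r) \<oplus>\<^bsub>ring_mod_ideal R J\<^esub> (J +> s) = J +> (r \<oplus> s)"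
    using ideal.a_rcos_sum [OF J rs] by (simp add: quot_module_def)
  show "r \<odot>\<^bsub>ring_mod_ideal R J\<^esub> (J +> s) = J +> (r \<otimes> s)" by (rule ring_mod_ideal_smult [OF J rs])
  show "(J +> r = J +> s) = (r \<ominus> s \<in> J)" by (rule coset_eq_iff [OF J rs])
next
  show "\<zero>\<^bsub>ring_mod_ideal R J\<^esub> = J +> \<zero>"
    using coset_eq_self_iff [OF J zero_closed] additive_subgroup.zero_closed [OF ideal.axioms(1) [OF J]]
    by (simp add: quot_module_def)
qed (rule ring_mod_ideal_carrier)

lemma (in cring) mem_coset_self: "ideal J R \<Longrightarrow> r \<in> carrier R \<Longrightarrow> r \<in> J +> r"
  by (rule abelian_subgroup.a_rcos_self) (rule abelian_subgroupI3 [OF ideal.axioms(1) is_abelian_group])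

section \<open>Projections, relative Frobenius and the Frobenius action in terms of
  numerators\<close>

context cech_char_p_cring
begin

lemma projection_cyclic_map:
  assumes J: "ideal J R" and J': "ideal J' R" and "J \<subseteq> J'"
  shows "cyclic_cech_map R ys J (ring_mod_ideal R J) (\<lambda>r. J +> r)
    J' (ring_mod_ideal R J') (\<lambda>r. J' +> r) p 0 (projection R J')"
proof (intro cyclic_cech_map.intro cyclic_cech_map_axioms.intro ring_mod_ideal_cyclic J J' cech_char_p_cring_axioms)
  fix r assume r: "r \<in> carrier R"
  have "J' +> x = J' +> r" if x: "x \<in> J +> r" for x
  proof -
    obtain u where u: "u \<in> J" "x = u \<oplus> r" using x by (auto simp: a_r_coset_def')
    have uC: "u \<in> carrier R" using ideal.Icarr [OF J u(1)] .
    have "(u \<oplus> r) \<ominus> r = u" using uC r by algebra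
    then have "x \<ominus> r \<in> J'" using u assms(3) by auto
    then show ?thesis using coset_eq_iff [OF J', of x r] u(2) uC r by simp
  qed
  moreover have "r \<in> J +> r" using mem_coset_self [OF J r] .
  ultimately have "projection R J' (J +> r) = J' +> r" unfolding projection_def by blast
  then show "projection R J' (J +> r) = J' +> (r [^] (p ^ 0))" using r by simp
next
  fix r assume "r \<in> J"
  then show "r [^] (p ^ 0) \<in> J'" using assms(3) ideal.Icarr [OF J] by auto
qed

lemma relative_frobenius_cyclic_map:
  assumes J: "ideal J R"
  shows "cyclic_cech_map R ys J (ring_mod_ideal R J) (\<lambda>r. J +> r)
    (frobenius_power R J (p ^ e)) (ring_mod_ideal R (frobenius_power R J (p ^ e)))
    (\<lambda>r. frobenius_power R J (p ^ e) +> r) p e (relative_frobenius R J (p ^ e))"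
proof -
  let ?F = "frobenius_power R J (p ^ e)"
  have JC: "J \<subseteq> carrier R" using ideal.Icarr [OF J] by blast
  have F: "ideal ?F R" by (rule ideal_frobenius_power [OF JC])
  show ?thesis
  proof (intro cyclic_cech_map.intro cyclic_cech_map_axioms.intro ring_mod_ideal_cyclic J F cech_char_p_cring_axioms)
    fix r assume r: "r \<in> carrier R"
    have "?F +> x [^] (p ^ e) = ?F +> r [^] (p ^ e)" if x: "x \<in> J +> r" for x
    proof -
      obtain u where u: "u \<in> J" "x = u \<oplus> r" using x by (auto simp: a_r_coset_def')
      have uC: "u \<in> carrier R" using ideal.Icarr [OF J u(1)] .
      have "(a \<oplus> b) \<ominus> b = a" if "a \<in> carrier R" "b \<in> carrier R" for a b using that by algebra
      then have "x [^] (p ^ e) \<ominus> r [^] (p ^ e) \<in> ?F"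
        using frobenius_power_mem [OF JC u(1)] uC r unfolding u(2) by (simp add: frob_add)
      then show ?thesis using coset_eq_iff [OF F, of "x [^] (p ^ e)" "r [^] (p ^ e)"] u(2) uC r by simp
    qed
    moreover have "r \<in> J +> r" using mem_coset_self [OF J r] .
    ultimately show "relative_frobenius R J (p ^ e) (J +> r) = ?F +> r [^] (p ^ e)"
      unfolding relative_frobenius_def by blast
  qed (rule frobenius_power_mem [OF JC])
qed

lemma frobenius_action_cyclic_map:
  "cyclic_cech_map R ys {\<zero>} (regular_module R) (\<lambda>r. r) {\<zero>} (regular_module R) (\<lambda>r. r) p 1 (\<lambda>x. x [^] p)"
proof (intro cyclic_cech_map.intro cyclic_cech_map_axioms.intro regular_module_cyclic cech_char_p_cring_axioms)
  fix r assume "r \<in> {\<zero>}"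
  then show "r [^] (p ^ 1) \<in> {\<zero>}" using frob_zero [of 1] by simp
qed simp

text \<open>The i-th iterate of the action sends the class of a / y^n to that of
  \<open>frob i a\<close> over y^(p^i n). So nilpotence of the class becomes a coboundary condition,
  and the attained infimum gives the uniform exponent h.\<close>

lemma HSL_kills:
  assumes hsl: "HSL (cech_cohomology R ys (regular_module R) k) (frobenius_action R ys p k) = enat h"
    and a: "a \<in> cochains" "is_cocycle {\<zero>} k n a" "is_coboundary {\<zero>} k (p ^ f * n) (frob f a)"
  shows "is_coboundary {\<zero>} k (p ^ h * n) (frob h a)"
proof -
  interpret F: cyclic_cech_map R ys "{\<zero>}" "regular_module R" "\<lambda>r. r" "{\<zero>}" "regular_module R" "\<lambda>r. r" p 1 "\<lambda>x. x [^] p"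
    by (rule frobenius_action_cyclic_map)
  let ?H = "cech_cohomology R ys (regular_module R) k" and ?f = "frobenius_action R ys p k"
  have iter: "(?f ^^ i) (F.M.cls k n a) = F.M.cls k (p ^ i * n) (frob i a)" for i
  proof (induction i)
    case 0
    have "F.M.coch k n a = F.M.coch k n (frob 0 a)"
      using F.M.cochI [OF a(1)] by (intro F.M.coch_cong) (simp add: frob_def)
    then show ?case by (simp add: F.M.cls_def)
  next
    case (Suc i)
    have "(?f ^^ Suc i) (F.M.cls k n a) = F.M.cls k (p ^ 1 * (p ^ i * n)) (frob 1 (frob i a))"
      using F.cohomology_map_cls [OF frob_cochain [OF a(1)], of k "p ^ i * n" i] Suc
      by (simp add: frobenius_action_def)
    also have "F.M.coch k (p ^ 1 * (p ^ i * n)) (frob 1 (frob i a)) = F.M.coch k (p ^ Suc i * n) (frob (Suc i) a)"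
      using frob_frob [OF a(1), of _ k 1 i] by (simp add: mult.assoc) (intro F.M.coch_cong, simp)
    then have "F.M.cls k (p ^ 1 * (p ^ i * n)) (frob 1 (frob i a)) = F.M.cls k (p ^ Suc i * n) (frob (Suc i) a)"
      by (simp add: F.M.cls_def)
    finally show ?case .
  qed
  have "enat h \<in> {enat e | e. \<forall>x\<in>nilpotent_part ?H ?f. (?f ^^ e) x = \<zero>\<^bsub>?H\<^esub>}"
    by (rule Inf_enat_mem [OF hsl [unfolded HSL_def]])
  then have h: "\<And>x. x \<in> nilpotent_part ?H ?f \<Longrightarrow> (?f ^^ h) x = \<zero>\<^bsub>?H\<^esub>" by auto
  have "F.M.cls k n a \<in> carrier ?H" unfolding F.M.cohomology_carrier using a by blast
  moreover have "(?f ^^ f) (F.M.cls k n a) = \<zero>\<^bsub>?H\<^esub>"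
    unfolding iter F.M.cls_eq_zero_iff [OF frob_cochain [OF a(1)]] by (rule a(3))
  ultimately have "(?f ^^ h) (F.M.cls k n a) = \<zero>\<^bsub>?H\<^esub>" by (intro h) (auto simp: nilpotent_part_def)
  then show ?thesis unfolding iter F.M.cls_eq_zero_iff [OF frob_cochain [OF a(1)]] .
qed

lemma relative_frobenius_closure_iff:
  assumes J: "ideal J R" and a: "a \<in> cochains" "is_cocycle J k n a"
  shows "cyclic_cech.cls R ys (ring_mod_ideal R J) (\<lambda>r. J +> r) k n a \<in> relative_frobenius_closure R ys p k J
    \<longleftrightarrow> (\<exists>e. is_coboundary (frobenius_power R J (p ^ e)) k (p ^ e * n) (frob e a))"
proof -
  interpret M: cyclic_cech R ys J "ring_mod_ideal R J" "\<lambda>r. J +> r" by (rule ring_mod_ideal_cyclic [OF J])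
  have "cohomology_map R ys (ring_mod_ideal R (frobenius_power R J (p ^ e))) k (p ^ e)
      (relative_frobenius R J (p ^ e)) (M.cls k n a)
    = \<zero>\<^bsub>cech_cohomology R ys (ring_mod_ideal R (frobenius_power R J (p ^ e))) k\<^esub>
    \<longleftrightarrow> is_coboundary (frobenius_power R J (p ^ e)) k (p ^ e * n) (frob e a)" for e
  proof -
    interpret F: cyclic_cech_map R ys J "ring_mod_ideal R J" "\<lambda>r. J +> r"
      "frobenius_power R J (p ^ e)" "ring_mod_ideal R (frobenius_power R J (p ^ e))"
      "\<lambda>r. frobenius_power R J (p ^ e) +> r" p e "relative_frobenius R J (p ^ e)"
      by (rule relative_frobenius_cyclic_map [OF J])
    show ?thesis unfolding F.cohomology_map_cls [OF a(1)] by (rule F.N.cls_eq_zero_iff [OF frob_cochain [OF a(1)]])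
  qed
  moreover have "M.cls k n a \<in> carrier (cech_cohomology R ys (ring_mod_ideal R J) k)"
    unfolding M.cohomology_carrier using a by blast
  ultimately show ?thesis unfolding relative_frobenius_closure_def Let_def by simp
qed

text \<open>The projection keeps numerators and denominators, so the class of a over J' is the
  \<alpha>-image of its class over J. Vanishing after f iterations puts this image into the closure
  over J', and \<open>eq\<close> pulls membership back to J. The resulting g exists without any
  bound.\<close>

lemma descent_of_closure_eq:
  assumes J: "ideal J R" and J': "ideal J' R" "J \<subseteq> J'" and a: "a \<in> cochains" "is_cocycle J k n a"
    and eq: "{\<xi> \<in> carrier (cech_cohomology R ys (ring_mod_ideal R J) k).
         cohomology_map R ys (ring_mod_ideal R J') k 1 (projection R J') \<xi>
           \<in> relative_frobenius_closure R ys p k J'}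
      = relative_frobenius_closure R ys p k J"
    and cob: "is_coboundary (frobenius_power R J' (p ^ f)) k (p ^ f * n) (frob f a)"
  shows "\<exists>g. is_coboundary (frobenius_power R J (p ^ g)) k (p ^ g * n) (frob g a)"
proof -
  interpret F: cyclic_cech_map R ys J "ring_mod_ideal R J" "\<lambda>r. J +> r"
    J' "ring_mod_ideal R J'" "\<lambda>r. J' +> r" p 0 "projection R J'"
    by (rule projection_cyclic_map [OF J J'])
  have "F.N.coch k n (frob 0 a) = F.N.coch k n a"
    using F.M.cochI [OF a(1)] by (intro F.N.coch_cong) (simp add: frob_def)
  then have "cohomology_map R ys (ring_mod_ideal R J') k 1 (projection R J') (F.M.cls k n a) = F.N.cls k n a"
    using F.cohomology_map_cls [OF a(1), of k n] by (simp add: F.N.cls_def)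
  moreover have "F.N.cls k n a \<in> relative_frobenius_closure R ys p k J'"
    using relative_frobenius_closure_iff [OF J'(1) a(1) is_cocycle_mono [OF J'(2) a(2)]] cob by blast
  moreover have "F.M.cls k n a \<in> carrier (cech_cohomology R ys (ring_mod_ideal R J) k)"
    unfolding F.M.cohomology_carrier using a by blast
  ultimately have "F.M.cls k n a \<in> relative_frobenius_closure R ys p k J" unfolding eq [symmetric] by simp
  then show ?thesis using relative_frobenius_closure_iff [OF J a] by blast
qed

text \<open>In degree 0 the only index set is empty, its product y is one, and there is no lower
  degree to take a differential from.\<close>

lemma is_coboundary_0_iff:
  assumes "ideal J R" "a \<in> cochains" shows "is_coboundary J 0 n a \<longleftrightarrow> a {} \<in> J"
proof -
  have i0: "cech_index ys 0 = {{}}" by (auto simp: cech_index_def finite_subset [of _ "{..<length ys}"])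
  have aC: "a {} \<in> carrier R" using cochainsD [OF assms(2)] by simp
  have "(\<lambda>_. \<zero>) \<in> cochains" by (auto simp: cochains_def)
  then show ?thesis using aC by (auto simp: is_coboundary_def i0 cobound_def cech_elt_def minus_eq)
qed

end

section \<open>The bound on the Frobenius test exponent\<close>

lemma sum_enat: "(\<Sum>k\<in>S. enat (f k)) = enat (\<Sum>k\<in>S. f k)"
  by (induction S rule: infinite_finite_induct) (simp_all add: zero_enat_def)

section \<open>The ideals q_i^[p^e] of a filter regular sequence\<close>

locale local_cech_char_p = noetherian_local_ring R \<mm> + cech_char_p_cring R ys p
  for R :: "('a, 'r) ring_scheme" (structure) and \<mm> and ys :: "'a list" and p +
  assumes ys_radical: "radical R (Idl (set ys)) = \<mm>"
begin

lemma ys_subset: "set ys \<subseteq> \<mm>"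
  using genideal_self [OF ys_closed] radical_subset_max_ideal [OF genideal_ideal [OF ys_closed] ys_radical] by blast

definition frob_ideal :: "'a list \<Rightarrow> nat \<Rightarrow> nat \<Rightarrow> 'a set" where
  "frob_ideal xs i e = frobenius_power R (Idl (set (take i xs))) (p ^ e)"

context
  fixes xs assumes xs_filter_regular: "filter_regular R \<mm> xs"
begin

lemma xs_closed: "set xs \<subseteq> carrier R"
  using xs_filter_regular max_ideal_subset by (auto simp: filter_regular_def)

lemma take_closed: "set (take i xs) \<subseteq> carrier R"
  using xs_closed set_take_subset by fast

lemma Idl_take_closed: "Idl (set (take i xs)) \<subseteq> carrier R"
  using ideal.Icarr [OF genideal_ideal [OF take_closed]] by blast

lemma frob_ideal_ideal: "ideal (frob_ideal xs i e) R"
  unfolding frob_ideal_def by (rule ideal_frobenius_power [OF Idl_take_closed])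

lemma frob_ideal_eq: "frob_ideal xs i e = Idl ((\<lambda>x. x [^] (p ^ e)) ` set (take i xs))"
  unfolding frob_ideal_def by (rule frobenius_power_Idl [OF take_closed])

lemma frob_ideal_power: "frobenius_power R (frob_ideal xs i e) (p ^ f) = frob_ideal xs i (e + f)"
  unfolding frob_ideal_def by (rule frobenius_power_frobenius_power [OF Idl_take_closed])

lemma frob_ideal_mem: "r \<in> frob_ideal xs i e \<Longrightarrow> r [^] (p ^ f) \<in> frob_ideal xs i (e + f)"
  unfolding frob_ideal_power [symmetric]
  by (rule frobenius_power_mem) (auto intro: ideal.Icarr [OF frob_ideal_ideal])

lemma frob_ideal_0: "frob_ideal xs 0 e = {\<zero>}"
  unfolding frob_ideal_eq by (simp add: Idl_empty)

lemma frob_ideal_Suc: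
  assumes "i < length xs"
  shows "frob_ideal xs (Suc i) e = Idl (insert ((xs ! i) [^] (p ^ e)) (frob_ideal xs i e))"
proof -
  have x: "xs ! i \<in> carrier R" using assms xs_closed by auto
  have c: "(\<lambda>x. x [^] (p ^ e)) ` set (take i xs) \<subseteq> carrier R" using take_closed by auto
  have "frob_ideal xs (Suc i) e = Idl ((\<lambda>x. x [^] (p ^ e)) ` set (take i xs) \<union> {(xs ! i) [^] (p ^ e)})"
    unfolding frob_ideal_eq take_Suc_conv_app_nth [OF assms] by simp
  also have "\<dots> = Idl (Idl ((\<lambda>x. x [^] (p ^ e)) ` set (take i xs)) \<union> {(xs ! i) [^] (p ^ e)})"
    by (rule Idl_Un_Idl [OF c, symmetric]) (use x in simp)
  finally show ?thesis unfolding frob_ideal_eq by simp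
qed

text \<open>Each y in \<open>ys\<close> lies in \<mm>, so \<open>xs\<close> is regular after
  inverting y, and so is the sequence of p^e-th powers. Its i-th regularity condition is the
  required torsion statement.\<close>

lemma frob_ideal_torsion:
  assumes i: "i < length xs"
  shows "colon_torsion (frob_ideal xs i e) ((xs ! i) [^] (p ^ e))"
  unfolding colon_torsion_def
proof (intro ballI impI)
  fix y r assume y: "y \<in> set ys" and r: "r \<in> carrier R" and m: "(xs ! i) [^] (p ^ e) \<otimes> r \<in> frob_ideal xs i e"
  let ?zs = "map (\<lambda>x. x [^] (p ^ e)) xs"
  have yC: "y \<in> carrier R" using y ys_closed by blast
  have zs: "set ?zs \<subseteq> carrier R" using xs_closed by auto
  have c: "(\<lambda>x. x [^] (p ^ e)) ` set (take i xs) \<subseteq> carrier R" using take_closed by auto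
  have "regseq y {\<zero>} ?zs"
    by (rule regseq_map_pow [OF yC p_pow_pos zeroideal xs_closed])
       (rule filter_regular_imp_regseq [OF xs_filter_regular max_ideal_subset], use y ys_subset in blast)
  moreover have "Idl ({\<zero>} \<union> set (take i ?zs)) = frob_ideal xs i e"
  proof -
    have "set (take i ?zs) = (\<lambda>x. x [^] (p ^ e)) ` set (take i xs)" by (simp add: take_map)
    then show ?thesis
      using Idl_Un_Idl [OF empty_subsetI c] unfolding frob_ideal_eq Idl_empty by simp
  qed
  moreover have "?zs ! i = (xs ! i) [^] (p ^ e)" using i by simp
  moreover have "(xs ! i) [^] (p ^ e) \<otimes> r \<in> sat y (frob_ideal xs i e)"
    using m sat_subset [OF frob_ideal_ideal] by blast
  ultimately show "r \<in> sat y (frob_ideal xs i e)"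
    using regseq_iff_nth [OF zeroideal zs] i r by (metis length_map)
qed

end

text \<open>Each y_B here lies in \<mm>, so y_B^m is in Q for some m and y_B^(m p^e) is in Q^[p^e].
  Hence R/Q^[p^e] vanishes after inverting y_B, and H^0 is the whole quotient.\<close>

lemma degree_0_cocycle:
  assumes Q: "ideal Q R" "radical R Q = \<mm>" and r: "r \<in> carrier R"
  shows "is_cocycle (frobenius_power R Q (p ^ e)) 0 0 (\<lambda>_. r)"
proof -
  have QC: "Q \<subseteq> carrier R" using ideal.Icarr [OF Q(1)] by blast
  let ?F = "frobenius_power R Q (p ^ e)"
  have F: "ideal ?F R" by (rule ideal_frobenius_power [OF QC])
  have a: "(\<lambda>_. r) \<in> cochains" using r by (auto simp: cochains_def)
  have "\<exists>l. \<forall>B\<in>cech_index ys (Suc 0). yprod B [^] (l::nat) \<otimes> cobound 0 (\<lambda>_. r) B \<in> ?F"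
  proof (rule finite_uniform_nat [OF finite_cech_index])
    fix B assume B: "B \<in> cech_index ys (Suc 0)"
    note B' = cech_indexD [OF B]
    obtain b where b: "b \<in> B" using B' by fastforce
    have "yprod (B - {b}) \<in> carrier R" using B' by (intro yprod_closed) blast
    moreover have "ys ! b \<in> \<mm>" using b B'(1) ys_subset nth_mem [of b ys] by blast
    ultimately have "yprod B \<in> \<mm>"
      unfolding yprod_insert [OF B'(1) b]
      by (intro ideal.I_l_closed [OF maximalideal.axioms(1) [OF maximal]])
    then obtain m :: nat where m: "yprod B [^] m \<in> Q" unfolding Q(2) [symmetric] radical_def by blast
    have yB: "yprod B \<in> carrier R" by (rule yprod_closed [OF B'(1)])
    have "yprod B [^] (m * p ^ e) \<in> ?F"
      using frobenius_power_mem [OF QC m, of "p ^ e"] yB by (simp add: nat_pow_pow)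
    then have "yprod B [^] (m * p ^ e) \<otimes> cobound 0 (\<lambda>_. r) B \<in> ?F"
      by (rule ideal.I_r_closed [OF F _ cobound_closed [OF a B'(1)]])
    then show "\<exists>l. yprod B [^] (l::nat) \<otimes> cobound 0 (\<lambda>_. r) B \<in> ?F" by blast
  next
    fix B and i j :: nat
    assume B: "B \<in> cech_index ys (Suc 0)" and i: "yprod B [^] i \<otimes> cobound 0 (\<lambda>_. r) B \<in> ?F" "i \<le> j"
    show "yprod B [^] j \<otimes> cobound 0 (\<lambda>_. r) B \<in> ?F"
      by (rule pow_mult_mem_ideal_mono [OF F yprod_closed [OF cech_indexD(1) [OF B]]
            cobound_closed [OF a cech_indexD(1) [OF B]] i])
  qed
  then show ?thesis unfolding is_cocycle_def .
qed

end

theorem theorem3p1: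
  fixes R :: "('a, 'r) ring_scheme" (structure)
    and \<mm> :: "'a set" and ys :: "'a list" and p d e0 :: nat
  assumes "noetherian_local_ring R \<mm>"
    and "Factorial_Ring.prime p" and "[p] \<cdot> \<one> = \<zero>"
    and "krull_dim R = enat d"
    and "set ys \<subseteq> carrier R" and "radical R (Idl (set ys)) = \<mm>"
    and "\<And>e xs i j J J'.
      e \<ge> e0 \<Longrightarrow> system_of_parameters R \<mm> xs \<Longrightarrow> filter_regular R \<mm> xs \<Longrightarrow>
      i \<ge> 1 \<Longrightarrow> i + j \<le> d \<Longrightarrow>
      J = frobenius_power R (Idl (set (take (i - 1) xs))) (p ^ e) \<Longrightarrow>
      J' = frobenius_power R (Idl (set (take i xs))) (p ^ e) \<Longrightarrow>
      {\<xi> \<in> carrier (cech_cohomology R ys (ring_mod_ideal R J) j).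
         cohomology_map R ys (ring_mod_ideal R J') j 1 (projection R J') \<xi>
           \<in> relative_frobenius_closure R ys p j J'}
      = relative_frobenius_closure R ys p j J"
  shows "Fte R \<mm> p \<le> enat e0 +
    (\<Sum>k=0..d. of_nat (d choose k) *
       HSL (cech_cohomology R ys (regular_module R) k) (frobenius_action R ys p k))"
proof -
  interpret noetherian_local_ring R \<mm> by fact
  interpret local_cech_char_p R \<mm> ys p
    using assms(2,3,5,6) by unfold_locales
  let ?HSL = "\<lambda>k. HSL (cech_cohomology R ys (regular_module R) k) (frobenius_action R ys p k)"
  show ?thesis
  proof (cases "\<exists>k\<le>d. ?HSL k = \<infinity>")
    case True
    then obtain k where k: "k \<le> d" "?HSL k = \<infinity>" by blast
    \<comment> \<open>In \<open>enat\<close> the product of 0 and \<infinity> is 0; the coefficient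
      must be nonzero for the summand, and with it the bound, to be infinite.\<close>
    have "(of_nat (d choose k) :: enat) \<noteq> 0" using k(1) by (simp add: of_nat_eq_enat zero_enat_def)
    then have "of_nat (d choose k) * ?HSL k = \<infinity>" unfolding k(2) by (simp add: imult_is_infinity)
    moreover have "of_nat (d choose k) * ?HSL k \<le> (\<Sum>k=0..d. of_nat (d choose k) * ?HSL k)"
      using k(1) by (intro member_le_sum) auto
    ultimately have "\<infinity> \<le> (\<Sum>k=0..d. of_nat (d choose k) * ?HSL k)" by (rule subst)
    then show ?thesis by (simp only: enat_ord_simps plus_enat_simps)
  next
    case False
    define h where "h k = the_enat (?HSL k)" for k
    have h: "?HSL k = enat (h k)" if "k \<le> d" for k
      using False that unfolding h_def by (cases "?HSL k") auto
    define E where "E = killing_exponent h d 0"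
    have "(\<Sum>k=0..d. of_nat (d choose k) * ?HSL k) = (\<Sum>k=0..d. enat ((d choose k) * h k))"
      by (intro sum.cong refl) (simp add: h of_nat_eq_enat)
    also have "\<dots> = enat E"
      unfolding sum_enat E_def killing_exponent_eq by (simp add: atLeast0AtMost)
    finally have sum_eq: "(\<Sum>k=0..d. of_nat (d choose k) * ?HSL k) = enat E" .
    have "frobenius_power R (frobenius_closure R p Q) (p ^ (e0 + E)) = frobenius_power R Q (p ^ (e0 + E))"
      if pQ: "parameter_ideal R \<mm> Q" for Q
    proof -
      obtain xs where sop: "system_of_parameters R \<mm> xs" and fr: "filter_regular R \<mm> xs"
        and Q: "Q = Idl (set xs)" using parameter_ideal_filter_regular [OF pQ] by blast
      have len: "length xs = d" and rad: "radical R Q = \<mm>"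
        using sop assms(4) Q by (auto simp: system_of_parameters_def)
      have QI: "ideal Q R" unfolding Q by (rule genideal_ideal [OF xs_closed [OF fr]])
      have QC: "Q \<subseteq> carrier R" using ideal.Icarr [OF QI] by blast
      have Fd: "frob_ideal xs d e = frobenius_power R Q (p ^ e)" for e
        using len by (simp add: frob_ideal_def Q)
      have key: "r [^] (p ^ (e0 + E)) \<in> frobenius_power R Q (p ^ (e0 + E))"
        if "r \<in> frobenius_closure R p Q" for r
      proof -
        obtain f where r: "r \<in> carrier R" and f: "\<And>e. e \<ge> f \<Longrightarrow> r [^] (p ^ e) \<in> frobenius_power R Q (p ^ e)"
          using \<open>r \<in> frobenius_closure R p Q\<close> unfolding frobenius_closure_def by blast
        \<comment> \<open>Raising r to the power p^e0 moves it to level e0, the first at which the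
          hypothesis is available. As a degree 0 class it has denominator exponent 0, which
          Frobenius leaves at 0.\<close>
        let ?a = "\<lambda>_ :: nat set. r [^] (p ^ e0)"
        have a: "?a \<in> cochains" using r by (auto simp: cochains_def)
        have fa: "frob g ?a {} = r [^] (p ^ (e0 + g))" for g
          using r by (simp add: frob_def nat_pow_pow power_add)
        have "is_coboundary (frob_ideal xs d (e0 + killing_exponent h d 0)) 0
          (p ^ killing_exponent h d 0 * 0) (frob (killing_exponent h d 0) ?a)"
        proof (rule killing_exponent_kills [where J = "frob_ideal xs" and x = "(!) xs" and d = d and ?e0.0 = e0 and f = f])
          show "ideal (frob_ideal xs i e) R" for i e by (rule frob_ideal_ideal [OF fr])
          show "s [^] (p ^ g) \<in> frob_ideal xs i (e + g)" if "s \<in> frob_ideal xs i e" for i e g s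
            by (rule frob_ideal_mem [OF fr that])
          show "frob_ideal xs (Suc i) e = Idl (insert ((xs ! i) [^] (p ^ e)) (frob_ideal xs i e))"
            if "i < d" for i e using frob_ideal_Suc [OF fr] that len by blast
          show "xs ! i \<in> carrier R" if "i < d" for i
            using subsetD [OF xs_closed [OF fr] nth_mem] that len by blast
          show "colon_torsion (frob_ideal xs i e) ((xs ! i) [^] (p ^ e))" if "i < d" for i e
            using frob_ideal_torsion [OF fr] that len by blast
          \<comment> \<open>For i = 0 the ideals of all levels are zero, so the relative Frobenius
            is the Frobenius action on H^j(R).\<close>
          show "is_coboundary (frob_ideal xs 0 (e + h j)) j (p ^ h j * n) (frob (h j) b)"
            if "j \<le> d" "b \<in> cochains" "is_cocycle (frob_ideal xs 0 e) j n b"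
              "is_coboundary (frob_ideal xs 0 (e + g)) j (p ^ g * n) (frob g b)" for j e n g b
            using HSL_kills [OF h [OF that(1)] that(2), of n g] that(3,4) unfolding frob_ideal_0 [OF fr] by blast
          show "\<exists>g'. is_coboundary (frob_ideal xs i (e + g')) j (p ^ g' * n) (frob g' b)"
            if "e0 \<le> e" "Suc i + j \<le> d" "b \<in> cochains" "is_cocycle (frob_ideal xs i e) j n b"
              "is_coboundary (frob_ideal xs (Suc i) (e + g)) j (p ^ g * n) (frob g b)" for i j e n g b
          proof -
            have i: "i < length xs" using that(2) len by simp
            have "frob_ideal xs i e \<subseteq> frob_ideal xs (Suc i) e"
              unfolding frob_ideal_Suc [OF fr i]
              by (rule subset_Idl_insert [OF frob_ideal_ideal [OF fr]]) (rule nat_pow_closed [OF subsetD [OF xs_closed [OF fr] nth_mem [OF i]]])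
            moreover have "{\<xi> \<in> carrier (cech_cohomology R ys (ring_mod_ideal R (frob_ideal xs i e)) j).
                cohomology_map R ys (ring_mod_ideal R (frob_ideal xs (Suc i) e)) j 1
                    (projection R (frob_ideal xs (Suc i) e)) \<xi>
                  \<in> relative_frobenius_closure R ys p j (frob_ideal xs (Suc i) e)}
              = relative_frobenius_closure R ys p j (frob_ideal xs i e)"
              by (rule assms(7) [OF that(1) sop fr _ that(2)]) (simp_all add: frob_ideal_def)
            ultimately show ?thesis
              using descent_of_closure_eq [OF frob_ideal_ideal [OF fr] frob_ideal_ideal [OF fr] _ that(3,4)] that(5)
              unfolding frob_ideal_power [OF fr] by blast
          qed
          show "e0 \<le> e0" "d + 0 \<le> d" "?a \<in> cochains" using a by simp_all
          show "is_cocycle (frob_ideal xs d e0) 0 0 ?a"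
            unfolding Fd using r by (intro degree_0_cocycle QI rad) simp
          \<comment> \<open>The f from the Frobenius closure depends on r; it shows only that the
            class is nilpotent, and the induction replaces it by E.\<close>
          show "is_coboundary (frob_ideal xs d (e0 + f)) 0 (p ^ f * 0) (frob f ?a)"
            unfolding Fd is_coboundary_0_iff [OF ideal_frobenius_power [OF QC] frob_cochain [OF a]] fa
            by (rule f) simp
        qed
        then show ?thesis
          unfolding Fd is_coboundary_0_iff [OF ideal_frobenius_power [OF QC] frob_cochain [OF a]] fa E_def .
      qed
      have sub: "Q \<subseteq> frobenius_closure R p Q"
        using frobenius_power_mem [OF QC] QC by (auto simp: frobenius_closure_def)
      have clC: "frobenius_closure R p Q \<subseteq> carrier R" by (auto simp: frobenius_closure_def)
      show ?thesis
      proof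
        show "frobenius_power R (frobenius_closure R p Q) (p ^ (e0 + E)) \<subseteq> frobenius_power R Q (p ^ (e0 + E))"
          unfolding frobenius_power_def [of R "frobenius_closure R p Q"]
          by (rule genideal_minimal [OF ideal_frobenius_power [OF QC]]) (use key in blast)
        show "frobenius_power R Q (p ^ (e0 + E)) \<subseteq> frobenius_power R (frobenius_closure R p Q) (p ^ (e0 + E))"
          unfolding frobenius_power_def [of R Q]
          by (rule genideal_minimal [OF ideal_frobenius_power [OF clC]])
             (use frobenius_power_mem [OF clC] sub in blast)
      qed
    qed
    then have "Fte R \<mm> p \<le> enat (e0 + E)" unfolding Fte_def by (intro Inf_lower) blast
    then show ?thesis unfolding sum_eq by simp
  qed
qed

end
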